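(* Let $\mathbb{E}=(\mathbb{E}_\alpha)_{\alpha>\alpha_*}$ be a scale of Banach spaces. Suppose that for each $n\in\mathbb{N}$ the following hold, with $K$ and $M$ independent of $n$: (S1) $(A^{(n)}(t))_{t\ge0}\subset L(\mathbb{E})$ and $t\mapsto A^{(n)}_{\alpha\alpha'}(t)\in L(\mathbb{E}_\alpha,\mathbb{E}_{\alpha'})$ is continuous in the operator norm topology for all $\alpha'<\alpha$. (S2) $(V^{(n)}(t,s))_{t\ge s\ge0}\subset L(\mathbb{E})$ satisfies (A2) and (A3) for the operators $(A^{(n)}(t))_{t\ge0}$, and there is a constant $K\ge1$ with $\|V^{(n)}_{\alpha\alpha'}(t,s)\|_{\alpha\alpha'}\le K$ for all $0\le s\le t$, $\alpha'<\alpha$, $n\in\mathbb{N}$. (S3) $(B^{(n)}(t))_{t\ge0}\subset L(\mathbb{E})$, $t\mapsto B^{(n)}_{\alpha\alpha'}(t)\in L(\mathbb{E}_\alpha,\mathbb{E}_{\alpha'})$ is strongly continuous for all $\alpha'<\alpha$, and there is an increasing continuous function $M:(\alpha_*,\infty)\to[0,\infty)$, independent of $n$, with $\|B^{(n)}_{\alpha\alpha'}(t)\|_{\alpha\alpha'}\le\frac{M(\alpha)}{\alpha-\alpha'}$ for all $\alpha'<\alpha$, $t\ge0$. Let $(A(t))_{t\ge0}$ and $(B(t))_{t\ge0}$ be two families of operators in $L(\mathbb{E})$ such that, for any $T>0$ and $\alpha'<\alpha$, $$\lim_{n\to\infty}\sup_{t\in[0,T]}\|B^{(n)}_{\alpha\alpha'}(t)-B_{\alpha\alpha'}(t)\|_{\alpha\alpha'}=0\quad\text{and}\quad\lim_{n\to\infty}\sup_{t\in[0,T]}\|A^{(n)}_{\alpha\alpha'}(t)-A_{\alpha\alpha'}(t)\|_{\alpha\alpha'}=0.$$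 Then $(A(t))_{t\ge0}$ satisfies (A1), $(B(t))_{t\ge0}$ satisfies (B1) and (B2) with the same function $M$, and there exists $(V(t,s))_{t\ge s\ge0}$ satisfying (A2), (A3) (for $(A(t))_{t\ge0}$) and (A4) with the same constant $K$. Moreover, with $T(\alpha',\alpha)=\frac{\alpha-\alpha'}{2eKM(\alpha)}$, for any $n\in\mathbb{N}$ there exist the perturbed forward families $W^{(n)}(t,s)$ associated with $V^{(n)},B^{(n)}$ and $W(t,s)$ associated with $V,B$ (as defined in the context), and for any $\alpha'<\alpha$ and any compact $\Delta_{\alpha'\alpha}\subset\{(t,s)\mid 0\le s\le t,\ t-s<T(\alpha',\alpha)\}$ it holds that $$\lim_{n\to\infty}\sup_{(t,s)\in\Delta_{\alpha'\alpha}}\|W^{(n)}_{\alpha\alpha'}(t,s)k-W_{\alpha\alpha'}(t,s)k\|_{\alpha'}=0,\qquad k\in\mathbb{E}_\alpha.$$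
   Context: Scale of Banach spaces: $\alpha_*\in\mathbb{R}$ is fixed and $\mathbb{E}=(\mathbb{E}_\alpha)_{\alpha>\alpha_*}$ is a family of Banach spaces with $\mathbb{E}_\alpha\subset\mathbb{E}_{\alpha'}$ and $\|\cdot\|_{\alpha'}\le\|\cdot\|_\alpha$ for $\alpha'<\alpha$. Writing $\alpha'<\alpha$ always includes $\alpha'>\alpha_*$. $i_{\alpha\alpha'}\in L(\mathbb{E}_\alpha,\mathbb{E}_{\alpha'})$ denotes the embedding; $\|\cdot\|_{\alpha\alpha'}$ is the operator norm on $L(\mathbb{E}_\alpha,\mathbb{E}_{\alpha'})$. $L(\mathbb{E})$ is the set of collections $A=(A_{\alpha\alpha'})_{\alpha'<\alpha}$, $A_{\alpha\alpha'}\in L(\mathbb{E}_\alpha,\mathbb{E}_{\alpha'})$, with $A_{\alpha''\alpha'}=i_{\alpha\alpha'}A_{\alpha''\alpha}=A_{\alpha\alpha'}i_{\alpha''\alpha}$ for all $\alpha'<\alpha<\alpha''$. Composition in $L(\mathbb{E})$: $(AB)_{\alpha\alpha'}:=A_{\beta\alpha'}B_{\alpha\beta}$ for any $\beta\in(\alpha',\alpha)$ (independent of $\beta$). (A1) For all $\alpha'<\alpha$, $t\mapsto A_{\alpha\alpha'}(t)\in L(\mathbb{E}_\alpha,\mathbb{E}_{\alpha'})$ is continuous in the operator norm on $[0,\infty)$. (A2) $V(t,s)\in L(\mathbb{E})$ for all $t\ge s\ge 0$, $V_{\alpha\alpha'}(t,t)=i_{\alpha\alpha'}$ for all $\alpha'<\alpha$,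 $t\ge 0$, and for any $\alpha'<\alpha$, $k\in\mathbb{E}_\alpha$ the map $(t,s)\mapsto V_{\alpha\alpha'}(t,s)k$ is continuous in $\mathbb{E}_{\alpha'}$. (A3) (for $(A(t))_{t\ge 0}$) For any $\alpha'<\alpha''<\alpha$, $k\in\mathbb{E}_\alpha$, $0\le s\le t$: $V_{\alpha\alpha'}(t,s)k=k+\int_s^tA_{\alpha''\alpha'}(r)V_{\alpha\alpha''}(r,s)k\,dr$ and $V_{\alpha\alpha'}(t,s)k=k+\int_s^tV_{\alpha''\alpha'}(t,r)A_{\alpha\alpha''}(r)k\,dr$, where the integrals exist in $\mathbb{E}_{\alpha'}$. (A4) There is a constant $K\ge 1$ with $\|V_{\alpha\alpha'}(t,s)\|_{\alpha\alpha'}\le K$ for all $0\le s\le t$ and $\alpha'<\alpha$. (B1) For all $\alpha'<\alpha$ and $k\in\mathbb{E}_\alpha$, $t\mapsto B_{\alpha\alpha'}(t)k\in\mathbb{E}_{\alpha'}$ is continuous on $[0,\infty)$. (B2) There is an increasing continuous function $M:(\alpha_*,\infty)\to[0,\infty)$ with $\|B_{\alpha\alpha'}(t)\|_{\alpha\alpha'}\le\frac{M(\alpha)}{\alpha-\alpha'}$ for all $t\ge 0$, $\alpha'<\alpha$. Perturbed forward family associated with $V,B$: put $T(\alpha',\alpha):=\frac{\alpha-\alpha'}{2KeM(\alpha)}$ with $1/0:=+\infty$. $W$ is the family $\{W_{\alpha\alpha'}(t,s)\in L(\mathbb{E}_\alpha,\mathbb{E}_{\alpha'}):\alpha'<\alpha,\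 0\le s\le t,\ t-s<T(\alpha',\alpha)\}$ with the following properties (under (A2), (A4), (B1), (B2) it exists and is unique): (i) $(t,s)\mapsto W_{\alpha\alpha'}(t,s)$ is strongly continuous, $W_{\alpha\alpha'}(t,t)=i_{\alpha\alpha'}$, $\|W_{\alpha\alpha'}(t,s)\|_{\alpha\alpha'}\le\frac{T(\alpha',\alpha)}{T(\alpha',\alpha)-(t-s)}K$; (ii) for $\alpha'<\alpha''<\alpha$, $W_{\alpha\alpha'}(t,s)=i_{\alpha''\alpha'}W_{\alpha\alpha''}(t,s)$ if $t-s<\min\{T(\alpha',\alpha),T(\alpha'',\alpha)\}$ and $W_{\alpha\alpha'}(t,s)=W_{\alpha''\alpha'}(t,s)i_{\alpha\alpha''}$ if $t-s<\min\{T(\alpha',\alpha),T(\alpha',\alpha'')\}$; (iii) $W_{\alpha\alpha'}(t,s)k=V_{\alpha\alpha'}(t,s)k+\int_s^t(V(t,r)B(r))_{\alpha''\alpha'}W_{\alpha\alpha''}(r,s)k\,dr$ for $k\in\mathbb{E}_\alpha$, $\alpha'<\alpha''<\alpha$, $t-s<\min\{T(\alpha',\alpha),T(\alpha'',\alpha)\}$; (iv) $W_{\alpha\alpha'}(t,s)k=V_{\alpha\alpha'}(t,s)k+\int_s^tW_{\alpha''\alpha'}(t,r)(B(r)V(r,s))_{\alpha\alpha''}k\,dr$ for $k\in\mathbb{E}_\alpha$, $\alpha'<\alpha''<\alpha$, $t-s<\min\{T(\alpha',\alpha),T(\alpha',\alpha'')\}$. *)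

theory Defs
  imports "HOL-Analysis.Analysis"
begin

text \<open>
  All spaces of a scale are subspaces of one ambient vector space \<open>'a\<close> (for instance their
  union), so that the embeddings are the inclusions and are not written. The scalars are an
  arbitrary type \<open>'k :: real_normed_field\<close>, which covers real and complex Banach spaces;
  \<open>scl\<close> is the scalar multiplication, and the real structure given by the class
  \<open>real_vector\<close> of \<open>'a\<close> is required to be its restriction. The field \<open>low\<close> is the
  lower bound \<open>\<alpha>\<^sub>*\<close> of the indices. The values of \<open>nrm S \<alpha>\<close> outside \<open>sp S \<alpha>\<close> are
  irrelevant, and so are the values of operators outside their domain.
\<close>

record ('k, 'a) scale =
  low :: real
  scl :: "'k \<Rightarrow> 'a \<Rightarrow> 'a"
  sp :: "real \<Rightarrow> 'a set"
  nrm :: "real \<Rightarrow> 'a \<Rightarrow> real"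

text \<open>The cut-off makes this symmetric and nonnegative on all of \<open>'a\<close>, as the locale
  \<^locale>\<open>Metric_space\<close> demands.\<close>

definition ndist :: "('k, 'a::real_vector) scale \<Rightarrow> real \<Rightarrow> 'a \<Rightarrow> 'a \<Rightarrow> real" where
  "ndist S \<alpha> x y = (if x \<in> sp S \<alpha> \<and> y \<in> sp S \<alpha> then nrm S \<alpha> (x - y) else 0)"

definition ntop :: "('k, 'a::real_vector) scale \<Rightarrow> real \<Rightarrow> 'a topology" where
  "ntop S \<alpha> = Metric_space.mtopology (sp S \<alpha>) (ndist S \<alpha>)"

definition banach_in :: "('k::real_normed_field, 'a::real_vector) scale \<Rightarrow> real \<Rightarrow> bool" where
  "banach_in S \<alpha> \<longleftrightarrow>
     module.subspace (scl S) (sp S \<alpha>) \<and>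
     (\<forall>x\<in>sp S \<alpha>. 0 \<le> nrm S \<alpha> x \<and> (nrm S \<alpha> x = 0 \<longleftrightarrow> x = 0)) \<and>
     (\<forall>x\<in>sp S \<alpha>. \<forall>c. nrm S \<alpha> (scl S c x) = norm c * nrm S \<alpha> x) \<and>
     (\<forall>x\<in>sp S \<alpha>. \<forall>y\<in>sp S \<alpha>. nrm S \<alpha> (x + y) \<le> nrm S \<alpha> x + nrm S \<alpha> y) \<and>
     Metric_space.mcomplete (sp S \<alpha>) (ndist S \<alpha>)"

definition banach_scale :: "('k::real_normed_field, 'a::real_vector) scale \<Rightarrow> bool" where
  "banach_scale S \<longleftrightarrow>
     vector_space (scl S) \<and> (\<forall>r x. scl S (of_real r) x = r *\<^sub>R x) \<and>
     (\<forall>\<alpha>>low S. banach_in S \<alpha>) \<and>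
     (\<forall>\<alpha>' \<alpha>. low S < \<alpha>' \<longrightarrow> \<alpha>' < \<alpha> \<longrightarrow>
        sp S \<alpha> \<subseteq> sp S \<alpha>' \<and> (\<forall>x\<in>sp S \<alpha>. nrm S \<alpha>' x \<le> nrm S \<alpha> x))"

definition bounded_op ::
    "('k, 'a::real_vector) scale \<Rightarrow> real \<Rightarrow> real \<Rightarrow> ('a \<Rightarrow> 'a) set" where
  "bounded_op S \<alpha> \<alpha>' = {T.
     T ` sp S \<alpha> \<subseteq> sp S \<alpha>' \<and>
     (\<forall>x\<in>sp S \<alpha>. \<forall>y\<in>sp S \<alpha>. T (x + y) = T x + T y) \<and>
     (\<forall>c. \<forall>x\<in>sp S \<alpha>. T (scl S c x) = scl S c (T x)) \<and>
     (\<exists>C. \<forall>x\<in>sp S \<alpha>. nrm S \<alpha>' (T x) \<le> C * nrm S \<alpha> x)}"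

text \<open>As in \<^const>\<open>onorm\<close>, the point \<open>x = 0\<close> contributes \<open>0 / 0 = 0\<close>.\<close>

definition opnorm :: "('k, 'a) scale \<Rightarrow> real \<Rightarrow> real \<Rightarrow> ('a \<Rightarrow> 'a) \<Rightarrow> real" where
  "opnorm S \<alpha> \<alpha>' T = (SUP x\<in>sp S \<alpha>. nrm S \<alpha>' (T x) / nrm S \<alpha> x)"

text \<open>A collection \<open>(A\<^bsub>\<alpha>\<alpha>'\<^esub>)\<close> is a function of \<open>\<alpha>\<close> and \<open>\<alpha>'\<close>, in this order; only
  its values for \<open>low S < \<alpha>' < \<alpha>\<close> matter.\<close>

type_synonym 'a coll = "real \<Rightarrow> real \<Rightarrow> 'a \<Rightarrow> 'a"

definition scale_ops :: "('k, 'a::real_vector) scale \<Rightarrow> 'a coll set" where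
  "scale_ops S = {A.
     (\<forall>\<alpha>' \<alpha>. low S < \<alpha>' \<longrightarrow> \<alpha>' < \<alpha> \<longrightarrow> A \<alpha> \<alpha>' \<in> bounded_op S \<alpha> \<alpha>') \<and>
     (\<forall>\<alpha>' \<alpha> \<alpha>''. low S < \<alpha>' \<longrightarrow> \<alpha>' < \<alpha> \<longrightarrow> \<alpha> < \<alpha>'' \<longrightarrow>
        (\<forall>x\<in>sp S \<alpha>''. A \<alpha>'' \<alpha>' x = A \<alpha>'' \<alpha> x \<and> A \<alpha>'' \<alpha>' x = A \<alpha> \<alpha>' x))}"

text \<open>The intermediate index is taken to be the midpoint; \<open>scale_comp_eq\<close> shows that any
  other choice gives the same operator.\<close>

definition scale_comp :: "'a coll \<Rightarrow> 'a coll \<Rightarrow> 'a coll" where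
  "scale_comp A B \<alpha> \<alpha>' x = A ((\<alpha>' + \<alpha>) / 2) \<alpha>' (B \<alpha> ((\<alpha>' + \<alpha>) / 2) x)"

lemma scale_comp_indep:
  assumes "A \<in> scale_ops S" "B \<in> scale_ops S" "low S < \<alpha>'" "\<alpha>' < \<beta>" "\<beta> < \<gamma>" "\<gamma> < \<alpha>"
    and "x \<in> sp S \<alpha>"
  shows "A \<beta> \<alpha>' (B \<alpha> \<beta> x) = A \<gamma> \<alpha>' (B \<alpha> \<gamma> x)"
proof -
  have "low S < \<beta>" "low S < \<gamma>" using assms by auto
  then have "B \<alpha> \<gamma> x \<in> sp S \<gamma>"
    using assms unfolding scale_ops_def bounded_op_def by blast
  then have "A \<gamma> \<alpha>' (B \<alpha> \<gamma> x) = A \<beta> \<alpha>' (B \<alpha> \<gamma> x)"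
    using assms unfolding scale_ops_def by blast
  moreover have "B \<alpha> \<beta> x = B \<alpha> \<gamma> x"
    using assms \<open>low S < \<beta>\<close> unfolding scale_ops_def by blast
  ultimately show ?thesis by simp
qed

lemma scale_comp_eq:
  assumes "A \<in> scale_ops S" "B \<in> scale_ops S" "low S < \<alpha>'" "\<alpha>' < \<beta>" "\<beta> < \<alpha>" "x \<in> sp S \<alpha>"
  shows "scale_comp A B \<alpha> \<alpha>' x = A \<beta> \<alpha>' (B \<alpha> \<beta> x)"
proof -
  let ?m = "(\<alpha>' + \<alpha>) / 2"
  have m: "\<alpha>' < ?m" "?m < \<alpha>" using assms by auto
  consider "\<beta> < ?m" | "\<beta> = ?m" | "?m < \<beta>" by linarith
  then show ?thesis
  proof cases
    case 1
    show ?thesis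
      using scale_comp_indep[OF assms(1-4) 1 m(2) assms(6)] by (simp add: scale_comp_def)
  next
    case 2
    then show ?thesis unfolding scale_comp_def by metis
  next
    case 3
    show ?thesis
      using scale_comp_indep[OF assms(1-3) m(1) 3 assms(5,6)] by (simp add: scale_comp_def)
  qed
qed

text \<open>The integral over \<open>[a,b]\<close> of a function with values in \<open>sp S \<alpha>\<close>: the library's
  \<open>has_integral\<close> on intervals (see \<open>has_integral_cbox\<close>) with convergence of the Riemann
  sums in the norm \<open>nrm S \<alpha>\<close>. It is used for continuous integrands only.\<close>

definition has_integral_in ::
    "('k, 'a::real_vector) scale \<Rightarrow> real \<Rightarrow> real \<Rightarrow> real \<Rightarrow> (real \<Rightarrow> 'a) \<Rightarrow> 'a \<Rightarrow> bool" where
  "has_integral_in S \<alpha> a b f I \<longleftrightarrow>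
     limitin (ntop S \<alpha>) (\<lambda>p. \<Sum>(x, k)\<in>p. measure lborel k *\<^sub>R f x) I (division_filter (cbox a b))"

text \<open>In the conditions below, one-parameter families \<open>A t\<close> are relevant for \<open>t \<ge> 0\<close> and
  two-parameter families \<open>V t s\<close> for \<open>0 \<le> s \<le> t\<close>.\<close>

definition cond_A1 ::
    "('k, 'a::real_vector) scale \<Rightarrow> (real \<Rightarrow> 'a coll) \<Rightarrow> bool" where
  "cond_A1 S A \<longleftrightarrow> (\<forall>\<alpha>' \<alpha>. low S < \<alpha>' \<longrightarrow> \<alpha>' < \<alpha> \<longrightarrow> (\<forall>t\<^sub>0\<ge>0.
     ((\<lambda>t. opnorm S \<alpha> \<alpha>' (\<lambda>x. A t \<alpha> \<alpha>' x - A t\<^sub>0 \<alpha> \<alpha>' x)) \<longlongrightarrow> 0) (at t\<^sub>0 within {0..})))"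

definition cond_A2 ::
    "('k, 'a::real_vector) scale \<Rightarrow> (real \<Rightarrow> real \<Rightarrow> 'a coll) \<Rightarrow> bool" where
  "cond_A2 S V \<longleftrightarrow>
     (\<forall>t s. 0 \<le> s \<longrightarrow> s \<le> t \<longrightarrow> V t s \<in> scale_ops S) \<and>
     (\<forall>\<alpha>' \<alpha>. low S < \<alpha>' \<longrightarrow> \<alpha>' < \<alpha> \<longrightarrow> (\<forall>k\<in>sp S \<alpha>.
        (\<forall>t\<ge>0. V t t \<alpha> \<alpha>' k = k) \<and>
        continuous_map (top_of_set {(t, s). 0 \<le> s \<and> s \<le> t}) (ntop S \<alpha>')
          (\<lambda>(t, s). V t s \<alpha> \<alpha>' k)))"

definition cond_A3 ::
    "('k, 'a::real_vector) scale \<Rightarrow> (real \<Rightarrow> 'a coll) \<Rightarrow> (real \<Rightarrow> real \<Rightarrow> 'a coll) \<Rightarrow> bool" where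
  "cond_A3 S A V \<longleftrightarrow>
     (\<forall>\<alpha>' \<alpha>'' \<alpha>. low S < \<alpha>' \<longrightarrow> \<alpha>' < \<alpha>'' \<longrightarrow> \<alpha>'' < \<alpha> \<longrightarrow>
        (\<forall>k\<in>sp S \<alpha>. \<forall>t s. 0 \<le> s \<longrightarrow> s \<le> t \<longrightarrow>
           has_integral_in S \<alpha>' s t (\<lambda>r. A r \<alpha>'' \<alpha>' (V r s \<alpha> \<alpha>'' k)) (V t s \<alpha> \<alpha>' k - k) \<and>
           has_integral_in S \<alpha>' s t (\<lambda>r. V t r \<alpha>'' \<alpha>' (A r \<alpha> \<alpha>'' k)) (V t s \<alpha> \<alpha>' k - k)))"

definition cond_A4 ::
    "('k, 'a) scale \<Rightarrow> real \<Rightarrow> (real \<Rightarrow> real \<Rightarrow> 'a coll) \<Rightarrow> bool" where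
  "cond_A4 S K V \<longleftrightarrow> 1 \<le> K \<and>
     (\<forall>\<alpha>' \<alpha>. low S < \<alpha>' \<longrightarrow> \<alpha>' < \<alpha> \<longrightarrow>
        (\<forall>t s. 0 \<le> s \<longrightarrow> s \<le> t \<longrightarrow> opnorm S \<alpha> \<alpha>' (V t s \<alpha> \<alpha>') \<le> K))"

definition cond_B1 ::
    "('k, 'a::real_vector) scale \<Rightarrow> (real \<Rightarrow> 'a coll) \<Rightarrow> bool" where
  "cond_B1 S B \<longleftrightarrow> (\<forall>\<alpha>' \<alpha>. low S < \<alpha>' \<longrightarrow> \<alpha>' < \<alpha> \<longrightarrow>
     (\<forall>k\<in>sp S \<alpha>. continuous_map (top_of_set {0..}) (ntop S \<alpha>') (\<lambda>t. B t \<alpha> \<alpha>' k)))"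

definition cond_B2 ::
    "('k, 'a) scale \<Rightarrow> (real \<Rightarrow> real) \<Rightarrow> (real \<Rightarrow> 'a coll) \<Rightarrow> bool" where
  "cond_B2 S M B \<longleftrightarrow>
     mono_on {low S<..} M \<and> continuous_on {low S<..} M \<and> (\<forall>\<alpha>>low S. 0 \<le> M \<alpha>) \<and>
     (\<forall>\<alpha>' \<alpha>. low S < \<alpha>' \<longrightarrow> \<alpha>' < \<alpha> \<longrightarrow>
        (\<forall>t\<ge>0. opnorm S \<alpha> \<alpha>' (B t \<alpha> \<alpha>') \<le> M \<alpha> / (\<alpha> - \<alpha>')))"

text \<open>In \<^typ>\<open>ereal\<close> a positive number divided by \<open>0\<close> is \<open>\<infinity>\<close>, so \<open>Tmax K M \<alpha>' \<alpha> = \<infinity>\<close>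
  if \<open>M \<alpha> = 0\<close>.\<close>

definition Tmax :: "real \<Rightarrow> (real \<Rightarrow> real) \<Rightarrow> real \<Rightarrow> real \<Rightarrow> ereal" where
  "Tmax K M \<alpha>' \<alpha> = ereal (\<alpha> - \<alpha>') / ereal (2 * K * exp 1 * M \<alpha>)"

lemma Tmax_zero: "\<alpha>' < \<alpha> \<Longrightarrow> M \<alpha> = 0 \<Longrightarrow> Tmax K M \<alpha>' \<alpha> = \<infinity>"
  by (simp add: Tmax_def divide_ereal_def)

lemma Tmax_pos: "M \<alpha> > 0 \<Longrightarrow> K \<ge> 1 \<Longrightarrow> Tmax K M \<alpha>' \<alpha> = ereal ((\<alpha> - \<alpha>') / (2 * K * exp 1 * M \<alpha>))"
  by (simp add: Tmax_def)

text \<open>\<open>T / (T - \<tau>)\<close>, read as \<open>1\<close> if \<open>T = \<infinity>\<close> (in \<^typ>\<open>ereal\<close>, \<open>\<infinity> / \<infinity> = 0\<close>).\<close>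

definition growth :: "ereal \<Rightarrow> real \<Rightarrow> ereal" where
  "growth T \<tau> = (if T = \<infinity> then 1 else T / (T - ereal \<tau>))"

definition fwd_dom :: "ereal \<Rightarrow> (real \<times> real) set" where
  "fwd_dom T = {(t, s). 0 \<le> s \<and> s \<le> t \<and> ereal (t - s) < T}"

text \<open>\<open>W\<close> is a perturbed forward family associated with \<open>V\<close> and \<open>B\<close>; the operators
  \<open>W t s \<alpha> \<alpha>'\<close> are relevant for \<open>(t, s) \<in> fwd_dom (Tmax K M \<alpha>' \<alpha>)\<close> only. The four blocks
  quantified over \<open>\<alpha>''\<close> are the two restriction properties and the two integral equations.\<close>

definition perturbed_forward ::
    "('k, 'a::real_vector) scale \<Rightarrow> real \<Rightarrow> (real \<Rightarrow> real) \<Rightarrow> (real \<Rightarrow> real \<Rightarrow> 'a coll) \<Rightarrow>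
     (real \<Rightarrow> 'a coll) \<Rightarrow> (real \<Rightarrow> real \<Rightarrow> 'a coll) \<Rightarrow> bool" where
  "perturbed_forward S K M V B W \<longleftrightarrow>
     (\<forall>\<alpha>' \<alpha>. low S < \<alpha>' \<longrightarrow> \<alpha>' < \<alpha> \<longrightarrow>
        (\<forall>(t, s) \<in> fwd_dom (Tmax K M \<alpha>' \<alpha>).
           W t s \<alpha> \<alpha>' \<in> bounded_op S \<alpha> \<alpha>' \<and>
           ereal (opnorm S \<alpha> \<alpha>' (W t s \<alpha> \<alpha>')) \<le> growth (Tmax K M \<alpha>' \<alpha>) (t - s) * ereal K) \<and>
        (\<forall>k\<in>sp S \<alpha>.
           (\<forall>t\<ge>0. W t t \<alpha> \<alpha>' k = k) \<and>
           continuous_map (top_of_set (fwd_dom (Tmax K M \<alpha>' \<alpha>))) (ntop S \<alpha>')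
             (\<lambda>(t, s). W t s \<alpha> \<alpha>' k))) \<and>
     (\<forall>\<alpha>' \<alpha>'' \<alpha>. low S < \<alpha>' \<longrightarrow> \<alpha>' < \<alpha>'' \<longrightarrow> \<alpha>'' < \<alpha> \<longrightarrow> (\<forall>k\<in>sp S \<alpha>.
        (\<forall>(t, s) \<in> fwd_dom (min (Tmax K M \<alpha>' \<alpha>) (Tmax K M \<alpha>'' \<alpha>)).
           W t s \<alpha> \<alpha>' k = W t s \<alpha> \<alpha>'' k) \<and>
        (\<forall>(t, s) \<in> fwd_dom (min (Tmax K M \<alpha>' \<alpha>) (Tmax K M \<alpha>' \<alpha>'')).
           W t s \<alpha> \<alpha>' k = W t s \<alpha>'' \<alpha>' k) \<and>
        (\<forall>(t, s) \<in> fwd_dom (min (Tmax K M \<alpha>' \<alpha>) (Tmax K M \<alpha>'' \<alpha>)).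
           has_integral_in S \<alpha>' s t
             (\<lambda>r. scale_comp (V t r) (B r) \<alpha>'' \<alpha>' (W r s \<alpha> \<alpha>'' k))
             (W t s \<alpha> \<alpha>' k - V t s \<alpha> \<alpha>' k)) \<and>
        (\<forall>(t, s) \<in> fwd_dom (min (Tmax K M \<alpha>' \<alpha>) (Tmax K M \<alpha>' \<alpha>'')).
           has_integral_in S \<alpha>' s t
             (\<lambda>r. W t r \<alpha>'' \<alpha>' (scale_comp (B r) (V r s) \<alpha> \<alpha>'' k))
             (W t s \<alpha> \<alpha>' k - V t s \<alpha> \<alpha>' k))))"

end

theory Submission
  imports Defs
begin

text \<open>The limit family \<open>V\<close> exists because the \<open>V\<^sup>n\<close> form a Cauchy sequence. Differentiating
  \<open>r \<mapsto> V\<^sup>n(t,r) V\<^sup>m(r,s) k\<close> by means of both equations of (A3) gives Duhamel's formula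
  \<open>V\<^sup>m(t,s) k - V\<^sup>n(t,s) k = \<integral> V\<^sup>n(t,r) (A\<^sup>m(r) - A\<^sup>n(r)) V\<^sup>m(r,s) k dr\<close> (lemma \<open>duhamel\<close>), and the
  right-hand side is at most \<open>K\<^sup>2 (t - s)\<close> times the norm of \<open>A\<^sup>m - A\<^sup>n\<close> between two intermediate
  spaces. All that is claimed of \<open>V\<close> passes to the limit, since the convergence is uniform on bounded
  sets of times, even in operator norm (theorem \<open>evol_limit\<close>).

  The perturbed family is a series \<open>W = \<Sum> w\<^sub>j\<close> with \<open>w\<^sub>0 = V\<close> and
  \<open>w\<^sub>j\<^sub>+\<^sub>1(t,s) = \<integral> V(t,r) B(r) w\<^sub>j(r,s) dr\<close>. Each factor \<open>B\<close> loses regularity at the price of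
  \<open>M / gap\<close>. If the loss \<open>\<alpha> - \<alpha>'\<close> is split into \<open>j + 1\<close> equal gaps, the \<open>j\<close>-th term is bounded by
  \<open>K (K M \<tau>)\<^sup>j / j! ((j + 1) / (\<alpha> - \<alpha>'))\<^sup>j \<le> K (\<tau> / T(\<alpha>',\<alpha>))\<^sup>j\<close> for \<open>\<tau> = t - s\<close> (lemma
  \<open>ovsyannikov\<close>): a geometric series that converges on the required domain and has the required
  sum. The integral equation with \<open>V\<close> on the left is the recursion, summed over \<open>j\<close>. The one with
  \<open>V\<close> on the right is the mirrored recursion, and this holds by an exchange of integrals over a triangle
  (lemmas \<open>integral_triangle_swap\<close> and \<open>w_Suc_right\<close>).

  A perturbed forward family is determined by its first integral equation: the difference \<open>z\<close> of two
  such families solves the homogeneous equation, and the estimate above, applied to the constant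
  sequence \<open>z, z, \<dots>\<close>, shows that \<open>z\<close> vanishes on a short interval. The length of the interval does
  not depend on its left end, so the argument can be repeated (lemma \<open>homogeneous_solution_zero\<close>).
  Hence \<open>W\<^sup>n\<close> and \<open>W\<close> are given by the series. Its terms converge uniformly by induction on \<open>j\<close>, and
  on a compact part of the domain all the series have one geometric majorant, so their
  sums converge uniformly as well (theorem \<open>series_convergent\<close>).

  Two devices make the analysis available. The spaces of the scale are subspaces of \<open>'a\<close> with norms of
  their own, whereas integration theory speaks about types. All Banach subspaces of \<open>'a\<close> therefore are
  embedded, linearly and isometrically, in one Banach space \<open>'a bsum\<close>; under the embedding \<open>em \<alpha>\<close> the
  topology and the integral of \<open>E \<alpha>\<close> become the usual ones. Moreover, an element of \<open>L(E)\<close> acts on all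
  spaces of the scale by one and the same map (\<open>flat\<close>), so that indices are needed only for norms.\<close>

section \<open>A Banach space that contains all Banach subspaces\<close>

definition complete_norm_on :: "'a::real_vector set \<Rightarrow> ('a \<Rightarrow> real) \<Rightarrow> bool" where
  "complete_norm_on X p \<longleftrightarrow>
     subspace X \<and>
     (\<forall>x\<in>X. p x = 0 \<longrightarrow> x = 0) \<and>
     (\<forall>x\<in>X. \<forall>r. p (r *\<^sub>R x) = \<bar>r\<bar> * p x) \<and>
     (\<forall>x\<in>X. \<forall>y\<in>X. p (x + y) \<le> p x + p y) \<and>
     (\<forall>f. (\<forall>n. f n \<in> X) \<longrightarrow> (\<forall>e>0. \<exists>N. \<forall>m\<ge>N. \<forall>n\<ge>N. p (f m - f n) < e) \<longrightarrow>
        (\<exists>x\<in>X. (\<lambda>n. p (f n - x)) \<longlonglongrightarrow> 0))"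

typedef (overloaded) 'a banach_struct = "{(X :: 'a::real_vector set, p). complete_norm_on X p}"
  by (rule exI[of _ "({0}, \<lambda>_. 0)"]) (auto simp: complete_norm_on_def subspace_def)

definition carr :: "'a::real_vector banach_struct \<Rightarrow> 'a set" where
  "carr i = fst (Rep_banach_struct i)"

definition bnorm :: "'a::real_vector banach_struct \<Rightarrow> 'a \<Rightarrow> real" where
  "bnorm i = snd (Rep_banach_struct i)"

lemma complete_norm_on_struct: "complete_norm_on (carr i) (bnorm i)"
  using Rep_banach_struct[of i] by (auto simp: carr_def bnorm_def)

lemma subspace_carr [simp]: "subspace (carr i)"
  using complete_norm_on_struct[of i] by (simp add: complete_norm_on_def)

lemma carr_closed [simp]:
  "0 \<in> carr i" "x \<in> carr i \<Longrightarrow> y \<in> carr i \<Longrightarrow> x + y \<in> carr i"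
  "x \<in> carr i \<Longrightarrow> y \<in> carr i \<Longrightarrow> x - y \<in> carr i" "x \<in> carr i \<Longrightarrow> - x \<in> carr i"
  "x \<in> carr i \<Longrightarrow> r *\<^sub>R x \<in> carr i"
  by (rule subspace_0 subspace_add subspace_diff subspace_neg subspace_scale; simp)+

lemma bnorm_scale: "x \<in> carr i \<Longrightarrow> bnorm i (r *\<^sub>R x) = \<bar>r\<bar> * bnorm i x"
  using complete_norm_on_struct[of i] by (simp add: complete_norm_on_def)

lemma bnorm_add: "x \<in> carr i \<Longrightarrow> y \<in> carr i \<Longrightarrow> bnorm i (x + y) \<le> bnorm i x + bnorm i y"
  using complete_norm_on_struct[of i] by (simp add: complete_norm_on_def)

lemma bnorm_eq_0: "x \<in> carr i \<Longrightarrow> bnorm i x = 0 \<Longrightarrow> x = 0"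
  using complete_norm_on_struct[of i] by (simp add: complete_norm_on_def)

lemma bnorm_0 [simp]: "bnorm i 0 = 0"
  using bnorm_scale[of 0 i 0] by simp

lemma bnorm_minus: "x \<in> carr i \<Longrightarrow> bnorm i (- x) = bnorm i x"
  using bnorm_scale[of x i "-1"] by simp

lemma bnorm_nonneg: "x \<in> carr i \<Longrightarrow> 0 \<le> bnorm i x"
  using bnorm_add[of x i "- x"] bnorm_minus[of x i] by simp

lemma bnorm_complete:
  assumes "\<And>n. f n \<in> carr i" "\<And>e. e > 0 \<Longrightarrow> \<exists>N. \<forall>m\<ge>N. \<forall>n\<ge>N. bnorm i (f m - f n) < e"
  shows "\<exists>x\<in>carr i. (\<lambda>n. bnorm i (f n - x)) \<longlonglongrightarrow> 0"
  using complete_norm_on_struct[of i] assms unfolding complete_norm_on_def by blast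

text \<open>The \<open>l\<^sup>\<infinity>\<close> sum of all Banach spaces whose underlying vector space is a subspace of \<open>'a\<close>. Taking all of
  them at once is what makes this a type: it depends on \<open>'a\<close> and not on a particular scale.\<close>
typedef (overloaded) 'a bsum =
    "{g :: 'a::real_vector banach_struct \<Rightarrow> 'a. (\<forall>i. g i \<in> carr i) \<and> bdd_above (range (\<lambda>i. bnorm i (g i)))}"
  by (rule exI[of _ "\<lambda>_. 0"]) auto

setup_lifting type_definition_bsum

instantiation bsum :: (real_vector) real_vector
begin
lift_definition zero_bsum :: "'a bsum" is "\<lambda>_. 0" by auto
lift_definition plus_bsum :: "'a bsum \<Rightarrow> 'a bsum \<Rightarrow> 'a bsum" is "\<lambda>f g i. f i + g i"
proof -
  fix f g :: "'a banach_struct \<Rightarrow> 'a"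
  assume f: "(\<forall>i. f i \<in> carr i) \<and> bdd_above (range (\<lambda>i. bnorm i (f i)))"
    and g: "(\<forall>i. g i \<in> carr i) \<and> bdd_above (range (\<lambda>i. bnorm i (g i)))"
  from f obtain C where C: "\<And>i. bnorm i (f i) \<le> C" by (auto simp: bdd_above_def)
  from g obtain D where D: "\<And>i. bnorm i (g i) \<le> D" by (auto simp: bdd_above_def)
  have "bnorm i (f i + g i) \<le> C + D" for i
    using bnorm_add[of "f i" i "g i"] f g C[of i] D[of i] by simp
  then show "(\<forall>i. f i + g i \<in> carr i) \<and> bdd_above (range (\<lambda>i. bnorm i (f i + g i)))"
    using f g by (auto intro!: bdd_aboveI)
qed
lift_definition uminus_bsum :: "'a bsum \<Rightarrow> 'a bsum" is "\<lambda>f i. - f i"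
  by (simp add: bnorm_minus)
lift_definition scaleR_bsum :: "real \<Rightarrow> 'a bsum \<Rightarrow> 'a bsum" is "\<lambda>r f i. r *\<^sub>R f i"
proof -
  fix r :: real and f :: "'a banach_struct \<Rightarrow> 'a"
  assume f: "(\<forall>i. f i \<in> carr i) \<and> bdd_above (range (\<lambda>i. bnorm i (f i)))"
  from f obtain C where C: "\<And>i. bnorm i (f i) \<le> C" by (auto simp: bdd_above_def)
  have "bnorm i (r *\<^sub>R f i) \<le> \<bar>r\<bar> * C" for i
    using bnorm_scale[of "f i" i r] f C[of i] by (simp add: mult_left_mono)
  then show "(\<forall>i. r *\<^sub>R f i \<in> carr i) \<and> bdd_above (range (\<lambda>i. bnorm i (r *\<^sub>R f i)))"
    using f by (auto intro!: bdd_aboveI)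
qed
definition "minus_bsum f (g :: 'a bsum) = f + - g"
instance
  by standard (simp_all add: Rep_bsum_inject[symmetric] plus_bsum.rep_eq zero_bsum.rep_eq
      uminus_bsum.rep_eq scaleR_bsum.rep_eq minus_bsum_def fun_eq_iff algebra_simps)
end

lemma Rep_bsum_carr [simp]: "Rep_bsum f i \<in> carr i"
  and Rep_bsum_bdd: "bdd_above (range (\<lambda>i. bnorm i (Rep_bsum f i)))"
  using Rep_bsum[of f] by simp_all

lemma Rep_bsum_diff: "Rep_bsum (f - g) i = Rep_bsum f i - Rep_bsum g i"
  unfolding minus_bsum_def plus_bsum.rep_eq uminus_bsum.rep_eq by simp

instantiation bsum :: (real_vector) real_normed_vector
begin
definition norm_bsum :: "'a bsum \<Rightarrow> real" where
  "norm_bsum f = (SUP i. bnorm i (Rep_bsum f i))"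
definition dist_bsum :: "'a bsum \<Rightarrow> 'a bsum \<Rightarrow> real" where
  "dist_bsum f g = norm (f - g)"
definition sgn_bsum :: "'a bsum \<Rightarrow> 'a bsum" where
  "sgn_bsum f = f /\<^sub>R norm f"
definition uniformity_bsum :: "('a bsum \<times> 'a bsum) filter" where
  "uniformity_bsum = (INF e\<in>{0 <..}. principal {(x, y). dist x y < e})"
definition open_bsum :: "'a bsum set \<Rightarrow> bool" where
  "open_bsum U \<longleftrightarrow> (\<forall>x\<in>U. \<forall>\<^sub>F (x', y) in uniformity. x' = x \<longrightarrow> y \<in> U)"

lemma bnorm_le_norm: "bnorm i (Rep_bsum f i) \<le> norm f"
  unfolding norm_bsum_def by (rule cSUP_upper[OF UNIV_I Rep_bsum_bdd])

lemma norm_bsum_le: "(\<And>i. bnorm i (Rep_bsum f i) \<le> C) \<Longrightarrow> norm f \<le> C"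
  unfolding norm_bsum_def by (rule cSUP_least) auto

instance
proof
  fix f g :: "'a bsum" and r :: real
  show "norm f = 0 \<longleftrightarrow> f = 0"
  proof
    assume "norm f = 0"
    then have "Rep_bsum f i = 0" for i
      using bnorm_le_norm[of i f] bnorm_nonneg[of "Rep_bsum f i" i]
      by (intro bnorm_eq_0[OF Rep_bsum_carr]) simp
    then have "Rep_bsum f = Rep_bsum 0" by (simp add: zero_bsum.rep_eq fun_eq_iff)
    then show "f = 0" by (simp add: Rep_bsum_inject)
  next
    assume "f = 0"
    then show "norm f = 0" by (simp add: norm_bsum_def zero_bsum.rep_eq)
  qed
  show "norm (f + g) \<le> norm f + norm g"
  proof (rule norm_bsum_le)
    fix i
    show "bnorm i (Rep_bsum (f + g) i) \<le> norm f + norm g"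
      using bnorm_add[of "Rep_bsum f i" i "Rep_bsum g i"] bnorm_le_norm[of i f] bnorm_le_norm[of i g]
      by (simp add: plus_bsum.rep_eq)
  qed
  have le: "norm (r *\<^sub>R f) \<le> \<bar>r\<bar> * norm f" for r and f :: "'a bsum"
    by (rule norm_bsum_le) (simp add: scaleR_bsum.rep_eq bnorm_scale mult_left_mono bnorm_le_norm)
  show "norm (r *\<^sub>R f) = \<bar>r\<bar> * norm f"
  proof (cases "r = 0")
    case True
    have "norm (0 :: 'a bsum) = 0" by (simp add: norm_bsum_def zero_bsum.rep_eq)
    with True show ?thesis by (simp only: scaleR_zero_left abs_zero mult_zero_left)
  next
    case False
    have "norm f = norm ((1 / r) *\<^sub>R (r *\<^sub>R f))" using False by simp
    also have "\<dots> \<le> \<bar>1 / r\<bar> * norm (r *\<^sub>R f)" by (rule le)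
    finally have "\<bar>r\<bar> * norm f \<le> \<bar>r\<bar> * (\<bar>1 / r\<bar> * norm (r *\<^sub>R f))"
      by (rule mult_left_mono) simp
    also have "\<dots> = norm (r *\<^sub>R f)" using False by simp
    finally show ?thesis using le[of r f] by (rule antisym[rotated])
  qed
qed (rule dist_bsum_def sgn_bsum_def uniformity_bsum_def open_bsum_def)+
end

text \<open>Cauchy sequences converge in every component, and the Cauchy estimate is uniform in the component.\<close>
instance bsum :: (real_vector) banach
proof
  fix X :: "nat \<Rightarrow> 'a bsum"
  assume X: "Cauchy X"
  have C: "\<exists>N. \<forall>m\<ge>N. \<forall>n\<ge>N. norm (X m - X n) < e" if "e > 0" for e
    using X that by (auto simp: Cauchy_def dist_norm)
  have "\<exists>x\<in>carr i. (\<lambda>n. bnorm i (Rep_bsum (X n) i - x)) \<longlonglongrightarrow> 0" for i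
  proof (rule bnorm_complete)
    fix e :: real assume "e > 0"
    then obtain N where N: "\<And>m n. m \<ge> N \<Longrightarrow> n \<ge> N \<Longrightarrow> norm (X m - X n) < e" using C by blast
    show "\<exists>N. \<forall>m\<ge>N. \<forall>n\<ge>N. bnorm i (Rep_bsum (X m) i - Rep_bsum (X n) i) < e"
    proof (intro exI[of _ N] allI impI)
      fix m n assume "m \<ge> N" "n \<ge> N"
      then show "bnorm i (Rep_bsum (X m) i - Rep_bsum (X n) i) < e"
        using N[of m n] bnorm_le_norm[of i "X m - X n"] by (simp add: Rep_bsum_diff)
    qed
  qed simp
  then obtain g where g: "\<And>i. g i \<in> carr i"
    and lim: "\<And>i. (\<lambda>n. bnorm i (Rep_bsum (X n) i - g i)) \<longlonglongrightarrow> 0" by metis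
  have close: "bnorm i (Rep_bsum (X m) i - g i) \<le> e"
    if N: "\<And>m n. m \<ge> N \<Longrightarrow> n \<ge> N \<Longrightarrow> norm (X m - X n) < e" and m: "m \<ge> N" for N e i m
  proof (rule LIMSEQ_le_const)
    show "(\<lambda>n. e + bnorm i (Rep_bsum (X n) i - g i)) \<longlonglongrightarrow> e"
      using tendsto_add[OF tendsto_const lim[of i], of e] by simp
    have "bnorm i (Rep_bsum (X m) i - g i) \<le> e + bnorm i (Rep_bsum (X n) i - g i)" if "n \<ge> N" for n
    proof -
      have "bnorm i (Rep_bsum (X m) i - g i)
          \<le> bnorm i (Rep_bsum (X m - X n) i) + bnorm i (Rep_bsum (X n) i - g i)"
        using bnorm_add[of "Rep_bsum (X m - X n) i" i "Rep_bsum (X n) i - g i"] g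
        by (simp add: Rep_bsum_diff)
      then show ?thesis using bnorm_le_norm[of i "X m - X n"] N[OF m that] by linarith
    qed
    then show "\<exists>N. \<forall>n\<ge>N. bnorm i (Rep_bsum (X m) i - g i) \<le> e + bnorm i (Rep_bsum (X n) i - g i)"
      by blast
  qed
  have "bdd_above (range (\<lambda>i. bnorm i (g i)))"
  proof -
    obtain N where N: "\<And>m n. m \<ge> N \<Longrightarrow> n \<ge> N \<Longrightarrow> norm (X m - X n) < 1"
      using C[of 1] by auto
    have "bnorm i (g i) \<le> norm (X N) + 1" for i
    proof -
      have "bnorm i (g i) \<le> bnorm i (Rep_bsum (X N) i) + bnorm i (- (Rep_bsum (X N) i - g i))"
        using bnorm_add[of "Rep_bsum (X N) i" i "- (Rep_bsum (X N) i - g i)"] g by simp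
      also have "\<dots> \<le> norm (X N) + 1"
        using close[where N=N and e=1 and m=N and i=i] N bnorm_le_norm[of i "X N"] g by (subst bnorm_minus) auto
      finally show ?thesis .
    qed
    then show ?thesis by (auto intro!: bdd_aboveI)
  qed
  then have G: "Rep_bsum (Abs_bsum g) = g" using g by (auto intro: Abs_bsum_inverse)
  have "X \<longlonglongrightarrow> Abs_bsum g"
  proof (rule LIMSEQ_I)
    fix e :: real assume e: "e > 0"
    then obtain N where N: "\<And>m n. m \<ge> N \<Longrightarrow> n \<ge> N \<Longrightarrow> norm (X m - X n) < e / 2"
      using C[of "e / 2"] by auto
    have "norm (X m - Abs_bsum g) \<le> e / 2" if "m \<ge> N" for m
      using close[where N=N and e="e / 2" and m=m] N that by (intro norm_bsum_le) (simp only: Rep_bsum_diff G)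
    then show "\<exists>N. \<forall>n\<ge>N. norm (X n - Abs_bsum g) < e" using e by (intro exI[of _ N]) force
  qed
  then show "convergent X" by (auto simp: convergent_def)
qed

text \<open>The embedding puts \<open>x\<close> into the component of the given space and \<open>0\<close> into all others. Composing it with
  a linear projection onto \<open>X\<close> makes it linear on all of \<open>'a\<close>, and this spares every later appeal to
  linearity a membership condition.\<close>
lemma complete_norm_on_isometry:
  fixes X :: "'a::real_vector set"
  assumes "complete_norm_on X p"
  shows "\<exists>\<iota> :: 'a \<Rightarrow> 'a bsum. linear \<iota> \<and> (\<forall>x\<in>X. norm (\<iota> x) = p x) \<and> range \<iota> = \<iota> ` X"
proof -
  define i0 where "i0 = Abs_banach_struct (X, p)"
  have i0: "carr i0 = X" "bnorm i0 = p"
    using Abs_banach_struct_inverse[of "(X, p)"] assms by (auto simp: i0_def carr_def bnorm_def)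
  have "subspace X" using assms by (simp add: complete_norm_on_def)
  then obtain P :: "'a \<Rightarrow> 'a" where P: "range P \<subseteq> X" "linear P" "\<And>x. x \<in> X \<Longrightarrow> P x = x"
    using linear_exists_left_inverse_on[of "\<lambda>x. x" X] real_vector.linear_ident by (auto simp: inj_on_def)
  define \<iota> where "\<iota> x = Abs_bsum (\<lambda>i. if i = i0 then P x else 0)" for x
  have "\<exists>C. \<forall>i. bnorm i (if i = i0 then P x else 0) \<le> C" for x
    by (rule exI[of _ "max 0 (bnorm i0 (P x))"]) auto
  then have R: "Rep_bsum (\<iota> x) = (\<lambda>i. if i = i0 then P x else 0)" for x
    unfolding \<iota>_def using P(1) i0 by (intro Abs_bsum_inverse) (auto simp: bdd_above_def)
  have "linear \<iota>"
  proof (rule linearI)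
    fix x y r
    have "Rep_bsum (\<iota> (x + y)) = Rep_bsum (\<iota> x + \<iota> y)"
      by (simp add: R plus_bsum.rep_eq linear_add[OF P(2)] fun_eq_iff)
    then show "\<iota> (x + y) = \<iota> x + \<iota> y" by (simp only: Rep_bsum_inject)
    have "Rep_bsum (\<iota> (r *\<^sub>R x)) = Rep_bsum (r *\<^sub>R \<iota> x)"
      by (simp add: R scaleR_bsum.rep_eq linear_scale[OF P(2)] fun_eq_iff)
    then show "\<iota> (r *\<^sub>R x) = r *\<^sub>R \<iota> x" by (simp only: Rep_bsum_inject)
  qed
  moreover have "norm (\<iota> x) = p x" if "x \<in> X" for x
  proof (rule antisym)
    have x: "P x = x" "x \<in> carr i0" using that P(3) i0(1) by auto
    show "p x \<le> norm (\<iota> x)"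
      using bnorm_le_norm[of i0 "\<iota> x"] x(1) i0(2) by (simp add: R)
    show "norm (\<iota> x) \<le> p x"
    proof (rule norm_bsum_le)
      fix i
      have "0 \<le> p x" using bnorm_nonneg[OF x(2)] i0(2) by simp
      then show "bnorm i (Rep_bsum (\<iota> x) i) \<le> p x"
        using x(1) i0(2) by (cases "i = i0") (simp_all add: R)
    qed
  qed
  moreover have "range \<iota> \<subseteq> \<iota> ` X"
  proof -
    have "\<iota> x = \<iota> (P x)" for x
    proof -
      have "P (P x) = P x" using P(1) by (intro P(3)) blast
      then show ?thesis unfolding \<iota>_def by metis
    qed
    then show ?thesis using P(1) by blast
  qed
  ultimately show ?thesis by blast
qed

section \<open>Limits and integrals in a scale\<close>

locale bscale =
  fixes S :: "('k::real_normed_field, 'a::real_vector) scale"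
  assumes banach_scale: "banach_scale S"
begin

abbreviation E :: "real \<Rightarrow> 'a set" where "E \<equiv> sp S"
abbreviation nm :: "real \<Rightarrow> 'a \<Rightarrow> real" where "nm \<equiv> nrm S"

lemma scl_of_real: "scl S (of_real r) x = r *\<^sub>R x"
  using banach_scale by (simp add: banach_scale_def)

lemma module_scl: "module (scl S)"
  using banach_scale by (simp add: banach_scale_def module_iff_vector_space)

lemma banach_in: "low S < \<alpha> \<Longrightarrow> banach_in S \<alpha>"
  using banach_scale by (simp add: banach_scale_def)

lemma E_scl: "low S < \<alpha> \<Longrightarrow> x \<in> E \<alpha> \<Longrightarrow> scl S c x \<in> E \<alpha>"
  and E_add: "low S < \<alpha> \<Longrightarrow> x \<in> E \<alpha> \<Longrightarrow> y \<in> E \<alpha> \<Longrightarrow> x + y \<in> E \<alpha>"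
  and E_zero: "low S < \<alpha> \<Longrightarrow> 0 \<in> E \<alpha>"
  using banach_in[of \<alpha>] module.subspace_def[OF module_scl] by (auto simp: banach_in_def)

lemma E_scaleR: "low S < \<alpha> \<Longrightarrow> x \<in> E \<alpha> \<Longrightarrow> r *\<^sub>R x \<in> E \<alpha>"
  using E_scl[of \<alpha> x "of_real r"] by (simp add: scl_of_real)

lemma E_subspace: "low S < \<alpha> \<Longrightarrow> subspace (E \<alpha>)"
  by (simp add: subspace_def E_zero E_add E_scaleR)

lemma E_diff: "low S < \<alpha> \<Longrightarrow> x \<in> E \<alpha> \<Longrightarrow> y \<in> E \<alpha> \<Longrightarrow> x - y \<in> E \<alpha>"
  by (simp add: E_subspace subspace_diff)

lemma E_sum: "low S < \<alpha> \<Longrightarrow> (\<And>i. i \<in> I \<Longrightarrow> f i \<in> E \<alpha>) \<Longrightarrow> sum f I \<in> E \<alpha>"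
  by (simp add: E_subspace subspace_sum)

lemma nm_nonneg: "low S < \<alpha> \<Longrightarrow> x \<in> E \<alpha> \<Longrightarrow> 0 \<le> nm \<alpha> x"
  and nm_eq_0: "low S < \<alpha> \<Longrightarrow> x \<in> E \<alpha> \<Longrightarrow> nm \<alpha> x = 0 \<longleftrightarrow> x = 0"
  and nm_scl: "low S < \<alpha> \<Longrightarrow> x \<in> E \<alpha> \<Longrightarrow> nm \<alpha> (scl S c x) = norm c * nm \<alpha> x"
  and nm_add: "low S < \<alpha> \<Longrightarrow> x \<in> E \<alpha> \<Longrightarrow> y \<in> E \<alpha> \<Longrightarrow> nm \<alpha> (x + y) \<le> nm \<alpha> x + nm \<alpha> y"
  and mcomplete_E: "low S < \<alpha> \<Longrightarrow> Metric_space.mcomplete (E \<alpha>) (ndist S \<alpha>)"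
  using banach_in[of \<alpha>] by (auto simp: banach_in_def)

lemma nm_scaleR: "low S < \<alpha> \<Longrightarrow> x \<in> E \<alpha> \<Longrightarrow> nm \<alpha> (r *\<^sub>R x) = \<bar>r\<bar> * nm \<alpha> x"
  using nm_scl[of \<alpha> x "of_real r"] by (simp add: scl_of_real)

lemma nm_zero: "low S < \<alpha> \<Longrightarrow> nm \<alpha> 0 = 0"
  using nm_eq_0[of \<alpha> 0] E_zero[of \<alpha>] by simp

lemma nm_commute: "low S < \<alpha> \<Longrightarrow> x \<in> E \<alpha> \<Longrightarrow> y \<in> E \<alpha> \<Longrightarrow> nm \<alpha> (x - y) = nm \<alpha> (y - x)"
  using nm_scaleR[of \<alpha> "x - y" "-1"] E_diff[of \<alpha> x y] by simp

lemma E_mono: "low S < \<alpha>' \<Longrightarrow> \<alpha>' \<le> \<alpha> \<Longrightarrow> x \<in> E \<alpha> \<Longrightarrow> x \<in> E \<alpha>'"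
  using banach_scale unfolding banach_scale_def by (cases "\<alpha>' = \<alpha>") (simp, metis order_le_less subsetD)

lemma nm_mono: "low S < \<alpha>' \<Longrightarrow> \<alpha>' \<le> \<alpha> \<Longrightarrow> x \<in> E \<alpha> \<Longrightarrow> nm \<alpha>' x \<le> nm \<alpha> x"
  using banach_scale by (cases "\<alpha>' = \<alpha>") (auto simp: banach_scale_def)

lemma Metric_space_E:
  assumes "low S < \<alpha>"
  shows "Metric_space (E \<alpha>) (ndist S \<alpha>)"
proof
  show "0 \<le> ndist S \<alpha> x y" for x y
    using assms by (simp add: ndist_def nm_nonneg E_diff)
  show "ndist S \<alpha> x y = ndist S \<alpha> y x" for x y
    using assms by (simp add: ndist_def nm_commute)
  show "ndist S \<alpha> x y = 0 \<longleftrightarrow> x = y" if "x \<in> E \<alpha>" "y \<in> E \<alpha>" for x y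
    using assms that by (simp add: ndist_def nm_eq_0 E_diff)
  show "ndist S \<alpha> x z \<le> ndist S \<alpha> x y + ndist S \<alpha> y z"
    if "x \<in> E \<alpha>" "y \<in> E \<alpha>" "z \<in> E \<alpha>" for x y z
    using assms that nm_add[of \<alpha> "x - y" "y - z"] by (simp add: ndist_def E_diff)
qed

lemma complete_norm_on_E:
  assumes \<alpha>: "low S < \<alpha>"
  shows "complete_norm_on (E \<alpha>) (nm \<alpha>)"
  unfolding complete_norm_on_def
proof (intro conjI ballI allI impI)
  interpret Metric_space "E \<alpha>" "ndist S \<alpha>" by (rule Metric_space_E[OF \<alpha>])
  fix f :: "nat \<Rightarrow> 'a"
  assume f: "\<forall>n. f n \<in> E \<alpha>" and C: "\<forall>e>0. \<exists>N. \<forall>m\<ge>N. \<forall>n\<ge>N. nm \<alpha> (f m - f n) < e"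
  then have "MCauchy f" by (auto simp: MCauchy_def ndist_def)
  then obtain x where x: "limitin mtopology f x sequentially"
    using mcomplete_E[OF \<alpha>] by (auto simp: mcomplete_def)
  then have xE: "x \<in> E \<alpha>" by (rule limitin_mspace)
  have "(\<lambda>n. nm \<alpha> (f n - x)) \<longlonglongrightarrow> 0"
  proof (rule LIMSEQ_I)
    fix r :: real assume "r > 0"
    then show "\<exists>N. \<forall>n\<ge>N. norm (nm \<alpha> (f n - x) - 0) < r"
      using x xE f \<alpha> by (simp add: limitin_metric eventually_sequentially ndist_def nm_nonneg E_diff)
  qed
  then show "\<exists>x\<in>E \<alpha>. (\<lambda>n. nm \<alpha> (f n - x)) \<longlonglongrightarrow> 0" using xE by blast
qed (use \<alpha> in \<open>auto simp: E_subspace nm_eq_0 nm_scaleR nm_add\<close>)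

text \<open>Outside \<open>E \<alpha>\<close> the embedding still is linear, but it has no relation to \<open>nm \<alpha>\<close> there.\<close>
definition em :: "real \<Rightarrow> 'a \<Rightarrow> 'a bsum" where
  "em \<alpha> = (SOME \<iota>. linear \<iota> \<and> (\<forall>x\<in>E \<alpha>. norm (\<iota> x) = nm \<alpha> x) \<and> range \<iota> = \<iota> ` E \<alpha>)"

lemma em_props:
  assumes "low S < \<alpha>"
  shows linear_em: "linear (em \<alpha>)" and norm_em: "x \<in> E \<alpha> \<Longrightarrow> norm (em \<alpha> x) = nm \<alpha> x"
    and range_em: "range (em \<alpha>) = em \<alpha> ` E \<alpha>"
proof -
  have "linear (em \<alpha>) \<and> (\<forall>x\<in>E \<alpha>. norm (em \<alpha> x) = nm \<alpha> x) \<and> range (em \<alpha>) = em \<alpha> ` E \<alpha>"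
    unfolding em_def by (rule someI_ex[OF complete_norm_on_isometry[OF complete_norm_on_E[OF assms]]])
  then show "linear (em \<alpha>)" "x \<in> E \<alpha> \<Longrightarrow> norm (em \<alpha> x) = nm \<alpha> x"
    "range (em \<alpha>) = em \<alpha> ` E \<alpha>" by blast+
qed

lemma em_add: "low S < \<alpha> \<Longrightarrow> em \<alpha> (x + y) = em \<alpha> x + em \<alpha> y"
  and em_diff: "low S < \<alpha> \<Longrightarrow> em \<alpha> (x - y) = em \<alpha> x - em \<alpha> y"
  and em_scaleR: "low S < \<alpha> \<Longrightarrow> em \<alpha> (r *\<^sub>R x) = r *\<^sub>R em \<alpha> x"
  and em_zero: "low S < \<alpha> \<Longrightarrow> em \<alpha> 0 = 0"
  and em_sum: "low S < \<alpha> \<Longrightarrow> em \<alpha> (sum f I) = (\<Sum>i\<in>I. em \<alpha> (f i))"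
  using linear_em[of \<alpha>] by (auto simp: linear_add linear_diff linear_scale linear_0 linear_sum)

lemma norm_em_diff:
  "low S < \<alpha> \<Longrightarrow> x \<in> E \<alpha> \<Longrightarrow> y \<in> E \<alpha> \<Longrightarrow> norm (em \<alpha> x - em \<alpha> y) = nm \<alpha> (x - y)"
  by (simp add: em_diff[symmetric] norm_em E_diff)

lemma dist_em:
  "low S < \<alpha> \<Longrightarrow> x \<in> E \<alpha> \<Longrightarrow> y \<in> E \<alpha> \<Longrightarrow> dist (em \<alpha> x) (em \<alpha> y) = nm \<alpha> (x - y)"
  by (simp add: dist_norm norm_em_diff)

lemma em_eq_iff:
  assumes "low S < \<alpha>" "x \<in> E \<alpha>" "y \<in> E \<alpha>"
  shows "em \<alpha> x = em \<alpha> y \<longleftrightarrow> x = y"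
  using norm_em_diff[OF assms] nm_eq_0[of \<alpha> "x - y"] assms
  by (metis E_diff eq_iff_diff_eq_0 norm_eq_zero)

text \<open>This is where completeness of the spaces enters: limits and integrals, computed in the ambient Banach
  space, come from elements of \<open>E \<alpha>\<close>.\<close>
lemma closed_range_em:
  assumes \<alpha>: "low S < \<alpha>"
  shows "closed (range (em \<alpha>))"
proof (rule closed_sequential_limits[THEN iffD2], intro allI impI, elim conjE)
  fix X l assume "\<forall>n. X n \<in> range (em \<alpha>)" and X: "X \<longlonglongrightarrow> l"
  then have "\<forall>n. \<exists>x\<in>E \<alpha>. X n = em \<alpha> x" unfolding range_em[OF \<alpha>] by blast
  then obtain f where f: "\<And>n. f n \<in> E \<alpha>" "\<And>n. X n = em \<alpha> (f n)" by metis
  have "\<forall>e>0. \<exists>N. \<forall>m\<ge>N. \<forall>n\<ge>N. nm \<alpha> (f m - f n) < e"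
  proof (intro allI impI)
    fix e :: real assume "e > 0"
    then obtain N where N: "\<And>m n. m \<ge> N \<Longrightarrow> n \<ge> N \<Longrightarrow> dist (X m) (X n) < e"
      using LIMSEQ_imp_Cauchy[OF X] unfolding Cauchy_def by blast
    then have "nm \<alpha> (f m - f n) < e" if "m \<ge> N" "n \<ge> N" for m n
      using N[OF that] by (simp add: f dist_em[OF \<alpha>])
    then show "\<exists>N. \<forall>m\<ge>N. \<forall>n\<ge>N. nm \<alpha> (f m - f n) < e" by blast
  qed
  then have "\<exists>x\<in>E \<alpha>. (\<lambda>n. nm \<alpha> (f n - x)) \<longlonglongrightarrow> 0"
    using complete_norm_on_E[OF \<alpha>] f(1) unfolding complete_norm_on_def by simp
  then obtain x where x: "x \<in> E \<alpha>" "(\<lambda>n. nm \<alpha> (f n - x)) \<longlonglongrightarrow> 0" by blast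
  then have "X \<longlonglongrightarrow> em \<alpha> x"
    unfolding tendsto_dist_iff[of X] by (simp add: f dist_em[OF \<alpha>])
  with X have "l = em \<alpha> x" by (rule LIMSEQ_unique)
  then show "l \<in> range (em \<alpha>)" by simp
qed

lemma tendsto_em_ex:
  assumes "low S < \<alpha>" "((\<lambda>p. em \<alpha> (f p)) \<longlongrightarrow> l) F" "F \<noteq> bot"
  obtains x where "x \<in> E \<alpha>" "l = em \<alpha> x"
proof -
  have "l \<in> range (em \<alpha>)"
    by (rule Lim_in_closed_set[OF closed_range_em[OF assms(1)] _ assms(3,2)]) simp
  then show ?thesis using that range_em[OF assms(1)] by auto
qed

lemma limitin_ntop_iff:
  assumes \<alpha>: "low S < \<alpha>"
  shows "limitin (ntop S \<alpha>) f l F \<longleftrightarrow>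
    l \<in> E \<alpha> \<and> (\<forall>\<^sub>F p in F. f p \<in> E \<alpha>) \<and> ((\<lambda>p. em \<alpha> (f p)) \<longlongrightarrow> em \<alpha> l) F"
proof -
  interpret Metric_space "E \<alpha>" "ndist S \<alpha>" by (rule Metric_space_E[OF \<alpha>])
  have *: "x \<in> E \<alpha> \<and> ndist S \<alpha> x l < e \<longleftrightarrow> x \<in> E \<alpha> \<and> dist (em \<alpha> x) (em \<alpha> l) < e" if "l \<in> E \<alpha>" for x e
    using \<alpha> that by (auto simp: ndist_def dist_em)
  show ?thesis
    unfolding ntop_def limitin_metric tendsto_iff
    by (cases "l \<in> E \<alpha>") (simp_all add: * eventually_conj_iff, metis zero_less_one)
qed

lemma atin_within_euclidean: "atin_within euclidean x X = at x within X"
  by (rule filter_eqI) (simp add: eventually_atin_within eventually_at_topological, meson)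

lemma continuous_map_ntop_iff:
  assumes \<alpha>: "low S < \<alpha>"
  shows "continuous_map (top_of_set X) (ntop S \<alpha>) f \<longleftrightarrow>
    (\<forall>p\<in>X. f p \<in> E \<alpha>) \<and> continuous_on X (\<lambda>p. em \<alpha> (f p))"
proof -
  interpret Metric_space "E \<alpha>" "ndist S \<alpha>" by (rule Metric_space_E[OF \<alpha>])
  have top: "topspace (ntop S \<alpha>) = E \<alpha>" by (simp add: ntop_def)
  show ?thesis
  proof (cases "\<forall>p\<in>X. f p \<in> E \<alpha>")
    case True
    have "continuous_map (top_of_set X) (ntop S \<alpha>) f \<longleftrightarrow>
        (\<forall>x\<in>X. limitin (ntop S \<alpha>) f (f x) (at x within X))"
      by (simp add: continuous_map_atin atin_subtopology_within atin_within_euclidean)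
    also have "\<dots> \<longleftrightarrow> (\<forall>x\<in>X. ((\<lambda>p. em \<alpha> (f p)) \<longlongrightarrow> em \<alpha> (f x)) (at x within X))"
      using True by (simp add: limitin_ntop_iff[OF \<alpha>] eventually_at_filter)
    finally show ?thesis using True by (simp add: continuous_on_def)
  next
    case False
    then show ?thesis by (auto simp: continuous_map_def top Pi_iff)
  qed
qed

lemma op_add: "T \<in> bounded_op S \<alpha> \<alpha>' \<Longrightarrow> x \<in> E \<alpha> \<Longrightarrow> y \<in> E \<alpha> \<Longrightarrow> T (x + y) = T x + T y"
  and op_scl: "T \<in> bounded_op S \<alpha> \<alpha>' \<Longrightarrow> x \<in> E \<alpha> \<Longrightarrow> T (scl S c x) = scl S c (T x)"
  and op_E: "T \<in> bounded_op S \<alpha> \<alpha>' \<Longrightarrow> x \<in> E \<alpha> \<Longrightarrow> T x \<in> E \<alpha>'"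
  by (auto simp: bounded_op_def)

lemma op_scaleR: "T \<in> bounded_op S \<alpha> \<alpha>' \<Longrightarrow> x \<in> E \<alpha> \<Longrightarrow> T (r *\<^sub>R x) = r *\<^sub>R T x"
  using op_scl[of T \<alpha> \<alpha>' x "of_real r"] by (simp add: scl_of_real)

lemma op_zero: "T \<in> bounded_op S \<alpha> \<alpha>' \<Longrightarrow> low S < \<alpha> \<Longrightarrow> T 0 = 0"
  using op_scaleR[of T \<alpha> \<alpha>' 0 0] E_zero by simp

lemma op_diff:
  assumes "T \<in> bounded_op S \<alpha> \<alpha>'" "low S < \<alpha>" "x \<in> E \<alpha>" "y \<in> E \<alpha>"
  shows "T (x - y) = T x - T y"
  using op_add[of T \<alpha> \<alpha>' "x - y" y] assms by (simp add: E_diff algebra_simps)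

lemma op_sum:
  assumes "T \<in> bounded_op S \<alpha> \<alpha>'" "low S < \<alpha>" "\<And>i. i \<in> I \<Longrightarrow> f i \<in> E \<alpha>"
  shows "T (sum f I) = (\<Sum>i\<in>I. T (f i))"
  using assms(3)
  by (induction I rule: infinite_finite_induct)
    (auto simp: op_zero[OF assms(1,2)] op_add[OF assms(1)] E_sum assms(2))

lemma op_bound:
  assumes "T \<in> bounded_op S \<alpha> \<alpha>'" "low S < \<alpha>"
  obtains C where "0 \<le> C" "\<And>x. x \<in> E \<alpha> \<Longrightarrow> nm \<alpha>' (T x) \<le> C * nm \<alpha> x"
proof -
  obtain C where C: "\<And>x. x \<in> E \<alpha> \<Longrightarrow> nm \<alpha>' (T x) \<le> C * nm \<alpha> x"
    using assms unfolding bounded_op_def by blast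
  have "nm \<alpha>' (T x) \<le> max 0 C * nm \<alpha> x" if "x \<in> E \<alpha>" for x
    by (rule order_trans[OF C[OF that]]) (simp add: mult_right_mono nm_nonneg assms that)
  then show ?thesis using that[of "max 0 C"] by simp
qed

lemma bounded_op_id: "low S < \<alpha>' \<Longrightarrow> \<alpha>' \<le> \<alpha> \<Longrightarrow> (\<lambda>x. x) \<in> bounded_op S \<alpha> \<alpha>'"
  by (auto simp: bounded_op_def E_mono nm_mono intro!: exI[of _ 1])

lemma tendsto_em_zero:
  assumes "low S < \<alpha>" "\<forall>\<^sub>F p in F. f p \<in> E \<alpha>" "l \<in> E \<alpha>"
  shows "((\<lambda>p. em \<alpha> (f p)) \<longlongrightarrow> em \<alpha> l) F \<longleftrightarrow> ((\<lambda>p. nm \<alpha> (f p - l)) \<longlongrightarrow> 0) F"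
  unfolding tendsto_dist_iff[of _ "em \<alpha> l"]
  by (rule tendsto_cong) (use assms(2) in eventually_elim, simp add: dist_em assms)

text \<open>Equiboundedness turns strong convergence of operators into convergence along convergent arguments.\<close>
lemma tendsto_op_apply:
  assumes \<alpha>: "low S < \<alpha>" "low S < \<alpha>'"
    and T: "\<forall>\<^sub>F p in F. T p \<in> bounded_op S \<alpha> \<alpha>'"
    and C: "\<forall>\<^sub>F p in F. \<forall>x\<in>E \<alpha>. nm \<alpha>' (T p x) \<le> C * nm \<alpha> x"
    and f: "\<forall>\<^sub>F p in F. f p \<in> E \<alpha>" "((\<lambda>p. em \<alpha> (f p)) \<longlongrightarrow> em \<alpha> x) F" and x: "x \<in> E \<alpha>"
    and Tx: "((\<lambda>p. em \<alpha>' (T p x)) \<longlongrightarrow> y) F"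
  shows "((\<lambda>p. em \<alpha>' (T p (f p))) \<longlongrightarrow> y) F"
proof -
  have "((\<lambda>p. em \<alpha>' (T p (f p)) - em \<alpha>' (T p x)) \<longlongrightarrow> 0) F"
  proof (rule Lim_null_comparison)
    show "\<forall>\<^sub>F p in F. norm (em \<alpha>' (T p (f p)) - em \<alpha>' (T p x)) \<le> C * nm \<alpha> (f p - x)"
      using T C f(1)
    proof eventually_elim
      case (elim p)
      have "norm (em \<alpha>' (T p (f p)) - em \<alpha>' (T p x)) = nm \<alpha>' (T p (f p - x))"
        using elim x \<alpha> by (simp add: norm_em_diff op_E op_diff[OF elim(1) \<alpha>(1)])
      then show ?case using elim x \<alpha> by (simp add: E_diff)
    qed
    show "((\<lambda>p. C * nm \<alpha> (f p - x)) \<longlongrightarrow> 0) F"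
      using f(2) unfolding tendsto_em_zero[OF \<alpha>(1) f(1) x] by (rule tendsto_mult_right_zero)
  qed
  from tendsto_add[OF this Tx] show ?thesis by simp
qed

lemma tendsto_op:
  assumes "low S < \<alpha>" "low S < \<alpha>'" "T \<in> bounded_op S \<alpha> \<alpha>'"
    and "\<forall>\<^sub>F p in F. f p \<in> E \<alpha>" "((\<lambda>p. em \<alpha> (f p)) \<longlongrightarrow> em \<alpha> x) F" "x \<in> E \<alpha>"
  shows "((\<lambda>p. em \<alpha>' (T (f p))) \<longlongrightarrow> em \<alpha>' (T x)) F"
proof -
  obtain C where C: "\<And>x. x \<in> E \<alpha> \<Longrightarrow> nm \<alpha>' (T x) \<le> C * nm \<alpha> x"
    using op_bound[OF assms(3,1)] by blast
  show ?thesis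
    by (rule tendsto_op_apply[where T="\<lambda>_. T" and C=C, OF assms(1,2) _ _ assms(4-6)])
      (use assms(3) C in auto)
qed

lemma tendsto_em_mono:
  assumes "low S < \<alpha>'" "\<alpha>' \<le> \<alpha>" "\<forall>\<^sub>F p in F. f p \<in> E \<alpha>" "((\<lambda>p. em \<alpha> (f p)) \<longlongrightarrow> em \<alpha> x) F" "x \<in> E \<alpha>"
  shows "((\<lambda>p. em \<alpha>' (f p)) \<longlongrightarrow> em \<alpha>' x) F"
  using tendsto_op[OF _ assms(1) bounded_op_id[OF assms(1,2)] assms(3-5)] assms(1,2) by simp

lemma has_integral_em_iff:
  fixes a b :: real
  assumes "low S < \<alpha>"
  shows "((\<lambda>r. em \<alpha> (f r)) has_integral em \<alpha> y) {a..b} \<longleftrightarrow>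
    ((\<lambda>p. em \<alpha> (\<Sum>(x, k)\<in>p. measure lborel k *\<^sub>R f x)) \<longlongrightarrow> em \<alpha> y) (division_filter (cbox a b))"
  using has_integral_cbox[of "\<lambda>r. em \<alpha> (f r)" "em \<alpha> y" a b]
  by (simp add: em_sum[OF assms] em_scaleR[OF assms] case_prod_unfold)

lemma riemann_sum_E:
  fixes a b :: real
  assumes "low S < \<alpha>" "\<And>r. r \<in> {a..b} \<Longrightarrow> f r \<in> E \<alpha>"
  shows "\<forall>\<^sub>F p in division_filter (cbox a b). (\<Sum>(x, k)\<in>p. measure lborel k *\<^sub>R f x) \<in> E \<alpha>"
  using eventually_division_filter_tagged_division[of "cbox a b"]
proof eventually_elim
  case (elim p)
  have "f x \<in> E \<alpha>" if "(x, k) \<in> p" for x k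
    using tagged_division_ofD(2,3)[OF elim that] by (intro assms(2)) auto
  then show ?case by (auto intro!: E_sum E_scaleR assms(1))
qed

lemma has_integral_in_iff:
  assumes "low S < \<alpha>" "\<And>r. r \<in> {a..b} \<Longrightarrow> f r \<in> E \<alpha>"
  shows "has_integral_in S \<alpha> a b f y \<longleftrightarrow> y \<in> E \<alpha> \<and> ((\<lambda>r. em \<alpha> (f r)) has_integral em \<alpha> y) {a..b}"
  unfolding has_integral_in_def limitin_ntop_iff[OF assms(1)] has_integral_em_iff[OF assms(1)]
  using riemann_sum_E[OF assms] by auto

text \<open>A bounded operator maps Riemann sums to Riemann sums. It is defined on \<open>E \<alpha>\<close> only, so that the usual
  rule for bounded linear maps does not apply to it.\<close>
lemma has_integral_op:
  fixes a b :: real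
  assumes "low S < \<alpha>" "low S < \<alpha>'" "T \<in> bounded_op S \<alpha> \<alpha>'"
    and f: "\<And>r. r \<in> {a..b} \<Longrightarrow> f r \<in> E \<alpha>" and y: "y \<in> E \<alpha>"
    and int: "((\<lambda>r. em \<alpha> (f r)) has_integral em \<alpha> y) {a..b}"
  shows "((\<lambda>r. em \<alpha>' (T (f r))) has_integral em \<alpha>' (T y)) {a..b}"
proof -
  let ?D = "division_filter (cbox a b)"
  have "((\<lambda>p. em \<alpha>' (T (\<Sum>(x, k)\<in>p. measure lborel k *\<^sub>R f x))) \<longlongrightarrow> em \<alpha>' (T y)) ?D"
    by (rule tendsto_op[OF assms(1-3) riemann_sum_E[OF assms(1) f] int[unfolded has_integral_em_iff[OF assms(1)]] y])
  moreover have "\<forall>\<^sub>F p in ?D. em \<alpha>' (T (\<Sum>(x, k)\<in>p. measure lborel k *\<^sub>R f x))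
      = em \<alpha>' (\<Sum>(x, k)\<in>p. measure lborel k *\<^sub>R T (f x))"
    using eventually_division_filter_tagged_division[of "cbox a b"]
  proof eventually_elim
    case (elim p)
    have fx: "f x \<in> E \<alpha>" if "(x, k) \<in> p" for x k
      using tagged_division_ofD(2,3)[OF elim that] by (intro f) auto
    have "T (\<Sum>(x, k)\<in>p. measure lborel k *\<^sub>R f x) = (\<Sum>i\<in>p. T (case i of (x, k) \<Rightarrow> measure lborel k *\<^sub>R f x))"
      using fx by (intro op_sum[OF assms(3,1)]) (auto intro!: E_scaleR assms(1))
    also have "\<dots> = (\<Sum>(x, k)\<in>p. measure lborel k *\<^sub>R T (f x))"
      using fx by (intro sum.cong) (auto simp: op_scaleR[OF assms(3)])
    finally show ?case by simp
  qed
  ultimately show ?thesis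
    unfolding has_integral_em_iff[OF assms(2)] by (rule Lim_transform_eventually)
qed

lemma has_integral_em_mono:
  fixes a b :: real
  assumes "low S < \<alpha>'" "\<alpha>' \<le> \<alpha>" "\<And>r. r \<in> {a..b} \<Longrightarrow> f r \<in> E \<alpha>" "y \<in> E \<alpha>"
    and "((\<lambda>r. em \<alpha> (f r)) has_integral em \<alpha> y) {a..b}"
  shows "((\<lambda>r. em \<alpha>' (f r)) has_integral em \<alpha>' y) {a..b}"
  using has_integral_op[OF _ assms(1) bounded_op_id[OF assms(1,2)] assms(3-5)] assms(1,2) by simp

lemma has_integral_em_ex:
  fixes a b :: real
  assumes \<alpha>: "low S < \<alpha>" and int: "(\<lambda>r. em \<alpha> (f r)) integrable_on {a..b}"
  shows "\<exists>y\<in>E \<alpha>. ((\<lambda>r. em \<alpha> (f r)) has_integral em \<alpha> y) {a..b}"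
proof -
  obtain J where J: "((\<lambda>r. em \<alpha> (f r)) has_integral J) {a..b}"
    using int by (auto simp: integrable_on_def)
  have "((\<lambda>p. em \<alpha> (\<Sum>(x, k)\<in>p. measure lborel k *\<^sub>R f x)) \<longlongrightarrow> J) (division_filter (cbox a b))"
    using J has_integral_cbox[of "\<lambda>r. em \<alpha> (f r)" J a b]
    by (simp add: em_sum[OF \<alpha>] em_scaleR[OF \<alpha>] case_prod_unfold)
  then obtain y where "y \<in> E \<alpha>" "J = em \<alpha> y"
    by (rule tendsto_em_ex[OF \<alpha> _ division_filter_not_empty])
  with J show ?thesis by blast
qed

text \<open>Convergence in one space of the scale implies convergence to the same element in every larger one. A
  limit can therefore be denoted without an index, and \<open>integ\<close> below does the same for integrals.\<close>
definition slim :: "(nat \<Rightarrow> 'a) \<Rightarrow> 'a" where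
  "slim X = (SOME y. \<exists>\<beta>>low S. y \<in> E \<beta> \<and> (\<forall>n. X n \<in> E \<beta>) \<and> (\<lambda>n. em \<beta> (X n)) \<longlonglongrightarrow> em \<beta> y)"

lemma slim_eq:
  assumes "low S < \<beta>" "y \<in> E \<beta>" "\<And>n. X n \<in> E \<beta>" "(\<lambda>n. em \<beta> (X n)) \<longlonglongrightarrow> em \<beta> y"
  shows "slim X = y"
  unfolding slim_def
proof (rule some_equality)
  show "\<exists>\<beta>>low S. y \<in> E \<beta> \<and> (\<forall>n. X n \<in> E \<beta>) \<and> (\<lambda>n. em \<beta> (X n)) \<longlonglongrightarrow> em \<beta> y"
    using assms by blast
  fix z assume "\<exists>\<beta>>low S. z \<in> E \<beta> \<and> (\<forall>n. X n \<in> E \<beta>) \<and> (\<lambda>n. em \<beta> (X n)) \<longlonglongrightarrow> em \<beta> z"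
  then obtain \<gamma> where \<gamma>: "low S < \<gamma>" "z \<in> E \<gamma>" "\<And>n. X n \<in> E \<gamma>" "(\<lambda>n. em \<gamma> (X n)) \<longlonglongrightarrow> em \<gamma> z" by blast
  define \<mu> where "\<mu> = min \<beta> \<gamma>"
  have \<mu>: "low S < \<mu>" "\<mu> \<le> \<beta>" "\<mu> \<le> \<gamma>" using assms \<gamma> by (auto simp: \<mu>_def)
  have "(\<lambda>n. em \<mu> (X n)) \<longlonglongrightarrow> em \<mu> y" "(\<lambda>n. em \<mu> (X n)) \<longlonglongrightarrow> em \<mu> z"
    using assms \<gamma> \<mu> by (auto intro: tendsto_em_mono)
  then have "em \<mu> z = em \<mu> y" by (metis LIMSEQ_unique)
  then show "z = y" using em_eq_iff[OF \<mu>(1)] E_mono[OF \<mu>(1)] \<mu> assms(2) \<gamma>(2) by blast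
qed

lemma slim_Cauchy:
  assumes \<beta>: "low S < \<beta>" and X: "\<And>n. X n \<in> E \<beta>" and C: "Cauchy (\<lambda>n. em \<beta> (X n))"
  shows "slim X \<in> E \<beta>" "(\<lambda>n. em \<beta> (X n)) \<longlonglongrightarrow> em \<beta> (slim X)"
proof -
  obtain l where l: "(\<lambda>n. em \<beta> (X n)) \<longlonglongrightarrow> l" using C by (auto simp: Cauchy_convergent_iff convergent_def)
  then obtain y where y: "y \<in> E \<beta>" "l = em \<beta> y" by (rule tendsto_em_ex[OF \<beta> _ sequentially_bot])
  with slim_eq[OF \<beta> y(1) X] l show "slim X \<in> E \<beta>" "(\<lambda>n. em \<beta> (X n)) \<longlonglongrightarrow> em \<beta> (slim X)" by auto
qed

definition integ :: "real \<Rightarrow> real \<Rightarrow> (real \<Rightarrow> 'a) \<Rightarrow> 'a" where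
  "integ a b f = (SOME y. \<exists>\<beta>>low S. y \<in> E \<beta> \<and> (\<forall>r\<in>{a..b}. f r \<in> E \<beta>) \<and>
     ((\<lambda>r. em \<beta> (f r)) has_integral em \<beta> y) {a..b})"

lemma integ_eq:
  assumes "low S < \<beta>" "y \<in> E \<beta>" "\<And>r. r \<in> {a..b} \<Longrightarrow> f r \<in> E \<beta>"
    and "((\<lambda>r. em \<beta> (f r)) has_integral em \<beta> y) {a..b}"
  shows "integ a b f = y"
  unfolding integ_def
proof (rule some_equality)
  show "\<exists>\<beta>>low S. y \<in> E \<beta> \<and> (\<forall>r\<in>{a..b}. f r \<in> E \<beta>) \<and> ((\<lambda>r. em \<beta> (f r)) has_integral em \<beta> y) {a..b}"
    using assms by blast
  fix z assume "\<exists>\<beta>>low S. z \<in> E \<beta> \<and> (\<forall>r\<in>{a..b}. f r \<in> E \<beta>) \<and> ((\<lambda>r. em \<beta> (f r)) has_integral em \<beta> z) {a..b}"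
  then obtain \<gamma> where \<gamma>: "low S < \<gamma>" "z \<in> E \<gamma>" "\<And>r. r \<in> {a..b} \<Longrightarrow> f r \<in> E \<gamma>"
    "((\<lambda>r. em \<gamma> (f r)) has_integral em \<gamma> z) {a..b}" by blast
  define \<mu> where "\<mu> = min \<beta> \<gamma>"
  have \<mu>: "low S < \<mu>" "\<mu> \<le> \<beta>" "\<mu> \<le> \<gamma>" using assms \<gamma> by (auto simp: \<mu>_def)
  have "((\<lambda>r. em \<mu> (f r)) has_integral em \<mu> y) {a..b}" "((\<lambda>r. em \<mu> (f r)) has_integral em \<mu> z) {a..b}"
    using has_integral_em_mono[OF \<mu>(1,2) assms(3,2,4)] has_integral_em_mono[OF \<mu>(1,3) \<gamma>(3,2,4)] by auto
  then have "em \<mu> z = em \<mu> y" by (metis has_integral_unique)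
  then show "z = y" using em_eq_iff[OF \<mu>(1)] E_mono[OF \<mu>(1)] \<mu> assms(2) \<gamma>(2) by blast
qed

lemma integ_continuous:
  assumes \<beta>: "low S < \<beta>" and f: "\<And>r. r \<in> {a..b} \<Longrightarrow> f r \<in> E \<beta>"
    and c: "continuous_on {a..b} (\<lambda>r. em \<beta> (f r))"
  shows "integ a b f \<in> E \<beta>" "((\<lambda>r. em \<beta> (f r)) has_integral em \<beta> (integ a b f)) {a..b}"
proof -
  obtain y where y: "y \<in> E \<beta>" "((\<lambda>r. em \<beta> (f r)) has_integral em \<beta> y) {a..b}"
    using has_integral_em_ex[OF \<beta> integrable_continuous_real[OF c]] by blast
  with integ_eq[OF \<beta> y(1) f y(2)] show "integ a b f \<in> E \<beta>"
    "((\<lambda>r. em \<beta> (f r)) has_integral em \<beta> (integ a b f)) {a..b}" by auto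
qed

section \<open>Operators between the spaces of a scale\<close>

lemma opnorm_bdd:
  assumes "low S < \<alpha>" "0 \<le> C" "\<And>x. x \<in> E \<alpha> \<Longrightarrow> nm \<alpha>' (T x) \<le> C * nm \<alpha> x" "x \<in> E \<alpha>"
  shows "nm \<alpha>' (T x) / nm \<alpha> x \<le> C"
  using assms(3)[OF assms(4)] nm_nonneg[OF assms(1,4)] assms(2)
  by (cases "nm \<alpha> x = 0") (auto simp: divide_le_eq)

lemma opnorm_le:
  assumes "low S < \<alpha>" "0 \<le> C" "\<And>x. x \<in> E \<alpha> \<Longrightarrow> nm \<alpha>' (T x) \<le> C * nm \<alpha> x"
  shows "opnorm S \<alpha> \<alpha>' T \<le> C"
  unfolding opnorm_def
  by (rule cSUP_least) (use assms E_zero opnorm_bdd[OF assms] in auto)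

lemma opnorm_bound:
  assumes "low S < \<alpha>" "low S < \<alpha>'" "T \<in> bounded_op S \<alpha> \<alpha>'" "x \<in> E \<alpha>"
  shows "nm \<alpha>' (T x) \<le> opnorm S \<alpha> \<alpha>' T * nm \<alpha> x"
proof -
  obtain C where C: "0 \<le> C" "\<And>x. x \<in> E \<alpha> \<Longrightarrow> nm \<alpha>' (T x) \<le> C * nm \<alpha> x"
    using op_bound[OF assms(3,1)] by blast
  have "bdd_above ((\<lambda>x. nm \<alpha>' (T x) / nm \<alpha> x) ` E \<alpha>)"
    using opnorm_bdd[OF assms(1) C] by (intro bdd_aboveI2)
  then have le: "nm \<alpha>' (T x) / nm \<alpha> x \<le> opnorm S \<alpha> \<alpha>' T"
    unfolding opnorm_def using assms(4) by (rule cSUP_upper[rotated])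
  show ?thesis
  proof (cases "x = 0")
    case True
    then show ?thesis using op_zero[OF assms(3,1)] assms by (simp add: nm_zero)
  next
    case False
    then have "nm \<alpha> x > 0" using nm_nonneg[of \<alpha> x] nm_eq_0[of \<alpha> x] assms by simp
    then show ?thesis using le by (simp add: divide_le_eq)
  qed
qed

lemma opnorm_nonneg:
  assumes "low S < \<alpha>" "low S < \<alpha>'" "T \<in> bounded_op S \<alpha> \<alpha>'"
  shows "0 \<le> opnorm S \<alpha> \<alpha>' T"
proof -
  obtain C where C: "0 \<le> C" "\<And>x. x \<in> E \<alpha> \<Longrightarrow> nm \<alpha>' (T x) \<le> C * nm \<alpha> x"
    using op_bound[OF assms(3,1)] by blast
  have "bdd_above ((\<lambda>x. nm \<alpha>' (T x) / nm \<alpha> x) ` E \<alpha>)"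
    using opnorm_bdd[OF assms(1) C] by (intro bdd_aboveI2)
  then have "nm \<alpha>' (T 0) / nm \<alpha> 0 \<le> opnorm S \<alpha> \<alpha>' T"
    unfolding opnorm_def by (rule cSUP_upper[OF E_zero[OF assms(1)]])
  then show ?thesis by (simp add: nm_zero assms)
qed

lemma bounded_op_diff:
  assumes "low S < \<alpha>" "low S < \<alpha>'" "T \<in> bounded_op S \<alpha> \<alpha>'" "U \<in> bounded_op S \<alpha> \<alpha>'"
  shows "(\<lambda>x. T x - U x) \<in> bounded_op S \<alpha> \<alpha>'"
proof -
  obtain C where C: "0 \<le> C" "\<And>x. x \<in> E \<alpha> \<Longrightarrow> nm \<alpha>' (T x) \<le> C * nm \<alpha> x"
    using op_bound[OF assms(3,1)] by blast
  obtain D where D: "0 \<le> D" "\<And>x. x \<in> E \<alpha> \<Longrightarrow> nm \<alpha>' (U x) \<le> D * nm \<alpha> x"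
    using op_bound[OF assms(4,1)] by blast
  have "nm \<alpha>' (T x - U x) \<le> (C + D) * nm \<alpha> x" if x: "x \<in> E \<alpha>" for x
  proof -
    have "nm \<alpha>' (T x - U x) = norm (em \<alpha>' (T x) - em \<alpha>' (U x))"
      using assms x by (simp add: norm_em_diff op_E)
    also have "\<dots> \<le> norm (em \<alpha>' (T x)) + norm (em \<alpha>' (U x))" by (rule norm_triangle_ineq4)
    also have "\<dots> = nm \<alpha>' (T x) + nm \<alpha>' (U x)" using assms x by (simp add: norm_em op_E)
    finally show ?thesis using C(2)[OF x] D(2)[OF x] by (simp add: distrib_right)
  qed
  moreover have "scl S c (T x) - scl S c (U x) = scl S c (T x - U x)" for c x
    using module.scale_right_diff_distrib[OF module_scl] by metis
  ultimately show ?thesis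
    using assms by (auto simp: bounded_op_def image_subset_iff intro!: E_diff)
qed

text \<open>Elements of \<open>L(E)\<close> as single maps: the two compatibility conditions on a collection say that it does not
  depend on the index of the target, and that on a smaller space it is the restriction of itself.\<close>
definition ops :: "('a \<Rightarrow> 'a) set" where
  "ops = {a. \<forall>\<alpha>' \<alpha>. low S < \<alpha>' \<longrightarrow> \<alpha>' < \<alpha> \<longrightarrow> a \<in> bounded_op S \<alpha> \<alpha>'}"

lemma opsD: "a \<in> ops \<Longrightarrow> low S < \<alpha>' \<Longrightarrow> \<alpha>' < \<alpha> \<Longrightarrow> a \<in> bounded_op S \<alpha> \<alpha>'"
  by (simp add: ops_def)

lemma ops_E: "a \<in> ops \<Longrightarrow> low S < \<alpha>' \<Longrightarrow> \<alpha>' < \<alpha> \<Longrightarrow> x \<in> E \<alpha> \<Longrightarrow> a x \<in> E \<alpha>'"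
  using op_E opsD by blast

lemma ops_coll: "a \<in> ops \<Longrightarrow> (\<lambda>_ _. a) \<in> scale_ops S"
  by (simp add: ops_def scale_ops_def)

text \<open>The map on the union of all spaces that induces every member of a collection.\<close>
definition flat :: "'a coll \<Rightarrow> 'a \<Rightarrow> 'a" where
  "flat A x = (SOME y. \<exists>\<alpha>' \<alpha>. low S < \<alpha>' \<and> \<alpha>' < \<alpha> \<and> x \<in> E \<alpha> \<and> y = A \<alpha> \<alpha>' x)"

lemma scale_ops_cod:
  assumes "A \<in> scale_ops S" "low S < \<alpha>'" "\<alpha>' < \<alpha>" "low S < \<beta>'" "\<beta>' < \<alpha>" "x \<in> E \<alpha>"
  shows "A \<alpha> \<alpha>' x = A \<alpha> \<beta>' x"
  using assms unfolding scale_ops_def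
  by (cases \<alpha>' \<beta>' rule: linorder_cases) auto

lemma scale_ops_dom:
  "A \<in> scale_ops S \<Longrightarrow> low S < \<alpha>' \<Longrightarrow> \<alpha>' < \<alpha> \<Longrightarrow> \<alpha> < \<alpha>'' \<Longrightarrow> x \<in> E \<alpha>'' \<Longrightarrow> A \<alpha>'' \<alpha>' x = A \<alpha> \<alpha>' x"
  unfolding scale_ops_def by blast

lemma flat_eq:
  assumes A: "A \<in> scale_ops S" and \<alpha>: "low S < \<alpha>'" "\<alpha>' < \<alpha>" "x \<in> E \<alpha>"
  shows "flat A x = A \<alpha> \<alpha>' x"
  unfolding flat_def
proof (rule some_equality)
  show "\<exists>\<beta>' \<beta>. low S < \<beta>' \<and> \<beta>' < \<beta> \<and> x \<in> E \<beta> \<and> A \<alpha> \<alpha>' x = A \<beta> \<beta>' x" using \<alpha> by blast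
  fix y assume "\<exists>\<beta>' \<beta>. low S < \<beta>' \<and> \<beta>' < \<beta> \<and> x \<in> E \<beta> \<and> y = A \<beta> \<beta>' x"
  then obtain \<beta>' \<beta> where \<beta>: "low S < \<beta>'" "\<beta>' < \<beta>" "x \<in> E \<beta>" "y = A \<beta> \<beta>' x" by blast
  obtain \<mu> where \<mu>: "low S < \<mu>" "\<mu> < \<alpha>" "\<mu> < \<beta>"
    using \<alpha> \<beta> dense[of "low S" "min \<alpha> \<beta>"] by auto
  have "A \<alpha> \<mu> x = A \<beta> \<mu> x"
  proof (cases \<alpha> \<beta> rule: linorder_cases)
    case less
    show ?thesis by (rule scale_ops_dom[OF A \<mu>(1,2) less \<beta>(3), symmetric])
  next
    case greater
    show ?thesis by (rule scale_ops_dom[OF A \<mu>(1,3) greater \<alpha>(3)])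
  qed simp
  then show "y = A \<alpha> \<alpha>' x"
    using scale_ops_cod[OF A \<mu>(1,2) \<alpha>] scale_ops_cod[OF A \<mu>(1,3) \<beta>(1-3)] \<beta>(4) by simp
qed

lemma bounded_op_cong:
  assumes "\<And>x. x \<in> E \<alpha> \<Longrightarrow> T x = U x" "low S < \<alpha>"
  shows "T \<in> bounded_op S \<alpha> \<alpha>' \<longleftrightarrow> U \<in> bounded_op S \<alpha> \<alpha>'"
  unfolding bounded_op_def using assms by (auto simp: E_add E_scl image_subset_iff)

lemma opnorm_cong: "(\<And>x. x \<in> E \<alpha> \<Longrightarrow> T x = U x) \<Longrightarrow> opnorm S \<alpha> \<alpha>' T = opnorm S \<alpha> \<alpha>' U"
  unfolding opnorm_def by (rule arg_cong[where f=Sup]) (auto intro: image_cong)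

lemma flat_ops: "A \<in> scale_ops S \<Longrightarrow> flat A \<in> ops"
  unfolding ops_def
proof (intro CollectI allI impI)
  fix \<alpha>' \<alpha> assume A: "A \<in> scale_ops S" "low S < \<alpha>'" "\<alpha>' < \<alpha>"
  then have "A \<alpha> \<alpha>' \<in> bounded_op S \<alpha> \<alpha>'" by (simp add: scale_ops_def)
  then show "flat A \<in> bounded_op S \<alpha> \<alpha>'"
    using bounded_op_cong[of \<alpha> "flat A" "A \<alpha> \<alpha>'" \<alpha>'] flat_eq[OF A] A by simp
qed

end

section \<open>Integrals with variable bounds and over triangles\<close>

lemma integral_reparametrize:
  fixes f :: "real \<Rightarrow> 'b::banach"
  assumes "s \<le> t" "continuous_on {s..t} f"
  shows "integral {s..t} f = (t - s) *\<^sub>R integral {0..1} (\<lambda>\<theta>. f (s + \<theta> * (t - s)))"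
proof (cases "s = t")
  case False
  with assms have lt: "s < t" by simp
  have "(f has_integral integral {s..t} f) (cbox s t)"
    using integrable_continuous_real[OF assms(2)] by (simp add: integrable_integral)
  from has_integral_affinity[OF this, of "t - s" s] lt
  have "((\<lambda>x. f ((t - s) * x + s)) has_integral (1 / (t - s)) *\<^sub>R integral {s..t} f)
      ((\<lambda>x. (1 / (t - s)) * x - s / (t - s)) ` {s..t})" by simp
  moreover have "(\<lambda>x. (1 / (t - s)) * x - s / (t - s)) ` {s..t} = {0..1}"
    using lt image_affinity_atLeastAtMost[of "1 / (t - s)" "- (s / (t - s))" s t]
    by (simp add: field_simps diff_divide_distrib[symmetric])
  ultimately have "integral {0..1} (\<lambda>x. f (s + x * (t - s))) = (1 / (t - s)) *\<^sub>R integral {s..t} f"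
    by (simp add: add.commute mult.commute integral_unique)
  with lt show ?thesis by simp
qed simp

text \<open>The substitution \<open>r = s + \<theta> (t - s)\<close> turns the variable interval into \<open>[0,1]\<close>.\<close>
lemma continuous_on_integral_bounds:
  fixes F :: "real \<times> real \<times> real \<Rightarrow> 'b::banach"
  assumes F: "continuous_on {(t, r, s). (t, s) \<in> X \<and> s \<le> r \<and> r \<le> t} F"
    and X: "\<And>t s. (t, s) \<in> X \<Longrightarrow> s \<le> t"
  shows "continuous_on X (\<lambda>(t, s). integral {s..t} (\<lambda>r. F (t, r, s)))"
proof -
  let ?G = "\<lambda>p \<theta>. F (fst p, snd p + \<theta> * (fst p - snd p), snd p)"
  have "continuous_on (X \<times> cbox 0 1) (\<lambda>(p, \<theta>). ?G p \<theta>)"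
    unfolding case_prod_unfold
  proof (rule continuous_on_compose2[OF F])
    show "continuous_on (X \<times> cbox 0 1) (\<lambda>x. (fst (fst x), snd (fst x) + snd x * (fst (fst x) - snd (fst x)), snd (fst x)))"
      by (intro continuous_intros)
    have "s + \<theta> * (t - s) \<le> t" if "(t, s) \<in> X" "0 \<le> \<theta>" "\<theta> \<le> 1" for t s \<theta> :: real
      using mult_right_mono[OF that(3), of "t - s"] X[OF that(1)] by simp
    then show "(\<lambda>x. (fst (fst x), snd (fst x) + snd x * (fst (fst x) - snd (fst x)), snd (fst x))) ` (X \<times> cbox 0 1)
        \<subseteq> {(t, r, s). (t, s) \<in> X \<and> s \<le> r \<and> r \<le> t}"
      using X by force
  qed
  then have "continuous_on X (\<lambda>p. integral (cbox 0 1) (?G p))" by (rule integral_continuous_on_param)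
  then have "continuous_on X (\<lambda>p. (fst p - snd p) *\<^sub>R integral {0..1} (?G p))"
    by (intro continuous_intros) simp
  moreover have "(case p of (t, s) \<Rightarrow> integral {s..t} (\<lambda>r. F (t, r, s)))
      = (fst p - snd p) *\<^sub>R integral {0..1} (?G p)" if "p \<in> X" for p
  proof -
    obtain t s where p: "p = (t, s)" by (cases p)
    have "continuous_on {s..t} (\<lambda>r. F (t, r, s))"
      by (rule continuous_on_compose2[OF F]) (use that p in \<open>auto intro!: continuous_intros\<close>)
    then show ?thesis using integral_reparametrize[OF X] that p by simp
  qed
  ultimately show ?thesis by (subst continuous_on_cong[OF refl]) auto
qed

text \<open>Fubini's theorem for a triangle, from the one for squares. The indicator function of the triangle is not
  continuous, but if the value on the diagonal is subtracted, the integrand extends continuously by \<open>0\<close> to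
  the square. What has been subtracted depends on one variable only, and for it the claim is an
  integration by parts.\<close>
lemma integral_triangle_swap:
  fixes F :: "real \<Rightarrow> real \<Rightarrow> 'b::banach"
  assumes st: "s \<le> t" and F: "continuous_on {(r, u). s \<le> u \<and> u \<le> r \<and> r \<le> t} (\<lambda>(r, u). F r u)"
  shows "integral {s..t} (\<lambda>r. integral {s..r} (\<lambda>u. F r u)) = integral {s..t} (\<lambda>u. integral {u..t} (\<lambda>r. F r u))"
proof -
  define h where "h r = F r r" for r
  define G where "G r u = F r (min u r) - h r" for r u
  let ?Q = "cbox (s, s) (t, t)"
  have h: "continuous_on {s..t} h"
    unfolding h_def by (rule continuous_on_compose2[OF F, of _ "\<lambda>r. (r, r)", simplified]) (auto intro!: continuous_intros)
  have Q: "?Q = {(r, u). s \<le> r \<and> r \<le> t \<and> s \<le> u \<and> u \<le> t}"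
    by (auto simp: cbox_Pair_eq)
  have "continuous_on ?Q (\<lambda>p. F (fst p) (min (snd p) (fst p)))"
    by (rule continuous_on_compose2[OF F, of _ "\<lambda>p. (fst p, min (snd p) (fst p))", simplified])
      (auto simp: Q intro!: continuous_intros)
  moreover have "continuous_on ?Q (\<lambda>p. h (fst p))"
    by (rule continuous_on_compose2[OF h]) (auto simp: Q intro!: continuous_intros)
  ultimately have G: "continuous_on ?Q (\<lambda>(r, u). G r u)"
    unfolding G_def case_prod_unfold by (intro continuous_intros)
  have Gr: "continuous_on {s..t} (\<lambda>u. G r u)" if "r \<in> {s..t}" for r
    by (rule continuous_on_compose2[OF G, of _ "\<lambda>u. (r, u)", simplified])
      (use that in \<open>auto simp: Q intro!: continuous_intros\<close>)
  have Gu: "continuous_on {s..t} (\<lambda>r. G r u)" if "u \<in> {s..t}" for u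
    by (rule continuous_on_compose2[OF G, of _ "\<lambda>r. (r, u)", simplified])
      (use that in \<open>auto simp: Q intro!: continuous_intros\<close>)
  have G0: "G r u = 0" if "r \<le> u" for r u using that by (simp add: G_def h_def min_def)
  have IG1: "continuous_on {s..t} (\<lambda>r. integral {s..t} (G r))"
    using integral_continuous_on_param[of "{s..t}" s t G] G by (simp add: cbox_Pair_eq)
  have IG2: "continuous_on {s..t} (\<lambda>u. integral {s..t} (\<lambda>r. G r u))"
  proof -
    have "continuous_on ({s..t} \<times> cbox s t) (\<lambda>(u, r). G r u)"
      unfolding case_prod_unfold
      by (rule continuous_on_compose2[OF G, of _ "\<lambda>p. (snd p, fst p)", simplified case_prod_unfold, simplified])
        (auto simp: Q intro!: continuous_intros)
    from integral_continuous_on_param[OF this] show ?thesis by simp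
  qed
  (* the subtracted part, integrated over the sections of the triangle with fixed u *)
  define H where "H u = integral {u..t} h" for u
  have dH: "(H has_vector_derivative - h u) (at u within {s..t})" if "u \<in> {s..t}" for u
    unfolding H_def by (rule integral_has_vector_derivative'[OF h that])
  have cH: "continuous_on {s..t} H"
    by (rule continuous_on_vector_derivative[OF dH])
  have left: "integral {s..r} (\<lambda>u. F r u) = integral {s..t} (G r) + (r - s) *\<^sub>R h r" if r: "r \<in> {s..t}" for r
  proof -
    have "integral {s..t} (G r) = integral {s..r} (G r) + integral {r..t} (G r)"
      using r by (intro Henstock_Kurzweil_Integration.integral_combine[symmetric] integrable_continuous_real Gr) auto
    also have "integral {r..t} (G r) = 0"
      using integral_cong[of "{r..t}" "G r" "\<lambda>_. 0"] G0 by simp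
    also have "integral {s..r} (G r) = integral {s..r} (\<lambda>u. F r u - h r)"
      by (rule integral_cong) (auto simp: G_def min_def)
    also have "\<dots> = integral {s..r} (\<lambda>u. F r u) - (r - s) *\<^sub>R h r"
    proof -
      have "continuous_on {s..r} (\<lambda>u. F r u)"
        by (rule continuous_on_compose2[OF F, of _ "\<lambda>u. (r, u)", simplified])
          (use r in \<open>auto intro!: continuous_intros\<close>)
      then show ?thesis using r by (simp add: Henstock_Kurzweil_Integration.integral_diff integrable_continuous_real)
    qed
    finally show ?thesis by simp
  qed
  have right: "integral {u..t} (\<lambda>r. F r u) = integral {s..t} (\<lambda>r. G r u) + H u" if u: "u \<in> {s..t}" for u
  proof -
    have "integral {s..t} (\<lambda>r. G r u) = integral {s..u} (\<lambda>r. G r u) + integral {u..t} (\<lambda>r. G r u)"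
      using u by (intro Henstock_Kurzweil_Integration.integral_combine[symmetric] integrable_continuous_real Gu) auto
    also have "integral {s..u} (\<lambda>r. G r u) = 0"
      using integral_cong[of "{s..u}" "\<lambda>r. G r u" "\<lambda>_. 0"] G0 by simp
    also have "integral {u..t} (\<lambda>r. G r u) = integral {u..t} (\<lambda>r. F r u - h r)"
      by (rule integral_cong) (auto simp: G_def min_def)
    also have "\<dots> = integral {u..t} (\<lambda>r. F r u) - H u"
    proof -
      have "continuous_on {u..t} (\<lambda>r. F r u)"
        by (rule continuous_on_compose2[OF F, of _ "\<lambda>r. (r, u)", simplified])
          (use u in \<open>auto intro!: continuous_intros\<close>)
      moreover have "continuous_on {u..t} h" by (rule continuous_on_subset[OF h]) (use u in auto)
      ultimately show ?thesis
        by (simp add: H_def Henstock_Kurzweil_Integration.integral_diff integrable_continuous_real)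
    qed
    finally show ?thesis by simp
  qed
  have parts: "integral {s..t} (\<lambda>r. (r - s) *\<^sub>R h r) = integral {s..t} H"
  proof -
    have "((\<lambda>u. H u - (u - s) *\<^sub>R h u) has_integral (t - s) *\<^sub>R H t - (s - s) *\<^sub>R H s) {s..t}"
    proof (rule fundamental_theorem_of_calculus[OF st])
      fix u assume "u \<in> {s..t}"
      then show "((\<lambda>u. (u - s) *\<^sub>R H u) has_vector_derivative H u - (u - s) *\<^sub>R h u) (at u within {s..t})"
        by (auto intro!: derivative_eq_intros dH)
    qed
    moreover have "H t = 0" by (simp add: H_def)
    ultimately have "integral {s..t} (\<lambda>u. H u - (u - s) *\<^sub>R h u) = 0" by (simp add: integral_unique)
    then show ?thesis
      by (subst (asm) Henstock_Kurzweil_Integration.integral_diff)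
        (auto intro!: integrable_continuous_real continuous_intros cH h)
  qed
  have "integral {s..t} (\<lambda>r. integral {s..r} (\<lambda>u. F r u)) = integral {s..t} (\<lambda>r. integral {s..t} (G r) + (r - s) *\<^sub>R h r)"
    by (rule integral_cong) (rule left)
  also have "\<dots> = integral {s..t} (\<lambda>r. integral {s..t} (G r)) + integral {s..t} (\<lambda>r. (r - s) *\<^sub>R h r)"
    by (intro Henstock_Kurzweil_Integration.integral_add integrable_continuous_real continuous_intros IG1 h)
  also have "\<dots> = integral {s..t} (\<lambda>u. integral {s..t} (\<lambda>r. G r u)) + integral {s..t} H"
    using integral_swap_continuous[of s s t t G] G parts by simp
  also have "\<dots> = integral {s..t} (\<lambda>u. integral {s..t} (\<lambda>r. G r u) + H u)"
    by (intro Henstock_Kurzweil_Integration.integral_add[symmetric] integrable_continuous_real IG2 cH)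
  also have "\<dots> = integral {s..t} (\<lambda>u. integral {u..t} (\<lambda>r. F r u))"
    by (rule integral_cong) (simp only: right)
  finally show ?thesis .
qed

section \<open>Families of operators\<close>

definition tri2 :: "real \<Rightarrow> (real \<times> real) set" where
  "tri2 T = {(t, s). 0 \<le> s \<and> s \<le> t \<and> t \<le> T}"

definition tri3 :: "real \<Rightarrow> (real \<times> real \<times> real) set" where
  "tri3 T = {(t, r, s). 0 \<le> s \<and> s \<le> r \<and> r \<le> t \<and> t \<le> T}"

context bscale
begin

text \<open>Families are indexed by points of a set \<open>X\<close>, which is a set of times, of pairs or of triples of times.
  In \<open>equi\<close> the bound depends on the pair of spaces, but is uniform in the index. The
  combination \<open>opfam\<close> of both properties is stable under composition and integration.\<close>
definition scont :: "'p::topological_space set \<Rightarrow> ('p \<Rightarrow> 'a \<Rightarrow> 'a) \<Rightarrow> bool" where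
  "scont X f \<longleftrightarrow> (\<forall>\<alpha>' \<alpha>. low S < \<alpha>' \<longrightarrow> \<alpha>' < \<alpha> \<longrightarrow> (\<forall>k\<in>E \<alpha>. continuous_on X (\<lambda>p. em \<alpha>' (f p k))))"

definition equi :: "'p set \<Rightarrow> ('p \<Rightarrow> 'a \<Rightarrow> 'a) \<Rightarrow> bool" where
  "equi X f \<longleftrightarrow> (\<forall>\<alpha>' \<alpha>. low S < \<alpha>' \<longrightarrow> \<alpha>' < \<alpha> \<longrightarrow> (\<exists>C. \<forall>p\<in>X. \<forall>x\<in>E \<alpha>. nm \<alpha>' (f p x) \<le> C * nm \<alpha> x))"

definition opfam :: "'p::topological_space set \<Rightarrow> ('p \<Rightarrow> 'a \<Rightarrow> 'a) \<Rightarrow> bool" where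
  "opfam X f \<longleftrightarrow> (\<forall>p\<in>X. f p \<in> ops) \<and> scont X f \<and> equi X f"

text \<open>Uniform convergence on \<open>X\<close> in operator norm, between any two spaces of the scale.\<close>
definition uconv :: "'p set \<Rightarrow> (nat \<Rightarrow> 'p \<Rightarrow> 'a \<Rightarrow> 'a) \<Rightarrow> ('p \<Rightarrow> 'a \<Rightarrow> 'a) \<Rightarrow> bool" where
  "uconv X fn f \<longleftrightarrow> (\<forall>\<alpha>' \<alpha>. low S < \<alpha>' \<longrightarrow> \<alpha>' < \<alpha> \<longrightarrow> (\<forall>e>0. \<exists>N. \<forall>n\<ge>N. \<forall>p\<in>X. \<forall>x\<in>E \<alpha>.
     nm \<alpha>' (fn n p x - f p x) \<le> e * nm \<alpha> x))"

lemma scontD: "scont X f \<Longrightarrow> low S < \<alpha>' \<Longrightarrow> \<alpha>' < \<alpha> \<Longrightarrow> k \<in> E \<alpha> \<Longrightarrow> continuous_on X (\<lambda>p. em \<alpha>' (f p k))"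
  by (simp add: scont_def)

lemma equi_bound:
  assumes "equi X f" "low S < \<alpha>'" "\<alpha>' < \<alpha>"
  shows "\<exists>C\<ge>0. \<forall>p\<in>X. \<forall>x\<in>E \<alpha>. nm \<alpha>' (f p x) \<le> C * nm \<alpha> x"
proof -
  obtain C where C: "\<And>p x. p \<in> X \<Longrightarrow> x \<in> E \<alpha> \<Longrightarrow> nm \<alpha>' (f p x) \<le> C * nm \<alpha> x"
    using assms unfolding equi_def by meson
  have "nm \<alpha>' (f p x) \<le> max 0 C * nm \<alpha> x" if "p \<in> X" "x \<in> E \<alpha>" for p x
    using assms that by (intro order_trans[OF C[OF that]] mult_right_mono nm_nonneg) auto
  then show ?thesis by (intro exI[of _ "max 0 C"]) simp
qed

lemma opfamD: "opfam X f \<Longrightarrow> p \<in> X \<Longrightarrow> f p \<in> ops" "opfam X f \<Longrightarrow> scont X f" "opfam X f \<Longrightarrow> equi X f"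
  by (auto simp: opfam_def)

lemma ops_compose:
  assumes "a \<in> ops" "b \<in> ops"
  shows "(\<lambda>x. a (b x)) \<in> ops"
  unfolding ops_def
proof (intro CollectI allI impI)
  fix \<alpha>' \<alpha> assume \<alpha>: "low S < \<alpha>'" "\<alpha>' < \<alpha>"
  then obtain \<beta> where \<beta>: "\<alpha>' < \<beta>" "\<beta> < \<alpha>" "low S < \<beta>" using dense[of \<alpha>' \<alpha>] by auto
  note a = opsD[OF assms(1) \<alpha>(1) \<beta>(1)] and b = opsD[OF assms(2) \<beta>(3,2)]
  obtain C where C: "0 \<le> C" "\<And>x. x \<in> E \<beta> \<Longrightarrow> nm \<alpha>' (a x) \<le> C * nm \<beta> x" using op_bound[OF a \<beta>(3)] by blast
  obtain D where D: "\<And>x. x \<in> E \<alpha> \<Longrightarrow> nm \<beta> (b x) \<le> D * nm \<alpha> x"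
    using op_bound[OF b] \<alpha> by (metis less_trans)
  have "nm \<alpha>' (a (b x)) \<le> (C * D) * nm \<alpha> x" if "x \<in> E \<alpha>" for x
    using C(2)[OF op_E[OF b that]] mult_left_mono[OF D[OF that] C(1)] by simp
  then show "(\<lambda>x. a (b x)) \<in> bounded_op S \<alpha> \<alpha>'"
    using a b unfolding bounded_op_def by (auto simp: image_subset_iff)
qed

lemma opfam_apply:
  assumes f: "opfam X f" and \<alpha>: "low S < \<alpha>'" "\<alpha>' < \<beta>"
    and y: "\<And>p. p \<in> X \<Longrightarrow> y p \<in> E \<beta>" "continuous_on X (\<lambda>p. em \<beta> (y p))"
  shows "continuous_on X (\<lambda>p. em \<alpha>' (f p (y p)))"
  unfolding continuous_on_def
proof
  fix p assume p: "p \<in> X"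
  obtain C where C: "0 \<le> C" "\<And>p x. p \<in> X \<Longrightarrow> x \<in> E \<beta> \<Longrightarrow> nm \<alpha>' (f p x) \<le> C * nm \<beta> x"
    using equi_bound[OF opfamD(3)[OF f] \<alpha>] by blast
  have ev: "\<forall>\<^sub>F q in at p within X. q \<in> X" by (simp add: eventually_at_filter)
  show "((\<lambda>q. em \<alpha>' (f q (y q))) \<longlongrightarrow> em \<alpha>' (f p (y p))) (at p within X)"
  proof (rule tendsto_op_apply[where C=C and T=f and f=y and x="y p" and \<alpha>=\<beta>])
    show "low S < \<beta>" using \<alpha> by simp
    show "\<forall>\<^sub>F q in at p within X. f q \<in> bounded_op S \<beta> \<alpha>'"
      using ev by eventually_elim (rule opsD[OF opfamD(1)[OF f] \<alpha>])
    show "\<forall>\<^sub>F q in at p within X. \<forall>x\<in>E \<beta>. nm \<alpha>' (f q x) \<le> C * nm \<beta> x"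
      using ev by eventually_elim (use C(2) in blast)
    show "\<forall>\<^sub>F q in at p within X. y q \<in> E \<beta>"
      using ev by eventually_elim (rule y(1))
    show "((\<lambda>q. em \<beta> (y q)) \<longlongrightarrow> em \<beta> (y p)) (at p within X)"
      using y(2) p by (auto simp: continuous_on_def)
    show "((\<lambda>q. em \<alpha>' (f q (y p))) \<longlongrightarrow> em \<alpha>' (f p (y p))) (at p within X)"
      using scontD[OF opfamD(2)[OF f] \<alpha> y(1)[OF p]] p by (auto simp: continuous_on_def)
  qed (use \<alpha> y p in auto)
qed

lemma equi_compose:
  assumes "\<And>p. p \<in> X \<Longrightarrow> g p \<in> ops" "equi X f" "equi X g"
  shows "equi X (\<lambda>p x. f p (g p x))"
  unfolding equi_def
proof (intro allI impI)
  fix \<alpha>' \<alpha> assume \<alpha>: "low S < \<alpha>'" "\<alpha>' < \<alpha>"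
  then obtain \<beta> where \<beta>: "\<alpha>' < \<beta>" "\<beta> < \<alpha>" "low S < \<beta>" using dense[of \<alpha>' \<alpha>] by auto
  obtain C where C: "0 \<le> C" "\<And>p x. p \<in> X \<Longrightarrow> x \<in> E \<beta> \<Longrightarrow> nm \<alpha>' (f p x) \<le> C * nm \<beta> x"
    using equi_bound[OF assms(2) \<alpha>(1) \<beta>(1)] by blast
  obtain D where D: "0 \<le> D" "\<And>p x. p \<in> X \<Longrightarrow> x \<in> E \<alpha> \<Longrightarrow> nm \<beta> (g p x) \<le> D * nm \<alpha> x"
    using equi_bound[OF assms(3) \<beta>(3,2)] by blast
  have "nm \<alpha>' (f p (g p x)) \<le> (C * D) * nm \<alpha> x" if "p \<in> X" "x \<in> E \<alpha>" for p x
    using C(2)[OF that(1) ops_E[OF assms(1)[OF that(1)] \<beta>(3,2) that(2)]]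
      mult_left_mono[OF D(2)[OF that] C(1)] by simp
  then show "\<exists>C. \<forall>p\<in>X. \<forall>x\<in>E \<alpha>. nm \<alpha>' (f p (g p x)) \<le> C * nm \<alpha> x"
    by (intro exI[of _ "C * D"] ballI)
qed

lemma opfam_compose:
  assumes f: "opfam X f" and g: "opfam X g"
  shows "opfam X (\<lambda>p x. f p (g p x))"
  unfolding opfam_def
proof (intro conjI ballI)
  show "(\<lambda>x. f p (g p x)) \<in> ops" if "p \<in> X" for p
    by (rule ops_compose[OF opfamD(1)[OF f that] opfamD(1)[OF g that]])
  show "equi X (\<lambda>p x. f p (g p x))"
    by (rule equi_compose[OF opfamD(1)[OF g] opfamD(3)[OF f] opfamD(3)[OF g]])
  show "scont X (\<lambda>p x. f p (g p x))"
    unfolding scont_def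
  proof (intro allI impI ballI)
    fix \<alpha>' \<alpha> k assume \<alpha>: "low S < \<alpha>'" "\<alpha>' < \<alpha>" and k: "k \<in> E \<alpha>"
    then obtain \<beta> where \<beta>: "\<alpha>' < \<beta>" "\<beta> < \<alpha>" "low S < \<beta>" using dense[of \<alpha>' \<alpha>] by auto
    show "continuous_on X (\<lambda>p. em \<alpha>' (f p (g p k)))"
      by (rule opfam_apply[OF f \<alpha>(1) \<beta>(1) ops_E[OF opfamD(1)[OF g] \<beta>(3,2) k] scontD[OF opfamD(2)[OF g] \<beta>(3,2) k]])
  qed
qed

lemma opfam_reindex:
  assumes "opfam Y f" "continuous_on X \<phi>" "\<phi> ` X \<subseteq> Y"
  shows "opfam X (\<lambda>p. f (\<phi> p))"
proof -
  have "continuous_on X (\<lambda>p. em \<alpha>' (f (\<phi> p) k))" if "low S < \<alpha>'" "\<alpha>' < \<alpha>" "k \<in> E \<alpha>" for \<alpha>' \<alpha> k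
    using continuous_on_compose2[OF scontD[OF opfamD(2)[OF assms(1)] that] assms(2,3)] .
  moreover have "\<exists>C. \<forall>p\<in>X. \<forall>x\<in>E \<alpha>. nm \<alpha>' (f (\<phi> p) x) \<le> C * nm \<alpha> x" if "low S < \<alpha>'" "\<alpha>' < \<alpha>" for \<alpha>' \<alpha>
    using opfamD(3)[OF assms(1)] that assms(3) unfolding equi_def by (meson image_subset_iff)
  ultimately show ?thesis
    using opfamD(1)[OF assms(1)] assms(3) unfolding opfam_def scont_def equi_def by (simp add: image_subset_iff)
qed

lemma uconv_reindex: "uconv Y fn f \<Longrightarrow> \<phi> ` X \<subseteq> Y \<Longrightarrow> uconv X (\<lambda>n p. fn n (\<phi> p)) (\<lambda>p. f (\<phi> p))"
  unfolding uconv_def image_subset_iff by meson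

lemma uconvD:
  assumes "uconv X fn f" "low S < \<alpha>'" "\<alpha>' < \<alpha>" "e > 0"
  shows "\<exists>N. \<forall>n\<ge>N. \<forall>p\<in>X. \<forall>x\<in>E \<alpha>. nm \<alpha>' (fn n p x - f p x) \<le> e * nm \<alpha> x"
  using assms by (simp add: uconv_def)

lemma uconv_tendsto:
  assumes u: "uconv X fn f" and ops: "\<And>n p. p \<in> X \<Longrightarrow> fn n p \<in> ops" "\<And>p. p \<in> X \<Longrightarrow> f p \<in> ops"
    and \<alpha>: "low S < \<alpha>'" "\<alpha>' < \<alpha>" "k \<in> E \<alpha>"
  shows "uniform_limit X (\<lambda>n p. em \<alpha>' (fn n p k)) (\<lambda>p. em \<alpha>' (f p k)) sequentially"
  unfolding uniform_limit_sequentially_iff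
proof (intro allI impI)
  fix e :: real assume e: "e > 0"
  define d where "d = e / (nm \<alpha> k + 1)"
  have nk: "0 \<le> nm \<alpha> k" using \<alpha> by (intro nm_nonneg) auto
  then have d: "d > 0" "d * nm \<alpha> k < e" using e by (auto simp: d_def field_simps)
  obtain N where N: "\<And>n p x. n \<ge> N \<Longrightarrow> p \<in> X \<Longrightarrow> x \<in> E \<alpha> \<Longrightarrow> nm \<alpha>' (fn n p x - f p x) \<le> d * nm \<alpha> x"
    using uconvD[OF u \<alpha>(1,2) d(1)] by blast
  have "dist (em \<alpha>' (fn n p k)) (em \<alpha>' (f p k)) < e" if "n \<ge> N" "p \<in> X" for n p
    using N[OF that \<alpha>(3)] d(2) ops[OF that(2)] \<alpha> by (simp add: dist_em ops_E[OF _ \<alpha>])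
  then show "\<exists>N. \<forall>n\<ge>N. \<forall>x\<in>X. dist (em \<alpha>' (fn n x k)) (em \<alpha>' (f x k)) < e" by blast
qed

text \<open>With \<open>f\<^sub>n g\<^sub>n - f g = f\<^sub>n (g\<^sub>n - g) + (f\<^sub>n - f) g\<close>, the loss of regularity is shared between the two
  factors at an intermediate index.\<close>
lemma uconv_compose:
  assumes fn: "uconv X fn f" and gn: "uconv X gn g"
    and C: "equi (UNIV \<times> X) (\<lambda>(n, p). fn n p)" and D: "equi X g"
    and ops: "\<And>n p. p \<in> X \<Longrightarrow> fn n p \<in> ops" "\<And>p. p \<in> X \<Longrightarrow> f p \<in> ops"
      "\<And>n p. p \<in> X \<Longrightarrow> gn n p \<in> ops" "\<And>p. p \<in> X \<Longrightarrow> g p \<in> ops"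
  shows "uconv X (\<lambda>n p x. fn n p (gn n p x)) (\<lambda>p x. f p (g p x))"
  unfolding uconv_def
proof (intro allI impI)
  fix \<alpha>' \<alpha> e :: real assume \<alpha>: "low S < \<alpha>'" "\<alpha>' < \<alpha>" and e: "e > 0"
  then obtain \<beta> where \<beta>: "\<alpha>' < \<beta>" "\<beta> < \<alpha>" "low S < \<beta>" using dense[of \<alpha>' \<alpha>] by auto
  obtain C where C: "0 \<le> C" "\<And>n p x. p \<in> X \<Longrightarrow> x \<in> E \<beta> \<Longrightarrow> nm \<alpha>' (fn n p x) \<le> C * nm \<beta> x"
    using equi_bound[OF C \<alpha>(1) \<beta>(1)] by fastforce
  obtain D where D: "0 \<le> D" "\<And>p x. p \<in> X \<Longrightarrow> x \<in> E \<alpha> \<Longrightarrow> nm \<beta> (g p x) \<le> D * nm \<alpha> x"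
    using equi_bound[OF D \<beta>(3,2)] by blast
  obtain N1 where N1: "\<And>n p x. n \<ge> N1 \<Longrightarrow> p \<in> X \<Longrightarrow> x \<in> E \<beta> \<Longrightarrow>
      nm \<alpha>' (fn n p x - f p x) \<le> (e / (2 * (D + 1))) * nm \<beta> x"
    using uconvD[OF fn \<alpha>(1) \<beta>(1), of "e / (2 * (D + 1))"] D(1) e by (simp add: add_nonneg_pos) blast
  obtain N2 where N2: "\<And>n p x. n \<ge> N2 \<Longrightarrow> p \<in> X \<Longrightarrow> x \<in> E \<alpha> \<Longrightarrow>
      nm \<beta> (gn n p x - g p x) \<le> (e / (2 * (C + 1))) * nm \<alpha> x"
    using uconvD[OF gn \<beta>(3,2), of "e / (2 * (C + 1))"] C(1) e by (simp add: add_nonneg_pos) blast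
  have "nm \<alpha>' (fn n p (gn n p x) - f p (g p x)) \<le> e * nm \<alpha> x"
    if n: "n \<ge> max N1 N2" and p: "p \<in> X" and x: "x \<in> E \<alpha>" for n p x
  proof -
    have nx: "0 \<le> nm \<alpha> x" using \<alpha> x by (intro nm_nonneg) auto
    have gE: "gn n p x \<in> E \<beta>" "g p x \<in> E \<beta>" using ops p x \<beta> by (auto intro: ops_E)
    have fE: "fn n p (gn n p x) \<in> E \<alpha>'" "fn n p (g p x) \<in> E \<alpha>'" "f p (g p x) \<in> E \<alpha>'"
      using ops p gE \<alpha> \<beta> by (auto intro: ops_E)
    have "fn n p (gn n p x) - f p (g p x) = fn n p (gn n p x - g p x) + (fn n p (g p x) - f p (g p x))"
      using op_diff[OF opsD[OF ops(1)[OF p] \<alpha>(1) \<beta>(1)] \<beta>(3) gE] by simp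
    also have "nm \<alpha>' \<dots> \<le> nm \<alpha>' (fn n p (gn n p x - g p x)) + nm \<alpha>' (fn n p (g p x) - f p (g p x))"
      using ops p gE \<alpha> \<beta> fE by (intro nm_add) (auto intro!: E_diff intro: ops_E)
    also have "nm \<alpha>' (fn n p (gn n p x - g p x)) \<le> C * ((e / (2 * (C + 1))) * nm \<alpha> x)"
      using C(2)[OF p, of "gn n p x - g p x" n] mult_left_mono[OF N2[OF _ p x, of n] C(1)] n gE \<beta>
      by (simp add: E_diff)
    also have "nm \<alpha>' (fn n p (g p x) - f p (g p x)) \<le> (e / (2 * (D + 1))) * (D * nm \<alpha> x)"
      using N1[OF _ p gE(2), of n] mult_left_mono[OF D(2)[OF p x], of "e / (2 * (D + 1))"] n D(1) e by simp
    also have "C * ((e / (2 * (C + 1))) * nm \<alpha> x) \<le> e / 2 * nm \<alpha> x"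
    proof -
      have "C * (e / (2 * (C + 1))) \<le> e / 2" using C(1) e by (simp add: field_simps)
      from mult_right_mono[OF this nx] show ?thesis by (simp add: mult.assoc)
    qed
    also have "(e / (2 * (D + 1))) * (D * nm \<alpha> x) \<le> e / 2 * nm \<alpha> x"
    proof -
      have "(e / (2 * (D + 1))) * D \<le> e / 2" using D(1) e by (simp add: field_simps)
      from mult_right_mono[OF this nx] show ?thesis by (simp add: mult.assoc)
    qed
    finally show ?thesis by simp
  qed
  then show "\<exists>N. \<forall>n\<ge>N. \<forall>p\<in>X. \<forall>x\<in>E \<alpha>. nm \<alpha>' (fn n p (gn n p x) - f p (g p x)) \<le> e * nm \<alpha> x" by blast
qed

lemma bounded_op_scl: "low S < \<alpha> \<Longrightarrow> scl S c \<in> bounded_op S \<alpha> \<alpha>"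
proof -
  assume \<alpha>: "low S < \<alpha>"
  have "scl S c (scl S d x) = scl S d (scl S c x)" for d x
    using module.scale_scale[OF module_scl] by (metis mult.commute)
  then show ?thesis
    using \<alpha> module.scale_right_distrib[OF module_scl]
    by (auto simp: bounded_op_def E_scl nm_scl intro!: exI[of _ "norm c"])
qed

lemma tri3_line: "(t, s) \<in> tri2 T \<Longrightarrow> (\<lambda>r. (t, r, s)) ` {s..t} \<subseteq> tri3 T"
  by (auto simp: tri2_def tri3_def)

lemma tri3I: "(t, s) \<in> tri2 T \<Longrightarrow> r \<in> {s..t} \<Longrightarrow> (t, r, s) \<in> tri3 T"
  by (auto simp: tri2_def tri3_def)

lemma opfam_integrand:
  assumes F: "opfam (tri3 T) F" and p: "(t, s) \<in> tri2 T" and \<alpha>: "low S < \<alpha>'" "\<alpha>' < \<alpha>" "k \<in> E \<alpha>"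
  shows "continuous_on {s..t} (\<lambda>r. em \<alpha>' (F (t, r, s) k))" "\<And>r. r \<in> {s..t} \<Longrightarrow> F (t, r, s) k \<in> E \<alpha>'"
proof -
  show "continuous_on {s..t} (\<lambda>r. em \<alpha>' (F (t, r, s) k))"
    by (rule continuous_on_compose2[OF scontD[OF opfamD(2)[OF F] \<alpha>] _ tri3_line[OF p]])
      (intro continuous_intros)
  show "F (t, r, s) k \<in> E \<alpha>'" if "r \<in> {s..t}" for r
    using opfamD(1)[OF F tri3I[OF p that]] \<alpha> by (rule ops_E)
qed

lemma opfam_has_integral:
  assumes "opfam (tri3 T) F" "(t, s) \<in> tri2 T" "low S < \<alpha>'" "\<alpha>' < \<alpha>" "k \<in> E \<alpha>"
  shows "((\<lambda>r. em \<alpha>' (F (t, r, s) k)) has_integral em \<alpha>' (integ s t (\<lambda>r. F (t, r, s) k))) {s..t}"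
  by (rule integ_continuous(2)[OF assms(3) opfam_integrand(2,1)[OF assms]])

text \<open>Integration over the middle time leads from operators \<open>F (t, r, s)\<close> to operators indexed by \<open>(t, s)\<close>.
  Linearity is inherited since the integral is unique, and the bound picks up the length of the interval.\<close>
lemma opfam_integral:
  assumes F: "opfam (tri3 T) F"
  shows "opfam (tri2 T) (\<lambda>(t, s) k. integ s t (\<lambda>r. F (t, r, s) k))"
proof -
  define I where "I t s k = integ s t (\<lambda>r. F (t, r, s) k)" for t s k
  have I: "I t s k \<in> E \<alpha>'" "((\<lambda>r. em \<alpha>' (F (t, r, s) k)) has_integral em \<alpha>' (I t s k)) {s..t}"
    if "(t, s) \<in> tri2 T" "low S < \<alpha>'" "\<alpha>' < \<alpha>" "k \<in> E \<alpha>" for t s \<alpha>' \<alpha> k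
    unfolding I_def using integ_continuous[OF that(2) opfam_integrand(2,1)[OF F that]] by auto
  have bound: "\<exists>C. \<forall>t s. (t, s) \<in> tri2 T \<longrightarrow> (\<forall>x\<in>E \<alpha>. nm \<alpha>' (I t s x) \<le> C * nm \<alpha> x)"
    if \<alpha>: "low S < \<alpha>'" "\<alpha>' < \<alpha>" for \<alpha>' \<alpha>
  proof -
    obtain C where C: "0 \<le> C" "\<And>p x. p \<in> tri3 T \<Longrightarrow> x \<in> E \<alpha> \<Longrightarrow> nm \<alpha>' (F p x) \<le> C * nm \<alpha> x"
      using equi_bound[OF opfamD(3)[OF F] \<alpha>] by blast
    have "nm \<alpha>' (I t s x) \<le> (C * T) * nm \<alpha> x" if p: "(t, s) \<in> tri2 T" and x: "x \<in> E \<alpha>" for t s x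
    proof -
      have nx: "0 \<le> C * nm \<alpha> x" using \<alpha> x C by (auto intro!: mult_nonneg_nonneg nm_nonneg)
      have "norm (em \<alpha>' (I t s x)) \<le> (C * nm \<alpha> x) * measure lborel (cbox s t)"
      proof (rule has_integral_bound[OF nx])
        show "((\<lambda>r. em \<alpha>' (F (t, r, s) x)) has_integral em \<alpha>' (I t s x)) (cbox s t)"
          using I(2)[OF p \<alpha> x] by simp
        fix r assume "r \<in> cbox s t"
        then have r: "r \<in> {s..t}" by simp
        then show "norm (em \<alpha>' (F (t, r, s) x)) \<le> C * nm \<alpha> x"
          using C(2)[OF tri3I[OF p r] x] opfam_integrand(2)[OF F p \<alpha> x r] \<alpha>
          by (simp add: norm_em)
      qed
      also have "\<dots> \<le> (C * nm \<alpha> x) * T"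
        using p by (intro mult_left_mono[OF _ nx]) (auto simp: tri2_def)
      finally show ?thesis using I(1)[OF p \<alpha> x] \<alpha> by (simp add: norm_em mult_ac)
    qed
    then show ?thesis by blast
  qed
  have "I t s \<in> bounded_op S \<alpha> \<alpha>'" if p: "(t, s) \<in> tri2 T" and \<alpha>: "low S < \<alpha>'" "\<alpha>' < \<alpha>" for t s \<alpha>' \<alpha>
  proof -
    note * = I[OF p \<alpha>] opfam_integrand(2)[OF F p \<alpha>]
    have Fop: "F (t, r, s) \<in> bounded_op S \<alpha> \<alpha>'" if "r \<in> {s..t}" for r
      using opfamD(1)[OF F tri3I[OF p that]] \<alpha> by (rule opsD)
    have low: "low S < \<alpha>" using \<alpha> by simp
    have "I t s (x + y) = I t s x + I t s y" if "x \<in> E \<alpha>" "y \<in> E \<alpha>" for x y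
    proof -
      have "((\<lambda>r. em \<alpha>' (F (t, r, s) (x + y))) has_integral em \<alpha>' (I t s x + I t s y)) {s..t}"
        using has_integral_add[OF *(2)[OF that(1)] *(2)[OF that(2)]] that \<alpha>(1)
        by (subst has_integral_cong[where g="\<lambda>r. em \<alpha>' (F (t, r, s) x) + em \<alpha>' (F (t, r, s) y)"])
          (auto simp: em_add op_add[OF Fop])
      then have "em \<alpha>' (I t s (x + y)) = em \<alpha>' (I t s x + I t s y)"
        using *(2)[OF E_add[OF low that]] by (metis has_integral_unique)
      then show ?thesis using em_eq_iff[OF \<alpha>(1)] *(1) that low \<alpha>(1) by (simp add: E_add)
    qed
    moreover have "I t s (scl S c x) = scl S c (I t s x)" if x: "x \<in> E \<alpha>" for c x
    proof -
      have "((\<lambda>r. em \<alpha>' (scl S c (F (t, r, s) x))) has_integral em \<alpha>' (scl S c (I t s x))) {s..t}"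
        by (rule has_integral_op[OF \<alpha>(1,1) bounded_op_scl[OF \<alpha>(1)]]) (use * x in auto)
      then have "((\<lambda>r. em \<alpha>' (F (t, r, s) (scl S c x))) has_integral em \<alpha>' (scl S c (I t s x))) {s..t}"
        by (subst has_integral_cong[where g="\<lambda>r. em \<alpha>' (scl S c (F (t, r, s) x))"])
          (auto simp: op_scl[OF Fop x])
      then have "em \<alpha>' (I t s (scl S c x)) = em \<alpha>' (scl S c (I t s x))"
        using *(2)[OF E_scl[OF low x]] by (metis has_integral_unique)
      then show ?thesis using em_eq_iff[OF \<alpha>(1)] *(1) x low \<alpha>(1) by (simp add: E_scl)
    qed
    moreover have "\<exists>C. \<forall>x\<in>E \<alpha>. nm \<alpha>' (I t s x) \<le> C * nm \<alpha> x" using bound[OF \<alpha>] p by blast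
    ultimately show ?thesis using *(1) by (simp add: bounded_op_def image_subset_iff)
  qed
  moreover have "scont (tri2 T) (\<lambda>(t, s). I t s)"
    unfolding scont_def
  proof (intro allI impI ballI)
    fix \<alpha>' \<alpha> k assume \<alpha>: "low S < \<alpha>'" "\<alpha>' < \<alpha>" and k: "k \<in> E \<alpha>"
    have "continuous_on (tri2 T) (\<lambda>(t, s). integral {s..t} (\<lambda>r. em \<alpha>' (F (t, r, s) k)))"
    proof (rule continuous_on_integral_bounds)
      have "{(t, r, s). (t, s) \<in> tri2 T \<and> s \<le> r \<and> r \<le> t} = tri3 T" by (auto simp: tri2_def tri3_def)
      then show "continuous_on {(t, r, s). (t, s) \<in> tri2 T \<and> s \<le> r \<and> r \<le> t} (\<lambda>p. em \<alpha>' (F p k))"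
        using scontD[OF opfamD(2)[OF F] \<alpha> k] by simp
    qed (auto simp: tri2_def)
    moreover have "em \<alpha>' (I t s k) = integral {s..t} (\<lambda>r. em \<alpha>' (F (t, r, s) k))" if "(t, s) \<in> tri2 T" for t s
      using I(2)[OF that \<alpha> k] by (simp add: integral_unique)
    ultimately show "continuous_on (tri2 T) (\<lambda>p. em \<alpha>' ((case p of (t, s) \<Rightarrow> I t s) k))"
      by (subst continuous_on_cong[OF refl]) auto
  qed
  moreover have "equi (tri2 T) (\<lambda>(t, s). I t s)"
    using bound unfolding equi_def by (simp add: Ball_def)
  ultimately have "opfam (tri2 T) (\<lambda>(t, s). I t s)"
    by (auto simp: opfam_def ops_def)
  then show ?thesis unfolding I_def .
qed

lemma uconv_integral:
  assumes Fn: "\<And>n. opfam (tri3 T) (Fn n)" and F: "opfam (tri3 T) F" and u: "uconv (tri3 T) Fn F"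
  shows "uconv (tri2 T) (\<lambda>n (t, s) k. integ s t (\<lambda>r. Fn n (t, r, s) k)) (\<lambda>(t, s) k. integ s t (\<lambda>r. F (t, r, s) k))"
  unfolding uconv_def
proof (intro allI impI)
  fix \<alpha>' \<alpha> e :: real assume \<alpha>: "low S < \<alpha>'" "\<alpha>' < \<alpha>" and e: "e > 0"
  define d where "d = e / (\<bar>T\<bar> + 1)"
  have d: "d > 0" "d * \<bar>T\<bar> \<le> e" using e by (auto simp: d_def field_simps)
  obtain N where N: "\<And>n p x. n \<ge> N \<Longrightarrow> p \<in> tri3 T \<Longrightarrow> x \<in> E \<alpha> \<Longrightarrow> nm \<alpha>' (Fn n p x - F p x) \<le> d * nm \<alpha> x"
    using uconvD[OF u \<alpha> d(1)] by blast
  have "nm \<alpha>' (integ s t (\<lambda>r. Fn n (t, r, s) x) - integ s t (\<lambda>r. F (t, r, s) x)) \<le> e * nm \<alpha> x"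
    if n: "n \<ge> N" and p: "(t, s) \<in> tri2 T" and x: "x \<in> E \<alpha>" for n t s x
  proof -
    note 1 = integ_continuous[OF \<alpha>(1) opfam_integrand(2,1)[OF Fn[of n] p \<alpha> x]]
    note 2 = integ_continuous[OF \<alpha>(1) opfam_integrand(2,1)[OF F p \<alpha> x]]
    have nx: "0 \<le> nm \<alpha> x" using \<alpha> x by (auto intro!: nm_nonneg)
    have "norm (em \<alpha>' (integ s t (\<lambda>r. Fn n (t, r, s) x)) - em \<alpha>' (integ s t (\<lambda>r. F (t, r, s) x)))
        \<le> (d * nm \<alpha> x) * measure lborel (cbox s t)"
    proof (rule has_integral_bound)
      show "0 \<le> d * nm \<alpha> x" using nx d by simp
      show "((\<lambda>r. em \<alpha>' (Fn n (t, r, s) x) - em \<alpha>' (F (t, r, s) x)) has_integral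
          em \<alpha>' (integ s t (\<lambda>r. Fn n (t, r, s) x)) - em \<alpha>' (integ s t (\<lambda>r. F (t, r, s) x))) (cbox s t)"
        using has_integral_diff[OF 1(2) 2(2)] by simp
      fix r assume "r \<in> cbox s t"
      then have r: "r \<in> {s..t}" by simp
      show "norm (em \<alpha>' (Fn n (t, r, s) x) - em \<alpha>' (F (t, r, s) x)) \<le> d * nm \<alpha> x"
        using N[OF n tri3I[OF p r] x] opfam_integrand(2)[OF Fn p \<alpha> x r] opfam_integrand(2)[OF F p \<alpha> x r] \<alpha>
        by (simp add: norm_em_diff)
    qed
    also have "\<dots> \<le> (d * nm \<alpha> x) * \<bar>T\<bar>"
      using p nx d by (intro mult_left_mono) (auto simp: tri2_def)
    also have "\<dots> \<le> e * nm \<alpha> x" using mult_right_mono[OF d(2) nx] by (simp add: mult_ac)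
    finally show ?thesis using 1(1) 2(1) \<alpha> by (simp add: norm_em_diff)
  qed
  then show "\<exists>N. \<forall>n\<ge>N. \<forall>p\<in>tri2 T. \<forall>x\<in>E \<alpha>. nm \<alpha>' ((case p of (t, s) \<Rightarrow> \<lambda>k. integ s t (\<lambda>r. Fn n (t, r, s) k)) x
      - (case p of (t, s) \<Rightarrow> \<lambda>k. integ s t (\<lambda>r. F (t, r, s) k)) x) \<le> e * nm \<alpha> x"
    by (intro exI[of _ N] allI impI ballI) (simp add: case_prod_beta)
qed

end

lemma has_vector_derivative_iff_quotient:
  "(f has_vector_derivative D) (at x within X) \<longleftrightarrow>
    ((\<lambda>y. (1 / (y - x)) *\<^sub>R (f y - f x)) \<longlongrightarrow> D) (at x within X)"
proof -
  have "norm ((f y - f x) - (y - x) *\<^sub>R D) / norm (y - x) = norm ((1 / (y - x)) *\<^sub>R (f y - f x) - D)"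
    if "y \<noteq> x" for y
  proof -
    have "(1 / (y - x)) *\<^sub>R (f y - f x) - D = (1 / (y - x)) *\<^sub>R ((f y - f x) - (y - x) *\<^sub>R D)"
      using that by (simp add: scaleR_diff_right)
    then have "norm ((1 / (y - x)) *\<^sub>R (f y - f x) - D) = \<bar>1 / (y - x)\<bar> * norm ((f y - f x) - (y - x) *\<^sub>R D)"
      by (metis norm_scaleR)
    then show ?thesis by (simp only: abs_divide abs_one real_norm_def times_divide_eq_left mult_1_left)
  qed
  note eq = this
  have "((\<lambda>y. norm ((f y - f x) - (y - x) *\<^sub>R D) / norm (y - x)) \<longlongrightarrow> 0) (at x within X) \<longleftrightarrow>
      ((\<lambda>y. norm ((1 / (y - x)) *\<^sub>R (f y - f x) - D)) \<longlongrightarrow> 0) (at x within X)"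
  proof (rule filterlim_cong[OF refl refl])
    show "\<forall>\<^sub>F y in at x within X. norm ((f y - f x) - (y - x) *\<^sub>R D) / norm (y - x)
        = norm ((1 / (y - x)) *\<^sub>R (f y - f x) - D)"
      unfolding eventually_at_filter by (intro always_eventually allI impI eq)
  qed
  also have "\<dots> \<longleftrightarrow> ((\<lambda>y. (1 / (y - x)) *\<^sub>R (f y - f x) - D) \<longlongrightarrow> 0) (at x within X)"
    by (rule tendsto_norm_zero_iff)
  also have "\<dots> \<longleftrightarrow> ((\<lambda>y. (1 / (y - x)) *\<^sub>R (f y - f x)) \<longlongrightarrow> D) (at x within X)"
    by (rule Lim_null[symmetric])
  finally show ?thesis
    unfolding has_vector_derivative_def has_derivative_iff_norm using bounded_linear_scaleR_left by blast
qed

lemma has_integral_uniform_limit: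
  fixes f :: "real \<Rightarrow> 'b::banach"
  assumes "uniform_limit {a..b} fn f sequentially" "\<And>n. continuous_on {a..b} (fn n)"
    and "\<And>n. (fn n has_integral I n) {a..b}" "I \<longlonglongrightarrow> J"
  shows "(f has_integral J) {a..b}"
proof -
  obtain I' J' where *: "\<And>n. (fn n has_integral I' n) {a..b}" "(f has_integral J') {a..b}" "I' \<longlonglongrightarrow> J'"
    using uniform_limit_integral[OF assms(1,2) sequentially_bot] by metis
  have "I' = I" using *(1) assms(3) by (intro ext) (metis has_integral_unique)
  then have "J' = J" using *(3) assms(4) LIMSEQ_unique by blast
  then show ?thesis using *(2) by simp
qed

context bscale
begin

lemma opfam_subset: "opfam Y f \<Longrightarrow> X \<subseteq> Y \<Longrightarrow> opfam X f"
  using opfam_reindex[of Y f X "\<lambda>p. p"] by simp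

lemma uconv_subset: "uconv Y fn f \<Longrightarrow> X \<subseteq> Y \<Longrightarrow> uconv X fn f"
  unfolding uconv_def by blast

text \<open>From some \<open>N\<close> on, the operators differ from the limit by at most \<open>1\<close> in norm; the finitely many earlier
  ones have bounds of their own.\<close>
lemma equi_uconv:
  assumes u: "uconv X fn f" and ops: "\<And>n p. p \<in> X \<Longrightarrow> fn n p \<in> ops" "\<And>p. p \<in> X \<Longrightarrow> f p \<in> ops"
    and fn: "\<And>n. equi X (fn n)"
  shows "equi (UNIV \<times> X) (\<lambda>(n, p). fn n p)" "equi X f"
proof -
  have "\<exists>C. (\<forall>n. \<forall>p\<in>X. \<forall>x\<in>E \<alpha>. nm \<alpha>' (fn n p x) \<le> C * nm \<alpha> x) \<and> (\<forall>p\<in>X. \<forall>x\<in>E \<alpha>. nm \<alpha>' (f p x) \<le> C * nm \<alpha> x)"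
    if \<alpha>: "low S < \<alpha>'" "\<alpha>' < \<alpha>" for \<alpha>' \<alpha>
  proof -
    obtain N where N: "\<And>n p x. n \<ge> N \<Longrightarrow> p \<in> X \<Longrightarrow> x \<in> E \<alpha> \<Longrightarrow> nm \<alpha>' (fn n p x - f p x) \<le> 1 * nm \<alpha> x"
      using uconvD[OF u \<alpha>, of 1] zero_less_one by blast
    have "\<forall>n. \<exists>C\<ge>0. \<forall>p\<in>X. \<forall>x\<in>E \<alpha>. nm \<alpha>' (fn n p x) \<le> C * nm \<alpha> x"
      using equi_bound[OF fn \<alpha>] by blast
    then obtain C where C: "\<And>n. 0 \<le> C n" "\<And>n p x. p \<in> X \<Longrightarrow> x \<in> E \<alpha> \<Longrightarrow> nm \<alpha>' (fn n p x) \<le> C n * nm \<alpha> x"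
      by metis
    define D where "D = (\<Sum>n\<le>N. C n) + 2"
    have CD: "C n + 2 \<le> D" if "n \<le> N" for n
      using member_le_sum[of n "{..N}" C] C(1) that by (simp add: D_def)
    have nx: "0 \<le> nm \<alpha> x" if "x \<in> E \<alpha>" for x using \<alpha> that by (auto intro: nm_nonneg)
    have f: "nm \<alpha>' (f p x) \<le> (D - 1) * nm \<alpha> x" if "p \<in> X" "x \<in> E \<alpha>" for p x
    proof -
      have E: "fn N p x \<in> E \<alpha>'" "f p x \<in> E \<alpha>'" using ops that \<alpha> by (auto intro: ops_E)
      have "norm (em \<alpha>' (f p x)) \<le> norm (em \<alpha>' (fn N p x)) + norm (em \<alpha>' (fn N p x) - em \<alpha>' (f p x))"
        using norm_triangle_sub[of "em \<alpha>' (f p x)" "em \<alpha>' (fn N p x)"] by (simp add: norm_minus_commute)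
      then have "nm \<alpha>' (f p x) \<le> (C N + 1) * nm \<alpha> x"
        using N[OF order_refl that] C(2)[OF that, of N] E \<alpha> by (simp add: norm_em norm_em_diff algebra_simps)
      also have "\<dots> \<le> (D - 1) * nm \<alpha> x" using CD[of N] nx[OF that(2)] by (intro mult_right_mono) auto
      finally show ?thesis .
    qed
    have "nm \<alpha>' (fn n p x) \<le> D * nm \<alpha> x" if p: "p \<in> X" "x \<in> E \<alpha>" for n p x
    proof (cases "n \<le> N")
      case True
      have "nm \<alpha>' (fn n p x) \<le> C n * nm \<alpha> x" by (rule C(2)[OF p])
      also have "\<dots> \<le> D * nm \<alpha> x" using CD[OF True] nx[OF p(2)] by (intro mult_right_mono) auto
      finally show ?thesis .
    next
      case False
      have E: "fn n p x \<in> E \<alpha>'" "f p x \<in> E \<alpha>'" using ops p \<alpha> by (auto intro: ops_E)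
      have "norm (em \<alpha>' (fn n p x)) \<le> norm (em \<alpha>' (f p x)) + norm (em \<alpha>' (fn n p x) - em \<alpha>' (f p x))"
        by (rule norm_triangle_sub)
      then show ?thesis
        using N[of n, OF _ p] f[OF p] E \<alpha> False by (simp add: norm_em norm_em_diff algebra_simps)
    qed
    moreover have "nm \<alpha>' (f p x) \<le> D * nm \<alpha> x" if "p \<in> X" "x \<in> E \<alpha>" for p x
      using f[OF that] nx[OF that(2)] by (simp add: algebra_simps)
    ultimately show ?thesis by blast
  qed
  then show "equi (UNIV \<times> X) (\<lambda>(n, p). fn n p)" "equi X f"
    unfolding equi_def by (simp, meson)+
qed

lemma opfam_uconv:
  fixes X :: "'p::topological_space set"
  assumes u: "uconv X fn f" and fn: "\<And>n. opfam X (fn n)" and f: "\<And>p. p \<in> X \<Longrightarrow> f p \<in> ops"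
  shows "opfam X f"
  unfolding opfam_def
proof (intro conjI ballI)
  show "equi X f" by (rule equi_uconv(2)[OF u opfamD(1)[OF fn] f opfamD(3)[OF fn]])
  show "scont X f"
    unfolding scont_def
  proof (intro allI impI ballI)
    fix \<alpha>' \<alpha> k assume \<alpha>: "low S < \<alpha>'" "\<alpha>' < \<alpha>" "k \<in> E \<alpha>"
    show "continuous_on X (\<lambda>p. em \<alpha>' (f p k))"
      by (rule uniform_limit_theorem[OF _ uconv_tendsto[OF u opfamD(1)[OF fn] f \<alpha>] sequentially_bot])
        (simp add: scontD[OF opfamD(2)[OF fn] \<alpha>])
  qed
qed (rule f)

lemma bounded_op_limit:
  assumes \<alpha>: "low S < \<alpha>'" "low S < \<alpha>" and fn: "\<And>n. fn n \<in> bounded_op S \<alpha> \<alpha>'"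
    and g: "\<And>x. x \<in> E \<alpha> \<Longrightarrow> g x \<in> E \<alpha>'" and lim: "\<And>x. x \<in> E \<alpha> \<Longrightarrow> (\<lambda>n. em \<alpha>' (fn n x)) \<longlonglongrightarrow> em \<alpha>' (g x)"
    and C: "\<And>n x. x \<in> E \<alpha> \<Longrightarrow> nm \<alpha>' (fn n x) \<le> C * nm \<alpha> x"
  shows "g \<in> bounded_op S \<alpha> \<alpha>'" "\<And>x. x \<in> E \<alpha> \<Longrightarrow> nm \<alpha>' (g x) \<le> C * nm \<alpha> x"
proof -
  show bound: "nm \<alpha>' (g x) \<le> C * nm \<alpha> x" if x: "x \<in> E \<alpha>" for x
  proof -
    have "norm (em \<alpha>' (g x)) \<le> C * nm \<alpha> x"
      by (rule Lim_norm_ubound[OF sequentially_bot lim[OF x]])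
        (use C[OF x] op_E[OF fn x] \<alpha> in \<open>simp add: norm_em\<close>)
    then show ?thesis using g[OF x] \<alpha> by (simp add: norm_em)
  qed
  have "g (x + y) = g x + g y" if "x \<in> E \<alpha>" "y \<in> E \<alpha>" for x y
  proof -
    have "(\<lambda>n. em \<alpha>' (fn n (x + y))) \<longlonglongrightarrow> em \<alpha>' (g x + g y)"
      using tendsto_add[OF lim[OF that(1)] lim[OF that(2)]]
      by (simp add: op_add[OF fn that] em_add \<alpha>)
    then have "em \<alpha>' (g (x + y)) = em \<alpha>' (g x + g y)"
      using lim[OF E_add[OF \<alpha>(2) that]] LIMSEQ_unique by blast
    then show ?thesis
      using g[OF that(1)] g[OF that(2)] g[OF E_add[OF \<alpha>(2) that]] em_eq_iff[OF \<alpha>(1)] E_add[OF \<alpha>(1)] by simp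
  qed
  moreover have "g (scl S c x) = scl S c (g x)" if x: "x \<in> E \<alpha>" for c x
  proof -
    have "(\<lambda>n. em \<alpha>' (scl S c (fn n x))) \<longlonglongrightarrow> em \<alpha>' (scl S c (g x))"
      by (rule tendsto_op[OF \<alpha>(1,1) bounded_op_scl[OF \<alpha>(1)]]) (use lim[OF x] g[OF x] op_E[OF fn x] in auto)
    then have "em \<alpha>' (g (scl S c x)) = em \<alpha>' (scl S c (g x))"
      using lim[OF E_scl[OF \<alpha>(2) x]] LIMSEQ_unique by (simp add: op_scl[OF fn x]) blast
    then show ?thesis
      using g[OF x] g[OF E_scl[OF \<alpha>(2) x]] em_eq_iff[OF \<alpha>(1)] E_scl[OF \<alpha>(1)] by simp
  qed
  ultimately show "g \<in> bounded_op S \<alpha> \<alpha>'"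
    using g bound unfolding bounded_op_def by (simp add: image_subset_iff) blast
qed

lemma ops_limit:
  assumes fn: "\<And>n. fn n \<in> ops"
    and lim: "\<And>\<alpha>' \<alpha> x. low S < \<alpha>' \<Longrightarrow> \<alpha>' < \<alpha> \<Longrightarrow> x \<in> E \<alpha> \<Longrightarrow>
      g x \<in> E \<alpha>' \<and> (\<lambda>n. em \<alpha>' (fn n x)) \<longlonglongrightarrow> em \<alpha>' (g x)"
    and C: "\<And>\<alpha>' \<alpha> n x. low S < \<alpha>' \<Longrightarrow> \<alpha>' < \<alpha> \<Longrightarrow> x \<in> E \<alpha> \<Longrightarrow> nm \<alpha>' (fn n x) \<le> C * nm \<alpha> x"
  shows "g \<in> ops" "\<And>\<alpha>' \<alpha> x. low S < \<alpha>' \<Longrightarrow> \<alpha>' < \<alpha> \<Longrightarrow> x \<in> E \<alpha> \<Longrightarrow> nm \<alpha>' (g x) \<le> C * nm \<alpha> x"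
proof -
  have *: "g \<in> bounded_op S \<alpha> \<alpha>' \<and> (\<forall>x\<in>E \<alpha>. nm \<alpha>' (g x) \<le> C * nm \<alpha> x)"
    if \<alpha>: "low S < \<alpha>'" "\<alpha>' < \<alpha>" for \<alpha>' \<alpha>
    using bounded_op_limit[OF \<alpha>(1) less_trans[OF \<alpha>] opsD[OF fn \<alpha>]
        conjunct1[OF lim[OF \<alpha>]] conjunct2[OF lim[OF \<alpha>]] C[OF \<alpha>]] by blast
  from * show "g \<in> ops" by (simp add: ops_def)
  from * show "\<And>\<alpha>' \<alpha> x. low S < \<alpha>' \<Longrightarrow> \<alpha>' < \<alpha> \<Longrightarrow> x \<in> E \<alpha> \<Longrightarrow> nm \<alpha>' (g x) \<le> C * nm \<alpha> x" by blast
qed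

section \<open>Evolution families and their generators\<close>

text \<open>The conditions (A2) and (A4), and below the condition (A3), for families of single maps. Joint continuity
  is stated on the bounded sets \<open>tri2 T\<close>, where all families of this development are equibounded.\<close>
definition evol :: "real \<Rightarrow> (real \<Rightarrow> real \<Rightarrow> 'a \<Rightarrow> 'a) \<Rightarrow> bool" where
  "evol K v \<longleftrightarrow> 1 \<le> K \<and> (\<forall>T. opfam (tri2 T) (\<lambda>(t, s). v t s)) \<and>
     (\<forall>\<alpha> k t. low S < \<alpha> \<longrightarrow> k \<in> E \<alpha> \<longrightarrow> 0 \<le> t \<longrightarrow> v t t k = k) \<and>
     (\<forall>\<alpha>' \<alpha> t s k. low S < \<alpha>' \<longrightarrow> \<alpha>' < \<alpha> \<longrightarrow> 0 \<le> s \<longrightarrow> s \<le> t \<longrightarrow> k \<in> E \<alpha> \<longrightarrow> nm \<alpha>' (v t s k) \<le> K * nm \<alpha> k)"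

definition generates :: "(real \<Rightarrow> 'a \<Rightarrow> 'a) \<Rightarrow> (real \<Rightarrow> real \<Rightarrow> 'a \<Rightarrow> 'a) \<Rightarrow> bool" where
  "generates a v \<longleftrightarrow> (\<forall>\<alpha>' \<alpha> t s k. low S < \<alpha>' \<longrightarrow> \<alpha>' < \<alpha> \<longrightarrow> 0 \<le> s \<longrightarrow> s \<le> t \<longrightarrow> k \<in> E \<alpha> \<longrightarrow>
     ((\<lambda>r. em \<alpha>' (a r (v r s k))) has_integral em \<alpha>' (v t s k - k)) {s..t} \<and>
     ((\<lambda>r. em \<alpha>' (v t r (a r k))) has_integral em \<alpha>' (v t s k - k)) {s..t})"

lemma evol_opfam: "evol K v \<Longrightarrow> opfam (tri2 T) (\<lambda>(t, s). v t s)"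
  and evol_refl: "evol K v \<Longrightarrow> low S < \<alpha> \<Longrightarrow> k \<in> E \<alpha> \<Longrightarrow> 0 \<le> t \<Longrightarrow> v t t k = k"
  and evol_bound: "evol K v \<Longrightarrow> low S < \<alpha>' \<Longrightarrow> \<alpha>' < \<alpha> \<Longrightarrow> 0 \<le> s \<Longrightarrow> s \<le> t \<Longrightarrow> k \<in> E \<alpha> \<Longrightarrow>
    nm \<alpha>' (v t s k) \<le> K * nm \<alpha> k"
  and evol_K: "evol K v \<Longrightarrow> 1 \<le> K"
  unfolding evol_def by blast+

lemma evol_ops: "evol K v \<Longrightarrow> 0 \<le> s \<Longrightarrow> s \<le> t \<Longrightarrow> v t s \<in> ops"
  using opfamD(1)[OF evol_opfam[of K v t], of "(t, s)"] by (simp add: tri2_def)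

lemma evol_E: "evol K v \<Longrightarrow> 0 \<le> s \<Longrightarrow> s \<le> t \<Longrightarrow> low S < \<alpha>' \<Longrightarrow> \<alpha>' < \<alpha> \<Longrightarrow> k \<in> E \<alpha> \<Longrightarrow> v t s k \<in> E \<alpha>'"
  by (rule ops_E[OF evol_ops])

lemma evol_opfam_fst: "evol K v \<Longrightarrow> 0 \<le> s \<Longrightarrow> opfam {s..t} (\<lambda>r. v r s)"
  by (rule opfam_reindex[OF evol_opfam[of K v t], of "{s..t}" "\<lambda>r. (r, s)", unfolded prod.case])
    (auto simp: tri2_def intro!: continuous_intros)

lemma evol_opfam_snd: "evol K v \<Longrightarrow> 0 \<le> s \<Longrightarrow> opfam {s..t} (\<lambda>r. v t r)"
  by (rule opfam_reindex[OF evol_opfam[of K v t], of "{s..t}" "\<lambda>r. (t, r)", unfolded prod.case])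
    (auto simp: tri2_def intro!: continuous_intros)

text \<open>By the product rule, \<open>r \<mapsto> v t r (v' r s k)\<close> has the derivative \<open>v t r ((a' r - a r) (v' r s k))\<close>.
  The two equations of (A3) provide the derivatives of the factors: that of \<open>v' r s k\<close> in an intermediate
  space, and that of \<open>v t r\<close>, strongly, on this space. The fundamental theorem of calculus does the rest.\<close>
lemma duhamel:
  assumes v: "evol K v" "generates a v" and v': "evol K v'" "generates a' v'"
    and a: "opfam {0..t} a" "opfam {0..t} a'"
    and \<alpha>: "low S < \<alpha>'" "\<alpha>' < \<alpha>" and k: "k \<in> E \<alpha>" and st: "0 \<le> s" "s \<le> t"
  shows "((\<lambda>r. em \<alpha>' (v t r (a' r (v' r s k) - a r (v' r s k)))) has_integral em \<alpha>' (v' t s k - v t s k)) {s..t}"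
proof -
  obtain \<beta> where \<beta>: "\<alpha>' < \<beta>" "\<beta> < \<alpha>" "low S < \<beta>" using dense[OF \<alpha>(2)] \<alpha> by force
  obtain \<gamma> where \<gamma>: "\<beta> < \<gamma>" "\<gamma> < \<alpha>" "low S < \<gamma>" using dense[OF \<beta>(2)] \<beta> by force
  have as: "opfam {s..t} a" "opfam {s..t} a'" using a st by (auto intro: opfam_subset)
  define x where "x r = v' r s k" for r
  have xE: "x r \<in> E \<delta>" if "r \<in> {s..t}" "low S < \<delta>" "\<delta> < \<alpha>" for r \<delta>
    using evol_E[OF v'(1) st(1) _ that(2,3) k] that(1) by (simp add: x_def)
  have x_cont: "continuous_on {s..t} (\<lambda>r. em \<gamma> (x r))"
    unfolding x_def by (rule scontD[OF opfamD(2)[OF evol_opfam_fst[OF v'(1) st(1)]] \<gamma>(3,2) k])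
  have axE: "a r (x r) \<in> E \<beta>" "a' r (x r) \<in> E \<beta>" if "r \<in> {s..t}" for r
    using ops_E[OF opfamD(1)[OF as(1) that] \<beta>(3) \<gamma>(1) xE] ops_E[OF opfamD(1)[OF as(2) that] \<beta>(3) \<gamma>(1) xE] that \<gamma> by auto
  have x_deriv: "((\<lambda>r. em \<beta> (x r)) has_vector_derivative em \<beta> (a' r (x r))) (at r within {s..t})"
    if r: "r \<in> {s..t}" for r
  proof -
    have "continuous_on {s..t} (\<lambda>u. em \<beta> (a' u (x u)))"
      by (rule opfam_apply[OF as(2) \<beta>(3) \<gamma>(1) xE x_cont]) (use \<gamma> in auto)
    from integral_has_vector_derivative[OF this r]
    have d: "((\<lambda>r. em \<beta> k + integral {s..r} (\<lambda>u. em \<beta> (a' u (x u)))) has_vector_derivative em \<beta> (a' r (x r)))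
        (at r within {s..t})" by (auto intro!: derivative_eq_intros)
    show ?thesis
    proof (rule has_vector_derivative_transform[OF r _ d])
      fix q assume "q \<in> {s..t}"
      then have "((\<lambda>u. em \<beta> (a' u (x u))) has_integral em \<beta> (x q - k)) {s..q}"
        using v'(2) \<beta> k st unfolding generates_def x_def by auto
      then show "em \<beta> (x q) = em \<beta> k + integral {s..q} (\<lambda>u. em \<beta> (a' u (x u)))"
        by (simp add: integral_unique em_diff \<beta>)
    qed
  qed
  have v_deriv: "((\<lambda>r. em \<alpha>' (v t r y)) has_vector_derivative - em \<alpha>' (v t r (a r y))) (at r within {s..t})"
    if r: "r \<in> {s..t}" and y: "y \<in> E \<beta>" for r y
  proof -
    obtain \<delta> where \<delta>: "\<alpha>' < \<delta>" "\<delta> < \<beta>" "low S < \<delta>" using dense[OF \<beta>(1)] \<alpha> by force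
    have "continuous_on {s..t} (\<lambda>u. em \<alpha>' (v t u (a u y)))"
      by (rule opfam_apply[OF evol_opfam_snd[OF v(1) st(1)] \<alpha>(1) \<delta>(1)
            ops_E[OF opfamD(1)[OF as(1)] \<delta>(3,2) y] scontD[OF opfamD(2)[OF as(1)] \<delta>(3,2) y]])
    from integral_has_vector_derivative'[OF this r]
    have d: "((\<lambda>r. em \<alpha>' y + integral {r..t} (\<lambda>u. em \<alpha>' (v t u (a u y)))) has_vector_derivative
        - em \<alpha>' (v t r (a r y))) (at r within {s..t})" by (auto intro!: derivative_eq_intros)
    show ?thesis
    proof (rule has_vector_derivative_transform[OF r _ d])
      fix q assume "q \<in> {s..t}"
      then have "((\<lambda>u. em \<alpha>' (v t u (a u y))) has_integral em \<alpha>' (v t q y - y)) {q..t}"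
        using v(2) \<alpha> \<beta> y st unfolding generates_def by auto
      then show "em \<alpha>' (v t q y) = em \<alpha>' y + integral {q..t} (\<lambda>u. em \<alpha>' (v t u (a u y)))"
        by (simp add: integral_unique em_diff \<alpha>)
    qed
  qed
  have deriv: "((\<lambda>r. em \<alpha>' (v t r (x r))) has_vector_derivative em \<alpha>' (v t r (a' r (x r) - a r (x r)))) (at r within {s..t})"
    if r: "r \<in> {s..t}" for r
    unfolding has_vector_derivative_iff_quotient
  proof -
    have ev: "\<forall>\<^sub>F q in at r within {s..t}. q \<in> {s..t} \<and> q \<noteq> r" by (simp add: eventually_at_filter)
    obtain C where C: "\<forall>q\<in>{s..t}. \<forall>z\<in>E \<beta>. nm \<alpha>' (v t q z) \<le> C * nm \<beta> z"
      using equi_bound[OF opfamD(3)[OF evol_opfam_snd[OF v(1) st(1)]] \<alpha>(1) \<beta>(1)] by blast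
    have vop: "v t q \<in> bounded_op S \<beta> \<alpha>'" if "q \<in> {s..t}" for q
      using opfamD(1)[OF evol_opfam_snd[OF v(1) st(1)] that] \<alpha>(1) \<beta>(1) by (rule opsD)
    (* the difference quotient of the product is v t q (d q) plus the one of q \<mapsto> v t q (x r) *)
    define d where "d q = (1 / (q - r)) *\<^sub>R (x q - x r)" for q
    have xb: "x q \<in> E \<beta>" if "q \<in> {s..t}" for q by (rule xE[OF that \<beta>(3,2)])
    have dE: "d q \<in> E \<beta>" if "q \<in> {s..t}" for q
      using xb[OF that] xb[OF r] \<beta> by (simp add: d_def E_scaleR E_diff)
    have "((\<lambda>q. em \<alpha>' (v t q (d q))) \<longlongrightarrow> em \<alpha>' (v t r (a' r (x r)))) (at r within {s..t})"
    proof (rule tendsto_op_apply[where T="v t" and f=d and x="a' r (x r)" and \<alpha>=\<beta> and C=C])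
      show "\<forall>\<^sub>F q in at r within {s..t}. v t q \<in> bounded_op S \<beta> \<alpha>'"
        using ev by eventually_elim (use vop in blast)
      show "\<forall>\<^sub>F q in at r within {s..t}. \<forall>z\<in>E \<beta>. nm \<alpha>' (v t q z) \<le> C * nm \<beta> z"
        using ev by eventually_elim (use C in blast)
      show "\<forall>\<^sub>F q in at r within {s..t}. d q \<in> E \<beta>"
        using ev by eventually_elim (use dE in blast)
      show "((\<lambda>q. em \<beta> (d q)) \<longlongrightarrow> em \<beta> (a' r (x r))) (at r within {s..t})"
        using x_deriv[OF r] unfolding has_vector_derivative_iff_quotient d_def by (simp add: em_scaleR em_diff \<beta>)
      show "((\<lambda>q. em \<alpha>' (v t q (a' r (x r)))) \<longlongrightarrow> em \<alpha>' (v t r (a' r (x r)))) (at r within {s..t})"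
        using scontD[OF opfamD(2)[OF evol_opfam_snd[OF v(1) st(1)]] \<alpha>(1) \<beta>(1) axE(2)[OF r]] r
        by (simp add: continuous_on_def)
    qed (use \<alpha> \<beta> axE[OF r] in auto)
    moreover have "((\<lambda>q. (1 / (q - r)) *\<^sub>R (em \<alpha>' (v t q (x r)) - em \<alpha>' (v t r (x r)))) \<longlongrightarrow> - em \<alpha>' (v t r (a r (x r))))
        (at r within {s..t})"
      using v_deriv[OF r xb[OF r]] unfolding has_vector_derivative_iff_quotient .
    ultimately have "((\<lambda>q. em \<alpha>' (v t q (d q)) + (1 / (q - r)) *\<^sub>R (em \<alpha>' (v t q (x r)) - em \<alpha>' (v t r (x r))))
        \<longlongrightarrow> em \<alpha>' (v t r (a' r (x r))) + - em \<alpha>' (v t r (a r (x r)))) (at r within {s..t})"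
      by (rule tendsto_add)
    also have "em \<alpha>' (v t r (a' r (x r))) + - em \<alpha>' (v t r (a r (x r))) = em \<alpha>' (v t r (a' r (x r) - a r (x r)))"
      using op_diff[OF vop[OF r] \<beta>(3) axE(2)[OF r] axE(1)[OF r]] \<alpha> by (simp add: em_diff)
    finally have lim: "((\<lambda>q. em \<alpha>' (v t q (d q)) + (1 / (q - r)) *\<^sub>R (em \<alpha>' (v t q (x r)) - em \<alpha>' (v t r (x r))))
        \<longlongrightarrow> em \<alpha>' (v t r (a' r (x r) - a r (x r)))) (at r within {s..t})" .
    show "((\<lambda>q. (1 / (q - r)) *\<^sub>R (em \<alpha>' (v t q (x q)) - em \<alpha>' (v t r (x r)))) \<longlongrightarrow>
        em \<alpha>' (v t r (a' r (x r) - a r (x r)))) (at r within {s..t})"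
    proof (rule Lim_transform_eventually[OF lim])
      show "\<forall>\<^sub>F q in at r within {s..t}. em \<alpha>' (v t q (d q)) + (1 / (q - r)) *\<^sub>R (em \<alpha>' (v t q (x r)) - em \<alpha>' (v t r (x r)))
          = (1 / (q - r)) *\<^sub>R (em \<alpha>' (v t q (x q)) - em \<alpha>' (v t r (x r)))"
        using ev
      proof eventually_elim
        case (elim q)
        then have q: "q \<in> {s..t}" by simp
        have "v t q (d q) = (1 / (q - r)) *\<^sub>R (v t q (x q) - v t q (x r))"
          using op_scaleR[OF vop[OF q] E_diff[OF \<beta>(3) xb[OF q] xb[OF r]]]
            op_diff[OF vop[OF q] \<beta>(3) xb[OF q] xb[OF r]] by (simp add: d_def)
        then show ?case using \<alpha> by (simp add: em_scaleR em_diff scaleR_diff_right)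
      qed
    qed
  qed
  have "((\<lambda>r. em \<alpha>' (v t r (a' r (x r) - a r (x r)))) has_integral em \<alpha>' (v t t (x t)) - em \<alpha>' (v t s (x s))) {s..t}"
    by (rule fundamental_theorem_of_calculus[OF st(2) deriv])
  moreover have "v t t (x t) = v' t s k" "x s = k"
    using evol_refl[OF v(1) \<beta>(3) xE[OF _ \<beta>(3,2)], of t t] evol_refl[OF v'(1) _ k, of s] st \<alpha> by (auto simp: x_def)
  ultimately show ?thesis using \<alpha> by (simp add: em_diff x_def)
qed

lemma duhamel_bound:
  assumes v: "evol K v" "generates a v" and v': "evol K v'" "generates a' v'"
    and a: "opfam {0..T} a" "opfam {0..T} a'"
    and \<alpha>: "low S < \<alpha>'" "\<alpha>' < \<gamma>" "\<gamma> < \<beta>" "\<beta> < \<alpha>" and k: "k \<in> E \<alpha>" and st: "0 \<le> s" "s \<le> t" "t \<le> T"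
    and e: "0 \<le> e" "\<And>r x. r \<in> {0..T} \<Longrightarrow> x \<in> E \<beta> \<Longrightarrow> nm \<gamma> (a' r x - a r x) \<le> e * nm \<beta> x"
  shows "nm \<alpha>' (v' t s k - v t s k) \<le> (K * (e * K) * T) * nm \<alpha> k"
proof -
  have K: "0 \<le> K" using evol_K[OF v(1)] by simp
  have l: "low S < \<gamma>" "low S < \<beta>" "\<alpha>' < \<alpha>" "low S < \<alpha>" using \<alpha> by auto
  have nk: "0 \<le> nm \<alpha> k" using l k by (auto intro: nm_nonneg)
  have at: "opfam {0..t} a" "opfam {0..t} a'" using a st by (auto intro: opfam_subset)
  have "norm (em \<alpha>' (v' t s k - v t s k)) \<le> (K * (e * (K * nm \<alpha> k))) * measure lborel (cbox s t)"
  proof (rule has_integral_bound)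
    show "0 \<le> K * (e * (K * nm \<alpha> k))" using K e nk by simp
    show "((\<lambda>r. em \<alpha>' (v t r (a' r (v' r s k) - a r (v' r s k)))) has_integral em \<alpha>' (v' t s k - v t s k)) (cbox s t)"
      using duhamel[OF v v' at \<alpha>(1) l(3) k st(1,2)] by simp
    fix r assume "r \<in> cbox s t"
    then have r: "s \<le> r" "r \<le> t" "r \<in> {0..t}" using st by auto
    have 1: "v' r s k \<in> E \<beta>" by (rule evol_E[OF v'(1) st(1) r(1) l(2) \<alpha>(4) k])
    have 2: "a' r (v' r s k) - a r (v' r s k) \<in> E \<gamma>"
      using at r 1 l \<alpha> by (intro E_diff ops_E[OF opfamD(1)[OF at(1)]] ops_E[OF opfamD(1)[OF at(2)]]) auto
    have 3: "v t r (a' r (v' r s k) - a r (v' r s k)) \<in> E \<alpha>'"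
      using evol_E[OF v(1) _ r(2) \<alpha>(1,2) 2] st r by simp
    have "norm (em \<alpha>' (v t r (a' r (v' r s k) - a r (v' r s k)))) = nm \<alpha>' (v t r (a' r (v' r s k) - a r (v' r s k)))"
      using 3 \<alpha> by (simp add: norm_em)
    also have "\<dots> \<le> K * nm \<gamma> (a' r (v' r s k) - a r (v' r s k))"
      using evol_bound[OF v(1) \<alpha>(1,2) _ r(2) 2] st r by simp
    also have "\<dots> \<le> K * (e * nm \<beta> (v' r s k))"
      using e(2)[OF _ 1, of r] r st K by (intro mult_left_mono) auto
    also have "\<dots> \<le> K * (e * (K * nm \<alpha> k))"
      using evol_bound[OF v'(1) l(2) \<alpha>(4) st(1) r(1) k] K e by (intro mult_left_mono) auto
    finally show "norm (em \<alpha>' (v t r (a' r (v' r s k) - a r (v' r s k)))) \<le> K * (e * (K * nm \<alpha> k))" .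
  qed
  also have "\<dots> \<le> (K * (e * (K * nm \<alpha> k))) * T"
    using st K e nk by (intro mult_left_mono) auto
  finally show ?thesis
    using evol_E[OF v(1) st(1,2) \<alpha>(1) l(3) k] evol_E[OF v'(1) st(1,2) \<alpha>(1) l(3) k] \<alpha>
    by (simp add: norm_em E_diff mult_ac)
qed

end

context bscale
begin

section \<open>Limits of evolution families\<close>

lemma uconv_evol_fst:
  "uconv (tri2 t) (\<lambda>n (t, s). vn n t s) (\<lambda>(t, s). v t s) \<Longrightarrow> 0 \<le> s \<Longrightarrow>
    uconv {s..t} (\<lambda>n r. vn n r s) (\<lambda>r. v r s)"
  using uconv_reindex[of "tri2 t" "\<lambda>n (t, s). vn n t s" "\<lambda>(t, s). v t s" "\<lambda>r. (r, s)" "{s..t}"]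
  by (simp add: tri2_def image_subset_iff)

lemma uconv_evol_snd:
  "uconv (tri2 t) (\<lambda>n (t, s). vn n t s) (\<lambda>(t, s). v t s) \<Longrightarrow> 0 \<le> s \<Longrightarrow>
    uconv {s..t} (\<lambda>n r. vn n t r) (\<lambda>r. v t r)"
  using uconv_reindex[of "tri2 t" "\<lambda>n (t, s). vn n t s" "\<lambda>(t, s). v t s" "\<lambda>r. (t, r)" "{s..t}"]
  by (simp add: tri2_def image_subset_iff)

lemma evol_uniformly_Cauchy:
  assumes vn: "\<And>n. evol K (vn n)" and gen: "\<And>n. generates (an n) (vn n)"
    and an: "\<And>n T. opfam {0..T} (an n)" and u: "uconv {0..\<bar>T\<bar>} an a" and a: "\<And>t. 0 \<le> t \<Longrightarrow> a t \<in> ops"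
    and \<alpha>: "low S < \<alpha>'" "\<alpha>' < \<alpha>" and e: "e > 0"
  shows "\<exists>N. \<forall>m\<ge>N. \<forall>n\<ge>N. \<forall>t s. (t, s) \<in> tri2 T \<longrightarrow> (\<forall>k\<in>E \<alpha>. nm \<alpha>' (vn m t s k - vn n t s k) \<le> e * nm \<alpha> k)"
proof -
  obtain \<gamma> where \<gamma>: "\<alpha>' < \<gamma>" "\<gamma> < \<alpha>" using dense[OF \<alpha>(2)] by blast
  obtain \<beta> where \<beta>: "\<gamma> < \<beta>" "\<beta> < \<alpha>" using dense[OF \<gamma>(2)] by blast
  have low: "low S < \<gamma>" "low S < \<beta>" using \<alpha> \<gamma> \<beta> by auto
  have K: "1 \<le> K" by (rule evol_K[OF vn])
  define d where "d = e / (2 * K * K * (\<bar>T\<bar> + 1))"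
  have d: "d > 0" using e K by (simp add: d_def add_nonneg_pos)
  have dK: "K * ((2 * d) * K) * \<bar>T\<bar> \<le> e"
  proof -
    define x where "x = \<bar>T\<bar> + 1"
    have "d = e / (2 * K * K * x)" by (simp add: d_def x_def)
    moreover have "x > 0" by (simp add: x_def add_nonneg_pos)
    ultimately have "K * ((2 * d) * K) = e / x" using K by (simp add: field_simps)
    then have "K * ((2 * d) * K) * \<bar>T\<bar> = e * (\<bar>T\<bar> / (\<bar>T\<bar> + 1))" by (simp add: x_def)
    also have "\<dots> \<le> e * 1" using e by (intro mult_left_mono) auto
    finally show ?thesis by simp
  qed
  obtain N where N: "\<And>n r x. n \<ge> N \<Longrightarrow> r \<in> {0..\<bar>T\<bar>} \<Longrightarrow> x \<in> E \<beta> \<Longrightarrow> nm \<gamma> (an n r x - a r x) \<le> d * nm \<beta> x"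
    using uconvD[OF u low(1) \<beta>(1) d] by blast
  have diff: "nm \<gamma> (an m r x - an n r x) \<le> (2 * d) * nm \<beta> x"
    if mn: "m \<ge> N" "n \<ge> N" and r: "r \<in> {0..\<bar>T\<bar>}" and x: "x \<in> E \<beta>" for m n r x
  proof -
    have E: "an m r x \<in> E \<gamma>" "an n r x \<in> E \<gamma>" "a r x \<in> E \<gamma>"
      using ops_E[OF opfamD(1)[OF an r] low(1) \<beta>(1) x] ops_E[OF a low(1) \<beta>(1) x] r by auto
    have "norm (em \<gamma> (an m r x) - em \<gamma> (an n r x)) \<le> norm (em \<gamma> (an m r x) - em \<gamma> (a r x)) + norm (em \<gamma> (an n r x) - em \<gamma> (a r x))"
      by (metis diff_add_cancel diff_diff_eq2 norm_minus_commute norm_triangle_ineq4 norm_triangle_sub dist_norm dist_triangle2)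
    then show ?thesis using N[OF mn(1) r x] N[OF mn(2) r x] E low by (simp add: norm_em_diff)
  qed
  have "nm \<alpha>' (vn m t s k - vn n t s k) \<le> e * nm \<alpha> k"
    if mn: "m \<ge> N" "n \<ge> N" and p: "(t, s) \<in> tri2 T" and k: "k \<in> E \<alpha>" for m n t s k
  proof -
    have st: "0 \<le> s" "s \<le> t" "t \<le> \<bar>T\<bar>" using p by (auto simp: tri2_def)
    have "nm \<alpha>' (vn m t s k - vn n t s k) \<le> (K * ((2 * d) * K) * \<bar>T\<bar>) * nm \<alpha> k"
      by (rule duhamel_bound[OF vn gen vn gen an an \<alpha>(1) \<gamma>(1) \<beta> k st]) (use d diff[OF mn] in auto)
    also have "\<dots> \<le> e * nm \<alpha> k"
      using \<alpha> k by (intro mult_right_mono[OF dK] nm_nonneg) auto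
    finally show ?thesis .
  qed
  then show ?thesis by (intro exI[of _ N]) blast
qed

theorem evol_limit:
  assumes vn: "\<And>n. evol K (vn n)" and gen: "\<And>n. generates (an n) (vn n)"
    and an: "\<And>n T. opfam {0..T} (an n)" and u: "\<And>T. uconv {0..T} an a" and a: "\<And>t. 0 \<le> t \<Longrightarrow> a t \<in> ops"
  shows "\<exists>v. evol K v \<and> generates a v \<and> (\<forall>T. uconv (tri2 T) (\<lambda>n (t, s). vn n t s) (\<lambda>(t, s). v t s))"
proof -
  define v where "v t s k = slim (\<lambda>n. vn n t s k)" for t s k
  have Cau: "\<exists>N. \<forall>m\<ge>N. \<forall>n\<ge>N. \<forall>t s. (t, s) \<in> tri2 T \<longrightarrow> (\<forall>k\<in>E \<alpha>. nm \<alpha>' (vn m t s k - vn n t s k) \<le> e * nm \<alpha> k)"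
    if "low S < \<alpha>'" "\<alpha>' < \<alpha>" "e > 0" for T \<alpha>' \<alpha> e
    by (rule evol_uniformly_Cauchy[OF vn gen an u a that])
  have vE: "vn n t s k \<in> E \<alpha>'" if "0 \<le> s" "s \<le> t" "low S < \<alpha>'" "\<alpha>' < \<alpha>" "k \<in> E \<alpha>" for n t s \<alpha>' \<alpha> k
    by (rule evol_E[OF vn that])
  have lim: "v t s k \<in> E \<alpha>' \<and> (\<lambda>n. em \<alpha>' (vn n t s k)) \<longlonglongrightarrow> em \<alpha>' (v t s k)"
    if st: "0 \<le> s" "s \<le> t" and \<alpha>: "low S < \<alpha>'" "\<alpha>' < \<alpha>" "k \<in> E \<alpha>" for t s \<alpha>' \<alpha> k
  proof -
    have "Cauchy (\<lambda>n. em \<alpha>' (vn n t s k))"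
    proof (rule metric_CauchyI)
      fix e :: real assume e: "e > 0"
      have p: "(t, s) \<in> tri2 t" using st by (simp add: tri2_def)
      have nk: "0 \<le> nm \<alpha> k" using \<alpha> by (intro nm_nonneg) auto
      define d where "d = e / (nm \<alpha> k + 1)"
      have d: "d > 0" "d * nm \<alpha> k < e" using e nk by (auto simp: d_def field_simps)
      obtain N where N: "\<And>m n. m \<ge> N \<Longrightarrow> n \<ge> N \<Longrightarrow> nm \<alpha>' (vn m t s k - vn n t s k) \<le> d * nm \<alpha> k"
        using Cau[OF \<alpha>(1,2) d(1), of t] \<alpha>(3) p by blast
      have "dist (em \<alpha>' (vn m t s k)) (em \<alpha>' (vn n t s k)) < e" if "m \<ge> N" "n \<ge> N" for m n
        using N[OF that] d(2) vE[OF st \<alpha>] \<alpha>(1) by (simp add: dist_em)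
      then show "\<exists>N. \<forall>m\<ge>N. \<forall>n\<ge>N. dist (em \<alpha>' (vn m t s k)) (em \<alpha>' (vn n t s k)) < e" by blast
    qed
    from slim_Cauchy[OF \<alpha>(1) vE[OF st \<alpha>] this] show ?thesis by (simp add: v_def)
  qed
  have vops: "v t s \<in> ops" if "0 \<le> s" "s \<le> t" for t s
    by (rule ops_limit(1)[OF evol_ops[OF vn that] lim[OF that] evol_bound[OF vn _ _ that]])
  have vK: "nm \<alpha>' (v t s k) \<le> K * nm \<alpha> k" if "0 \<le> s" "s \<le> t" "low S < \<alpha>'" "\<alpha>' < \<alpha>" "k \<in> E \<alpha>" for t s \<alpha>' \<alpha> k
    by (rule ops_limit(2)[OF evol_ops[OF vn that(1,2)] lim[OF that(1,2)] evol_bound[OF vn _ _ that(1,2)] that(3-5)])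
  have uv: "uconv (tri2 T) (\<lambda>n (t, s). vn n t s) (\<lambda>(t, s). v t s)" for T
    unfolding uconv_def
  proof (intro allI impI)
    fix \<alpha>' \<alpha> e :: real assume \<alpha>: "low S < \<alpha>'" "\<alpha>' < \<alpha>" and e: "e > 0"
    obtain N where N: "\<And>m n t s k. m \<ge> N \<Longrightarrow> n \<ge> N \<Longrightarrow> (t, s) \<in> tri2 T \<Longrightarrow> k \<in> E \<alpha> \<Longrightarrow>
        nm \<alpha>' (vn m t s k - vn n t s k) \<le> e * nm \<alpha> k"
      using Cau[OF \<alpha> e, of T] by blast
    have "nm \<alpha>' (vn m t s k - v t s k) \<le> e * nm \<alpha> k" if m: "m \<ge> N" and p: "(t, s) \<in> tri2 T" and k: "k \<in> E \<alpha>" for m t s k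
    proof -
      have st: "0 \<le> s" "s \<le> t" using p by (auto simp: tri2_def)
      note L = lim[OF st \<alpha> k] and X = vE[OF st \<alpha> k]
      have "norm (em \<alpha>' (vn m t s k) - em \<alpha>' (v t s k)) \<le> e * nm \<alpha> k"
      proof (rule Lim_norm_ubound[OF sequentially_bot tendsto_diff[OF tendsto_const conjunct2[OF L]]])
        show "\<forall>\<^sub>F n in sequentially. norm (em \<alpha>' (vn m t s k) - em \<alpha>' (vn n t s k)) \<le> e * nm \<alpha> k"
          using eventually_ge_at_top[of N]
          by eventually_elim (use N[OF m _ p k] X \<alpha> in \<open>simp add: norm_em_diff\<close>)
      qed
      then show ?thesis using L X \<alpha> by (simp add: norm_em_diff)
    qed
    then show "\<exists>N. \<forall>n\<ge>N. \<forall>p\<in>tri2 T. \<forall>x\<in>E \<alpha>. nm \<alpha>' ((case p of (t, s) \<Rightarrow> vn n t s) x - (case p of (t, s) \<Rightarrow> v t s) x) \<le> e * nm \<alpha> x"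
      by (intro exI[of _ N] allI impI ballI) (simp add: case_prod_beta)
  qed
  have gv: "opfam (tri2 T) (\<lambda>(t, s). v t s)" for T
    by (rule opfam_uconv[OF uv evol_opfam[OF vn]]) (auto simp: tri2_def intro: vops)
  have refl: "v t t k = k" if "low S < \<alpha>" "k \<in> E \<alpha>" "0 \<le> t" for \<alpha> k t
    unfolding v_def by (rule slim_eq[OF that(1,2)]) (simp_all add: evol_refl[OF vn that] that)
  have ev: "evol K v"
    unfolding evol_def using evol_K[OF vn] gv refl vK by blast
  have ga: "opfam {0..T} a" for T
    by (rule opfam_uconv[OF u an]) (simp add: a)
  have "generates a v"
    unfolding generates_def
  proof (intro allI impI)
    fix \<alpha>' \<alpha> t s :: real and k assume \<alpha>: "low S < \<alpha>'" "\<alpha>' < \<alpha>" and st: "0 \<le> s" "s \<le> t" and k: "k \<in> E \<alpha>"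
    have sub: "{s..t} \<subseteq> {0..t}" using st by (auto intro: order_trans)
    have an': "opfam {s..t} (an n)" for n by (rule opfam_subset[OF an sub])
    have a': "opfam {s..t} a" by (rule opfam_subset[OF ga sub])
    have ua: "uconv {s..t} an a" by (rule uconv_subset[OF u sub])
    note uv1 = uconv_evol_fst[OF uv st(1), of t] and uv2 = uconv_evol_snd[OF uv st(1), of t]
    note v1 = evol_opfam_fst[OF ev st(1), of t] and vn1 = evol_opfam_fst[OF vn st(1), of t]
    note v2 = evol_opfam_snd[OF ev st(1), of t] and vn2 = evol_opfam_snd[OF vn st(1), of t]
    have lim0: "(\<lambda>n. em \<alpha>' (vn n t s k - k)) \<longlonglongrightarrow> em \<alpha>' (v t s k - k)"
      using tendsto_diff[OF conjunct2[OF lim[OF st \<alpha> k]] tendsto_const] by (simp add: em_diff \<alpha>)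
    have u1: "uconv {s..t} (\<lambda>n r x. an n r (vn n r s x)) (\<lambda>r x. a r (v r s x))"
      by (rule uconv_compose[OF ua uv1 equi_uconv(1)[OF ua opfamD(1)[OF an'] opfamD(1)[OF a'] opfamD(3)[OF an']]
            opfamD(3)[OF v1] opfamD(1)[OF an'] opfamD(1)[OF a'] opfamD(1)[OF vn1] opfamD(1)[OF v1]])
    have u2: "uconv {s..t} (\<lambda>n r x. vn n t r (an n r x)) (\<lambda>r x. v t r (a r x))"
      by (rule uconv_compose[OF uv2 ua equi_uconv(1)[OF uv2 opfamD(1)[OF vn2] opfamD(1)[OF v2] opfamD(3)[OF vn2]]
            opfamD(3)[OF a'] opfamD(1)[OF vn2] opfamD(1)[OF v2] opfamD(1)[OF an'] opfamD(1)[OF a']])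
    note g1 = opfam_compose[OF an' vn1] and g1' = opfam_compose[OF a' v1]
    note g2 = opfam_compose[OF vn2 an'] and g2' = opfam_compose[OF v2 a']
    have gn: "((\<lambda>r. em \<alpha>' (an n r (vn n r s k))) has_integral em \<alpha>' (vn n t s k - k)) {s..t}"
      "((\<lambda>r. em \<alpha>' (vn n t r (an n r k))) has_integral em \<alpha>' (vn n t s k - k)) {s..t}" for n
      using gen[of n] \<alpha> st k unfolding generates_def by blast+
    show "((\<lambda>r. em \<alpha>' (a r (v r s k))) has_integral em \<alpha>' (v t s k - k)) {s..t} \<and>
       ((\<lambda>r. em \<alpha>' (v t r (a r k))) has_integral em \<alpha>' (v t s k - k)) {s..t}"
    proof
      show "((\<lambda>r. em \<alpha>' (a r (v r s k))) has_integral em \<alpha>' (v t s k - k)) {s..t}"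
        by (rule has_integral_uniform_limit[OF uconv_tendsto[OF u1 opfamD(1)[OF g1] opfamD(1)[OF g1'] \<alpha> k]
              scontD[OF opfamD(2)[OF g1] \<alpha> k] gn(1) lim0])
      show "((\<lambda>r. em \<alpha>' (v t r (a r k))) has_integral em \<alpha>' (v t s k - k)) {s..t}"
        by (rule has_integral_uniform_limit[OF uconv_tendsto[OF u2 opfamD(1)[OF g2] opfamD(1)[OF g2'] \<alpha> k]
              scontD[OF opfamD(2)[OF g2] \<alpha> k] gn(2) lim0])
    qed
  qed
  with ev uv show ?thesis by blast
qed

end

section \<open>The perturbation series\<close>

lemma power_div_fact_le_exp:
  fixes x :: real
  assumes "0 \<le> x"
  shows "x ^ n / fact n \<le> exp x"
proof -
  have s: "(\<lambda>n. x ^ n / fact n) sums exp x"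
    using exp_converges[of x] by (simp add: divide_inverse mult.commute)
  have "(\<Sum>i\<in>{n}. x ^ i / fact i) \<le> suminf (\<lambda>n. x ^ n / fact n)"
    using assms by (intro sum_le_suminf sums_summable[OF s]) auto
  then show ?thesis using sums_unique[OF s] by simp
qed

text \<open>Splitting the gap into \<open>j + 1\<close> instead of \<open>j\<close> parts costs \<open>(1 + 1/j)\<^sup>j \<le> 2\<^sup>j\<close>: this is the factor \<open>2\<close>
  in the definition of \<open>T(\<alpha>',\<alpha>)\<close>.\<close>
lemma Suc_power_div_fact_le: "(real (j + 1)) ^ j / fact j \<le> (2 * exp 1) ^ j"
proof (cases j)
  case (Suc i)
  have "(real (j + 1)) ^ j / fact j \<le> (2 * real j) ^ j / fact j"
    using Suc by (intro divide_right_mono power_mono) auto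
  also have "\<dots> = 2 ^ j * (real j ^ j / fact j)" by (simp add: power_mult_distrib)
  also have "\<dots> \<le> 2 ^ j * exp (real j)"
    by (intro mult_left_mono power_div_fact_le_exp) auto
  also have "\<dots> = (2 * exp 1) ^ j"
    by (simp add: power_mult_distrib exp_of_nat_mult[symmetric])
  finally show ?thesis .
qed simp

lemma has_integral_power_diff:
  fixes a c :: real
  assumes "a \<le> c"
  shows "((\<lambda>u. (u - a) ^ j) has_integral (c - a) ^ Suc j / real (Suc j)) {a..c}"
proof -
  have "((\<lambda>u. (u - a) ^ j) has_integral (c - a) ^ Suc j / real (Suc j) - (a - a) ^ Suc j / real (Suc j)) {a..c}"
  proof (rule fundamental_theorem_of_calculus[OF assms])
    fix u assume "u \<in> {a..c}"
    have "((\<lambda>u. (u - a) ^ Suc j / real (Suc j)) has_real_derivative (u - a) ^ j) (at u within {a..c})"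
      by (rule derivative_eq_intros refl | simp)+
    then show "((\<lambda>u. (u - a) ^ Suc j / real (Suc j)) has_vector_derivative (u - a) ^ j) (at u within {a..c})"
      by (simp add: has_real_derivative_iff_has_vector_derivative)
  qed
  then show ?thesis by simp
qed

context bscale
begin

lemma opfam_zero: "opfam X (\<lambda>p x. 0)"
  unfolding opfam_def scont_def equi_def ops_def bounded_op_def
  by (auto simp: E_zero nm_zero module.scale_zero_right[OF module_scl] intro!: exI[of _ 0])

lemma opfam_add:
  assumes f: "opfam X f" and g: "opfam X g"
  shows "opfam X (\<lambda>p x. f p x + g p x)"
proof -
  have bound: "\<exists>C. \<forall>p\<in>X. \<forall>x\<in>E \<alpha>. nm \<alpha>' (f p x + g p x) \<le> C * nm \<alpha> x" if \<alpha>: "low S < \<alpha>'" "\<alpha>' < \<alpha>" for \<alpha>' \<alpha>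
  proof -
    obtain C where C: "\<forall>p\<in>X. \<forall>x\<in>E \<alpha>. nm \<alpha>' (f p x) \<le> C * nm \<alpha> x"
      using equi_bound[OF opfamD(3)[OF f] \<alpha>] by blast
    obtain D where D: "\<forall>p\<in>X. \<forall>x\<in>E \<alpha>. nm \<alpha>' (g p x) \<le> D * nm \<alpha> x"
      using equi_bound[OF opfamD(3)[OF g] \<alpha>] by blast
    have "nm \<alpha>' (f p x + g p x) \<le> (C + D) * nm \<alpha> x" if p: "p \<in> X" and x: "x \<in> E \<alpha>" for p x
    proof -
      have "nm \<alpha>' (f p x + g p x) \<le> nm \<alpha>' (f p x) + nm \<alpha>' (g p x)"
        by (rule nm_add[OF \<alpha>(1) ops_E[OF opfamD(1)[OF f p] \<alpha> x] ops_E[OF opfamD(1)[OF g p] \<alpha> x]])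
      also have "\<dots> \<le> C * nm \<alpha> x + D * nm \<alpha> x" using C D p x by (intro add_mono) blast+
      finally show ?thesis by (simp add: distrib_right)
    qed
    then show ?thesis by (intro exI[of _ "C + D"]) blast
  qed
  have "(\<lambda>x. f p x + g p x) \<in> bounded_op S \<alpha> \<alpha>'" if p: "p \<in> X" and \<alpha>: "low S < \<alpha>'" "\<alpha>' < \<alpha>" for p \<alpha>' \<alpha>
  proof -
    note F = opsD[OF opfamD(1)[OF f p] \<alpha>] and G = opsD[OF opfamD(1)[OF g p] \<alpha>]
    have "\<exists>C. \<forall>x\<in>E \<alpha>. nm \<alpha>' (f p x + g p x) \<le> C * nm \<alpha> x" using bound[OF \<alpha>] p by blast
    moreover have "f p (x + y) + g p (x + y) = f p x + g p x + (f p y + g p y)" if "x \<in> E \<alpha>" "y \<in> E \<alpha>" for x y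
      using op_add[OF F that] op_add[OF G that] by (simp add: algebra_simps)
    moreover have "f p (scl S c x) + g p (scl S c x) = scl S c (f p x + g p x)" if "x \<in> E \<alpha>" for x c
      using op_scl[OF F that] op_scl[OF G that] module.scale_right_distrib[OF module_scl] by metis
    ultimately show ?thesis
      using op_E[OF F] op_E[OF G] E_add[OF \<alpha>(1)] unfolding bounded_op_def by (simp add: image_subset_iff)
  qed
  moreover have "scont X (\<lambda>p x. f p x + g p x)"
    unfolding scont_def
    by (auto simp: em_add intro!: continuous_on_add scontD[OF opfamD(2)[OF f]] scontD[OF opfamD(2)[OF g]])
  ultimately show ?thesis using bound by (simp add: opfam_def ops_def equi_def)
qed

lemma opfam_sum: "(\<And>j. opfam X (f j)) \<Longrightarrow> opfam X (\<lambda>p x. \<Sum>j<(N::nat). f j p x)"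
  by (induction N) (simp_all add: opfam_zero opfam_add)

text \<open>The conditions (B1) and (B2), except for the continuity of \<open>M\<close>, for a family of single maps.\<close>
definition pert :: "(real \<Rightarrow> real) \<Rightarrow> (real \<Rightarrow> 'a \<Rightarrow> 'a) \<Rightarrow> bool" where
  "pert M b \<longleftrightarrow> mono_on {low S<..} M \<and> (\<forall>\<alpha>>low S. 0 \<le> M \<alpha>) \<and> (\<forall>T. opfam {0..T} b) \<and>
     (\<forall>\<alpha>' \<alpha> t k. low S < \<alpha>' \<longrightarrow> \<alpha>' < \<alpha> \<longrightarrow> 0 \<le> t \<longrightarrow> k \<in> E \<alpha> \<longrightarrow> nm \<alpha>' (b t k) \<le> M \<alpha> / (\<alpha> - \<alpha>') * nm \<alpha> k)"

lemma pertD: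
  "pert M b \<Longrightarrow> low S < \<alpha> \<Longrightarrow> \<alpha> \<le> \<beta> \<Longrightarrow> M \<alpha> \<le> M \<beta>" "pert M b \<Longrightarrow> low S < \<alpha> \<Longrightarrow> 0 \<le> M \<alpha>"
  "pert M b \<Longrightarrow> opfam {0..T} b"
  "pert M b \<Longrightarrow> low S < \<alpha>' \<Longrightarrow> \<alpha>' < \<alpha> \<Longrightarrow> 0 \<le> t \<Longrightarrow> k \<in> E \<alpha> \<Longrightarrow> nm \<alpha>' (b t k) \<le> M \<alpha> / (\<alpha> - \<alpha>') * nm \<alpha> k"
  unfolding pert_def mono_on_def by auto

text \<open>The terms of the Dyson series: \<open>w v b j\<close> contains \<open>j\<close> factors \<open>b\<close>.\<close>
primrec w :: "(real \<Rightarrow> real \<Rightarrow> 'a \<Rightarrow> 'a) \<Rightarrow> (real \<Rightarrow> 'a \<Rightarrow> 'a) \<Rightarrow> nat \<Rightarrow> real \<Rightarrow> real \<Rightarrow> 'a \<Rightarrow> 'a" where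
  "w v b 0 t s k = v t s k"
| "w v b (Suc j) t s k = integ s t (\<lambda>r. v t r (b r (w v b j r s k)))"

lemma opfam_tri3_outer:
  assumes "opfam (tri2 T) (\<lambda>(t, s). f t s)"
  shows "opfam (tri3 T) (\<lambda>(t, r, s). f t r)"
proof -
  have "opfam (tri3 T) (\<lambda>p. case (fst p, fst (snd p)) of (t, s) \<Rightarrow> f t s)"
    by (rule opfam_reindex[OF assms]) (auto simp: tri2_def tri3_def intro!: continuous_intros)
  then show ?thesis by (simp add: case_prod_unfold)
qed

lemma opfam_tri3_inner:
  assumes "opfam (tri2 T) (\<lambda>(t, s). f t s)"
  shows "opfam (tri3 T) (\<lambda>(t, r, s). f r s)"
proof -
  have "opfam (tri3 T) (\<lambda>p. case snd p of (t, s) \<Rightarrow> f t s)"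
    by (rule opfam_reindex[OF assms]) (auto simp: tri2_def tri3_def intro!: continuous_intros)
  then show ?thesis by (simp add: case_prod_unfold)
qed

lemma opfam_tri3_middle:
  assumes "opfam {0..T} f"
  shows "opfam (tri3 T) (\<lambda>(t, r, s). f r)"
proof -
  have "opfam (tri3 T) (\<lambda>p. f (fst (snd p)))"
    by (rule opfam_reindex[OF assms]) (auto simp: tri3_def intro!: continuous_intros)
  then show ?thesis by (simp add: case_prod_unfold)
qed

end

locale perturbation = bscale S
  for S :: "('k::real_normed_field, 'a::real_vector) scale" +
  fixes K :: real and M :: "real \<Rightarrow> real" and v :: "real \<Rightarrow> real \<Rightarrow> 'a \<Rightarrow> 'a" and b :: "real \<Rightarrow> 'a \<Rightarrow> 'a"
  assumes ev: "evol K v" and pb: "pert M b"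
begin

lemma K_ge_1: "1 \<le> K" by (rule evol_K[OF ev])

lemma opfam_w_integrand:
  assumes "opfam (tri2 T) (\<lambda>(t, s). w v b j t s)"
  shows "opfam (tri3 T) (\<lambda>(t, r, s) k. v t r (b r (w v b j r s k)))"
proof -
  have "opfam (tri3 T) (\<lambda>p k. (case p of (t, r, s) \<Rightarrow> v t r) ((case p of (t, r, s) \<Rightarrow> b r) ((case p of (t, r, s) \<Rightarrow> w v b j r s) k)))"
    by (rule opfam_compose[OF opfam_tri3_outer[OF evol_opfam[OF ev]]
          opfam_compose[OF opfam_tri3_middle[OF pertD(3)[OF pb]] opfam_tri3_inner[OF assms]]])
  then show ?thesis by (simp add: case_prod_unfold)
qed

lemma opfam_w: "opfam (tri2 T) (\<lambda>(t, s). w v b j t s)"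
proof (induction j)
  case 0
  show ?case using evol_opfam[OF ev] by simp
next
  case (Suc j)
  have "(\<lambda>(t, s) k. integ s t (\<lambda>r. (\<lambda>(t, r, s) k. v t r (b r (w v b j r s k))) (t, r, s) k)) = (\<lambda>(t, s). w v b (Suc j) t s)"
    by (auto simp: fun_eq_iff)
  with opfam_integral[OF opfam_w_integrand[OF Suc]] show ?case by simp
qed

lemma w_ops: "0 \<le> s \<Longrightarrow> s \<le> t \<Longrightarrow> w v b j t s \<in> ops"
  using opfamD(1)[OF opfam_w[of t j], of "(t, s)"] by (simp add: tri2_def)

lemma w_E: "0 \<le> s \<Longrightarrow> s \<le> t \<Longrightarrow> low S < \<alpha>' \<Longrightarrow> \<alpha>' < \<alpha> \<Longrightarrow> k \<in> E \<alpha> \<Longrightarrow> w v b j t s k \<in> E \<alpha>'"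
  by (rule ops_E[OF w_ops])

lemma w_Suc_left:
  assumes "0 \<le> s" "s \<le> t" "low S < \<alpha>'" "\<alpha>' < \<alpha>" "k \<in> E \<alpha>"
  shows "((\<lambda>r. em \<alpha>' (v t r (b r (w v b j r s k)))) has_integral em \<alpha>' (w v b (Suc j) t s k)) {s..t}"
  using opfam_has_integral[OF opfam_w_integrand[OF opfam_w[of t j]] _ assms(3,4,5), of t s] assms(1,2)
  by (simp add: tri2_def)

lemma b_ops: "0 \<le> r \<Longrightarrow> b r \<in> ops"
  using opfamD(1)[OF pertD(3)[OF pb, of r], of r] by simp

lemma vb_ops: "0 \<le> r \<Longrightarrow> r \<le> t \<Longrightarrow> (\<lambda>x. v t r (b r x)) \<in> ops"
  by (rule ops_compose[OF evol_ops[OF ev] b_ops])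

text \<open>Since \<open>v t r\<close> does not map a space into itself, it has to be given some room. The bound holds with
  \<open>\<alpha> - \<delta>\<close> for all \<open>\<delta>\<close> above \<open>\<alpha>'\<close>, and \<open>\<delta>\<close> can then tend to \<open>\<alpha>'\<close>.\<close>
lemma vb_bound:
  assumes \<alpha>: "low S < \<alpha>'" "\<alpha>' < \<alpha>" and x: "x \<in> E \<alpha>" and r: "0 \<le> r" "r \<le> t"
  shows "nm \<alpha>' (v t r (b r x)) \<le> K * M \<alpha> / (\<alpha> - \<alpha>') * nm \<alpha> x"
proof (rule tendsto_lowerbound)
  show "((\<lambda>\<delta>. K * M \<alpha> / (\<alpha> - \<delta>) * nm \<alpha> x) \<longlongrightarrow> K * M \<alpha> / (\<alpha> - \<alpha>') * nm \<alpha> x) (at_right \<alpha>')"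
    using \<alpha> by (intro tendsto_intros) auto
  have "nm \<alpha>' (v t r (b r x)) \<le> K * M \<alpha> / (\<alpha> - \<delta>) * nm \<alpha> x" if \<delta>: "\<alpha>' < \<delta>" "\<delta> < \<alpha>" for \<delta>
  proof -
    have l: "low S < \<delta>" using \<alpha> \<delta> by simp
    have "nm \<alpha>' (v t r (b r x)) \<le> K * nm \<delta> (b r x)"
      by (rule evol_bound[OF ev \<alpha>(1) \<delta>(1) r ops_E[OF b_ops[OF r(1)] l \<delta>(2) x]])
    also have "\<dots> \<le> K * (M \<alpha> / (\<alpha> - \<delta>) * nm \<alpha> x)"
      using K_ge_1 by (intro mult_left_mono pertD(4)[OF pb l \<delta>(2) r(1) x]) auto
    finally show ?thesis by simp
  qed
  then show "\<forall>\<^sub>F \<delta> in at_right \<alpha>'. nm \<alpha>' (v t r (b r x)) \<le> K * M \<alpha> / (\<alpha> - \<delta>) * nm \<alpha> x"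
    unfolding eventually_at_right[OF \<alpha>(2)] using \<alpha>(2) by blast
qed simp

text \<open>Ovsyannikov's estimate. Each step of the recursion integrates a power of time, which produces \<open>1 / j!\<close>,
  and crosses one gap, which has to be chosen. It is stated for an arbitrary sequence and an arbitrary initial time \<open>r0\<close>,
  because it serves both the terms of the series and, with a constant sequence, the proof of uniqueness.\<close>
lemma ovsyannikov:
  assumes \<alpha>: "low S < \<alpha>'" and r0: "0 \<le> r0" and C: "0 \<le> C"
    and yE: "\<And>j r \<beta>. r \<in> {r0..c} \<Longrightarrow> \<alpha>' \<le> \<beta> \<Longrightarrow> \<beta> < \<alpha> \<Longrightarrow> y j r \<in> E \<beta>"
    and y0: "\<And>r \<beta>. r \<in> {r0..c} \<Longrightarrow> \<alpha>' \<le> \<beta> \<Longrightarrow> \<beta> < \<alpha> \<Longrightarrow> nm \<beta> (y 0 r) \<le> C"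
    and ySuc: "\<And>j r \<beta>. r \<in> {r0..c} \<Longrightarrow> \<alpha>' \<le> \<beta> \<Longrightarrow> \<beta> < \<alpha> \<Longrightarrow>
      ((\<lambda>u. em \<beta> (v r u (b u (y j u)))) has_integral em \<beta> (y (Suc j) r)) {r0..r}"
    and r: "r \<in> {r0..c}" and \<beta>: "\<alpha>' \<le> \<beta>" "\<beta> < \<alpha>"
  shows "nm \<beta> (y j r) \<le> C * ((K * M \<alpha> * (r - r0)) ^ j / fact j * (real (j + 1) / (\<alpha> - \<beta>)) ^ j)"
  using r \<beta>
proof (induction j arbitrary: r \<beta>)
  case 0
  then show ?case using y0 by simp
next
  case (Suc j)
  define L where "L = K * M \<alpha>"
  define q where "q = real (j + 2) / (\<alpha> - \<beta>)"
  (* one of j + 2 equal gaps is left to the new factor; the other j + 1 go to the induction hypothesis *)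
  define \<gamma> where "\<gamma> = \<beta> + (\<alpha> - \<beta>) / real (j + 2)"
  have M: "0 \<le> M \<alpha>" using Suc.prems \<alpha> by (intro pertD(2)[OF pb]) auto
  have L: "0 \<le> L" using K_ge_1 M by (simp add: L_def)
  have q: "0 \<le> q" using Suc.prems by (simp add: q_def)
  have \<gamma>: "\<beta> < \<gamma>" "\<gamma> < \<alpha>"
  proof -
    show "\<beta> < \<gamma>" using Suc.prems by (simp add: \<gamma>_def)
    have "(\<alpha> - \<beta>) / real (j + 2) < (\<alpha> - \<beta>) / 1" using Suc.prems by (intro divide_strict_left_mono) auto
    then show "\<gamma> < \<alpha>" by (simp add: \<gamma>_def)
  qed
  have gap1: "1 / (\<gamma> - \<beta>) = q" by (simp add: \<gamma>_def q_def)
  have gap2: "real (j + 1) / (\<alpha> - \<gamma>) = q"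
  proof -
    have "\<alpha> - \<gamma> = (\<alpha> - \<beta>) * real (j + 1) / real (j + 2)"
      by (simp add: \<gamma>_def field_simps)
    then show ?thesis using Suc.prems by (simp add: q_def)
  qed
  have low: "low S < \<beta>" "low S < \<gamma>" using \<alpha> Suc.prems \<gamma> by auto
  define D where "D = C * L ^ Suc j * q ^ Suc j / fact j"
  have est: "norm (em \<beta> (v r u (b u (y j u)))) \<le> D * (u - r0) ^ j" if u: "u \<in> {r0..r}" for u
  proof -
    have u': "u \<in> {r0..c}" "0 \<le> u" "u \<le> r" using u Suc.prems r0 by auto
    have yu: "y j u \<in> E \<gamma>" using yE[OF u'(1)] \<gamma> Suc.prems by simp
    have "norm (em \<beta> (v r u (b u (y j u)))) = nm \<beta> (v r u (b u (y j u)))"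
      using ops_E[OF vb_ops[OF u'(2,3)] low(1) \<gamma>(1) yu] low by (simp add: norm_em)
    also have "\<dots> \<le> K * M \<gamma> / (\<gamma> - \<beta>) * nm \<gamma> (y j u)"
      by (rule vb_bound[OF low(1) \<gamma>(1) yu u'(2,3)])
    also have "\<dots> \<le> (L * q) * nm \<gamma> (y j u)"
    proof (intro mult_right_mono nm_nonneg low yu)
      have "K * M \<gamma> / (\<gamma> - \<beta>) = K * M \<gamma> * (1 / (\<gamma> - \<beta>))" by simp
      also have "\<dots> \<le> L * q"
        unfolding gap1 L_def using K_ge_1 pertD(1)[OF pb low(2), of \<alpha>] \<gamma> q by (intro mult_right_mono mult_left_mono) auto
      finally show "K * M \<gamma> / (\<gamma> - \<beta>) \<le> L * q" .
    qed
    also have "\<dots> \<le> (L * q) * (C * ((L * (u - r0)) ^ j / fact j * q ^ j))"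
      using Suc.IH[OF u'(1), of \<gamma>] \<gamma> Suc.prems L q unfolding gap2 L_def[symmetric]
      by (intro mult_left_mono) auto
    also have "\<dots> = D * (u - r0) ^ j" by (simp add: D_def power_mult_distrib)
    finally show ?thesis .
  qed
  have r0r: "r0 \<le> r" using Suc.prems by simp
  note int = ySuc[OF Suc.prems, of j] and pow = has_integral_mult_right[OF has_integral_power_diff[OF r0r, of j], of D]
  have "norm (integral {r0..r} (\<lambda>u. em \<beta> (v r u (b u (y j u))))) \<le> integral {r0..r} (\<lambda>u. D * (u - r0) ^ j)"
    using est by (intro integral_norm_bound_integral has_integral_integrable[OF int] has_integral_integrable[OF pow])
  then have "nm \<beta> (y (Suc j) r) \<le> D * ((r - r0) ^ Suc j / real (Suc j))"
    using integral_unique[OF int] integral_unique[OF pow] norm_em[OF low(1) yE[OF Suc.prems]] by simp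
  also have "\<dots> = C * ((L * (r - r0)) ^ Suc j / fact (Suc j) * q ^ Suc j)"
    by (simp add: D_def power_mult_distrib mult_ac)
  finally show ?case by (simp add: L_def q_def)
qed

text \<open>The reciprocal of \<open>T(\<alpha>',\<alpha>)\<close>, which is finite also if \<open>M \<alpha> = 0\<close>.\<close>
definition rate :: "real \<Rightarrow> real \<Rightarrow> real" where
  "rate \<alpha>' \<alpha> = 2 * K * exp 1 * M \<alpha> / (\<alpha> - \<alpha>')"

lemma rate_nonneg: "low S < \<alpha>' \<Longrightarrow> \<alpha>' < \<alpha> \<Longrightarrow> 0 \<le> rate \<alpha>' \<alpha>"
  using K_ge_1 pertD(2)[OF pb, of \<alpha>] by (simp add: rate_def)

lemma ovsyannikov_rate:
  assumes "low S < \<alpha>'" "\<alpha>' < \<alpha>" "0 \<le> C" "0 \<le> \<tau>"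
  shows "C * ((K * M \<alpha> * \<tau>) ^ j / fact j * (real (j + 1) / (\<alpha> - \<alpha>')) ^ j) \<le> C * (rate \<alpha>' \<alpha> * \<tau>) ^ j"
proof -
  have M: "0 \<le> M \<alpha>" using assms by (intro pertD(2)[OF pb]) auto
  have "(K * M \<alpha> * \<tau>) ^ j / fact j * (real (j + 1) / (\<alpha> - \<alpha>')) ^ j
      = (K * M \<alpha> * \<tau> / (\<alpha> - \<alpha>')) ^ j * (real (j + 1) ^ j / fact j)"
    by (simp add: power_mult_distrib power_divide)
  also have "\<dots> \<le> (K * M \<alpha> * \<tau> / (\<alpha> - \<alpha>')) ^ j * (2 * exp 1) ^ j"
    using K_ge_1 M assms by (intro mult_left_mono Suc_power_div_fact_le zero_le_power) auto
  also have "\<dots> = (rate \<alpha>' \<alpha> * \<tau>) ^ j"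
    unfolding power_mult_distrib[symmetric] by (simp add: rate_def mult_ac)
  finally show ?thesis using assms by (intro mult_left_mono) auto
qed

lemma w_bound:
  assumes \<alpha>: "low S < \<alpha>'" "\<alpha>' < \<alpha>" and k: "k \<in> E \<alpha>" and st: "0 \<le> s" "s \<le> t"
  shows "nm \<alpha>' (w v b j t s k) \<le> K * nm \<alpha> k * (rate \<alpha>' \<alpha> * (t - s)) ^ j"
proof -
  have C: "0 \<le> K * nm \<alpha> k" using K_ge_1 \<alpha> k by (auto intro!: mult_nonneg_nonneg nm_nonneg)
  have "nm \<alpha>' (w v b j t s k)
      \<le> K * nm \<alpha> k * ((K * M \<alpha> * (t - s)) ^ j / fact j * (real (j + 1) / (\<alpha> - \<alpha>')) ^ j)"
  proof (rule ovsyannikov[where y="\<lambda>j r. w v b j r s k" and c=t, OF \<alpha>(1) st(1) C])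
    fix j r \<beta> assume r: "r \<in> {s..t}" and \<beta>: "\<alpha>' \<le> \<beta>" "\<beta> < \<alpha>"
    have l: "low S < \<beta>" and r': "s \<le> r" using \<alpha> \<beta> r by auto
    show "w v b j r s k \<in> E \<beta>" by (rule w_E[OF st(1) r' l \<beta>(2) k])
    show "nm \<beta> (w v b 0 r s k) \<le> K * nm \<alpha> k"
      using evol_bound[OF ev l \<beta>(2) st(1) r' k] by simp
    show "((\<lambda>u. em \<beta> (v r u (b u (w v b j u s k)))) has_integral em \<beta> (w v b (Suc j) r s k)) {s..r}"
      by (rule w_Suc_left[OF st(1) r' l \<beta>(2) k])
  qed (use st \<alpha> in auto)
  also have "\<dots> \<le> K * nm \<alpha> k * (rate \<alpha>' \<alpha> * (t - s)) ^ j"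
    using st by (intro ovsyannikov_rate[OF \<alpha> C]) auto
  finally show ?thesis .
qed

text \<open>The mirrored recursion. Inserting the induction hypothesis into the recursion gives an integral over
  \<open>s \<le> u \<le> r \<le> t\<close>, with the integration over \<open>u\<close> inside; with the one over \<open>r\<close> inside, it is the integral
  that defines \<open>w v b (Suc j) t u\<close>.\<close>
lemma w_Suc_right:
  assumes "0 \<le> s" "s \<le> t" "low S < \<alpha>'" "\<alpha>' < \<alpha>" "k \<in> E \<alpha>"
  shows "((\<lambda>u. em \<alpha>' (w v b j t u (b u (v u s k)))) has_integral em \<alpha>' (w v b (Suc j) t s k)) {s..t}"
  using assms
proof (induction j arbitrary: t \<alpha>')
  case 0
  then show ?case using w_Suc_left[OF 0, of 0] by simp
next
  case (Suc j)
  note st = Suc.prems(1,2) and \<alpha> = Suc.prems(3,4) and k = Suc.prems(5)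
  obtain \<beta> where \<beta>: "\<alpha>' < \<beta>" "\<beta> < \<alpha>" "low S < \<beta>" using dense[OF \<alpha>(2)] \<alpha> by force
  define y where "y u = b u (v u s k)" for u
  have bs: "opfam {s..t} b" by (rule opfam_subset[OF pertD(3)[OF pb, of t]]) (use st in auto)
  have y_opfam: "opfam {s..t} (\<lambda>u x. b u (v u s x))"
    by (rule opfam_compose[OF bs evol_opfam_fst[OF ev st(1)]])
  have yE: "y u \<in> E \<delta>" if "u \<in> {s..t}" "low S < \<delta>" "\<delta> < \<alpha>" for u \<delta>
    unfolding y_def by (rule ops_E[OF opfamD(1)[OF y_opfam that(1)] that(2,3) k])
  let ?X = "{(r, u). s \<le> u \<and> u \<le> r \<and> r \<le> t}"
  have X2: "(\<lambda>p. p) ` ?X \<subseteq> tri2 t" using st by (auto simp: tri2_def)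
  have g1: "opfam ?X (\<lambda>p. v t (fst p))"
    by (rule opfam_reindex[OF evol_opfam_snd[OF ev st(1)]]) (auto intro!: continuous_intros)
  have g2: "opfam ?X (\<lambda>p. b (fst p))"
    by (rule opfam_reindex[OF bs]) (auto intro!: continuous_intros)
  have g3: "opfam ?X (\<lambda>p. w v b j (fst p) (snd p))"
    using opfam_subset[OF opfam_w[of t j], of ?X] X2 by (simp add: case_prod_unfold)
  have g4: "opfam ?X (\<lambda>p x. b (snd p) (v (snd p) s x))"
    by (rule opfam_reindex[OF y_opfam]) (auto intro!: continuous_intros)
  note g = opfam_compose[OF g1 opfam_compose[OF g2 opfam_compose[OF g3 g4]]]
  from scontD[OF opfamD(2)[OF g] \<alpha> k]
  have cont: "continuous_on ?X (\<lambda>(r, u). em \<alpha>' (v t r (b r (w v b j r u (y u)))))"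
    by (simp add: case_prod_unfold y_def)
  have inner_left: "em \<alpha>' (v t r (b r (w v b (Suc j) r s k))) = integral {s..r} (\<lambda>u. em \<alpha>' (v t r (b r (w v b j r u (y u)))))"
    if r: "r \<in> {s..t}" for r
  proof -
    have r': "s \<le> r" "0 \<le> r" "r \<le> t" using r st by auto
    obtain \<gamma> where \<gamma>: "\<beta> < \<gamma>" "\<gamma> < \<alpha>" using dense[OF \<beta>(2)] by blast
    have "((\<lambda>u. em \<alpha>' (v t r (b r (w v b j r u (y u))))) has_integral em \<alpha>' (v t r (b r (w v b (Suc j) r s k)))) {s..r}"
    proof (rule has_integral_op[OF \<beta>(3) \<alpha>(1) opsD[OF vb_ops[OF r'(2,3)] \<alpha>(1) \<beta>(1)]])
      show "((\<lambda>u. em \<beta> (w v b j r u (y u))) has_integral em \<beta> (w v b (Suc j) r s k)) {s..r}"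
        unfolding y_def by (rule Suc.IH[OF st(1) r'(1) \<beta>(3,2) k])
      show "w v b j r u (y u) \<in> E \<beta>" if "u \<in> {s..r}" for u
        using w_E[OF _ _ \<beta>(3) \<gamma>(1) yE[OF _ _ \<gamma>(2)]] that st r \<beta> \<gamma> by auto
      show "w v b (Suc j) r s k \<in> E \<beta>" by (rule w_E[OF st(1) r'(1) \<beta>(3,2) k])
    qed
    then show ?thesis by (simp add: integral_unique)
  qed
  have inner_right: "em \<alpha>' (w v b (Suc j) t u (y u)) = integral {u..t} (\<lambda>r. em \<alpha>' (v t r (b r (w v b j r u (y u)))))"
    if u: "u \<in> {s..t}" for u
    using w_Suc_left[OF _ _ \<alpha>(1) \<beta>(1) yE[OF u \<beta>(3,2)], of u t j] u st
    by (simp add: integral_unique)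
  have "integral {s..t} (\<lambda>u. em \<alpha>' (w v b (Suc j) t u (y u)))
      = integral {s..t} (\<lambda>u. integral {u..t} (\<lambda>r. em \<alpha>' (v t r (b r (w v b j r u (y u))))))"
    by (rule integral_cong) (rule inner_right)
  also have "\<dots> = integral {s..t} (\<lambda>r. integral {s..r} (\<lambda>u. em \<alpha>' (v t r (b r (w v b j r u (y u))))))"
    by (rule integral_triangle_swap[OF st(2) cont, symmetric])
  also have "\<dots> = integral {s..t} (\<lambda>r. em \<alpha>' (v t r (b r (w v b (Suc j) r s k))))"
    by (rule integral_cong) (simp only: inner_left)
  also have "\<dots> = em \<alpha>' (w v b (Suc (Suc j)) t s k)"
    by (rule integral_unique[OF w_Suc_left[OF st \<alpha> k]])
  finally have eq: "integral {s..t} (\<lambda>u. em \<alpha>' (w v b (Suc j) t u (y u))) = em \<alpha>' (w v b (Suc (Suc j)) t s k)" .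
  have wg: "opfam {s..t} (\<lambda>u. w v b (Suc j) t u)"
    by (rule opfam_reindex[OF opfam_w[of t "Suc j"], of "{s..t}" "\<lambda>u. (t, u)", unfolded prod.case])
      (use st in \<open>auto simp: tri2_def intro!: continuous_intros\<close>)
  have "continuous_on {s..t} (\<lambda>u. em \<alpha>' (w v b (Suc j) t u (y u)))"
    unfolding y_def by (rule scontD[OF opfamD(2)[OF opfam_compose[OF wg y_opfam]] \<alpha> k])
  then show ?case
    using integrable_integral[OF integrable_continuous_real] eq unfolding y_def by metis
qed

end

lemma continuous_on_exhaust:
  fixes f :: "'p::t2_space \<Rightarrow> 'b::topological_space"
  assumes "\<And>p. p \<in> X \<Longrightarrow> \<exists>U. open U \<and> p \<in> U \<and> continuous_on (X \<inter> U) f"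
  shows "continuous_on X f"
  unfolding continuous_on_eq_continuous_within
proof
  fix p assume p: "p \<in> X"
  then obtain U where U: "open U" "p \<in> U" "continuous_on (X \<inter> U) f" using assms by blast
  then have "continuous (at p within X \<inter> U) f"
    using p by (simp add: continuous_on_eq_continuous_within)
  moreover have "at p within X \<inter> U = at p within X"
    by (rule at_within_nhd[OF U(2,1)]) auto
  ultimately show "continuous (at p within X) f" by (simp add: continuous_within)
qed

section \<open>The sum of the perturbation series\<close>

lemma uniform_limit_geometric:
  fixes f :: "nat \<Rightarrow> 'y \<Rightarrow> 'b::metric_space"
  assumes \<rho>: "0 \<le> \<rho>" "\<rho> < 1" and f: "\<And>N y. y \<in> Y \<Longrightarrow> dist (f N y) (g y) \<le> c * \<rho> ^ N"
  shows "uniform_limit Y f g sequentially"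
proof (rule uniform_limitI)
  fix e :: real assume e: "e > 0"
  have "(\<lambda>N. c * \<rho> ^ N) \<longlonglongrightarrow> c * 0"
    by (intro tendsto_mult tendsto_const LIMSEQ_power_zero) (use \<rho> in simp)
  then have "\<forall>\<^sub>F N in sequentially. c * \<rho> ^ N < e" using e by (simp add: order_tendstoD(2))
  then show "\<forall>\<^sub>F N in sequentially. \<forall>y\<in>Y. dist (f N y) (g y) < e"
    by eventually_elim (use f le_less_trans in blast)
qed

context bscale
begin

definition psum :: "(real \<Rightarrow> real \<Rightarrow> 'a \<Rightarrow> 'a) \<Rightarrow> (real \<Rightarrow> 'a \<Rightarrow> 'a) \<Rightarrow> nat \<Rightarrow> real \<Rightarrow> real \<Rightarrow> 'a \<Rightarrow> 'a" where
  "psum v b N t s k = (\<Sum>j<N. w v b j t s k)"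

definition series :: "(real \<Rightarrow> real \<Rightarrow> 'a \<Rightarrow> 'a) \<Rightarrow> (real \<Rightarrow> 'a \<Rightarrow> 'a) \<Rightarrow> real \<Rightarrow> real \<Rightarrow> 'a \<Rightarrow> 'a" where
  "series v b t s k = slim (\<lambda>N. psum v b N t s k)"

end

context perturbation
begin

abbreviation P :: "nat \<Rightarrow> real \<Rightarrow> real \<Rightarrow> 'a \<Rightarrow> 'a" where "P \<equiv> psum v b"
abbreviation W :: "real \<Rightarrow> real \<Rightarrow> 'a \<Rightarrow> 'a" where "W \<equiv> series v b"

lemma opfam_psum: "opfam (tri2 T) (\<lambda>(t, s). P N t s)"
proof -
  have "opfam (tri2 T) (\<lambda>p x. \<Sum>j<N. (case p of (t, s) \<Rightarrow> w v b j t s) x)" by (rule opfam_sum[OF opfam_w])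
  then show ?thesis by (simp add: case_prod_unfold psum_def[abs_def])
qed

lemma psum_ops: "0 \<le> s \<Longrightarrow> s \<le> t \<Longrightarrow> P N t s \<in> ops"
  using opfamD(1)[OF opfam_psum[of t N], of "(t, s)"] by (simp add: tri2_def)

lemma psum_E: "0 \<le> s \<Longrightarrow> s \<le> t \<Longrightarrow> low S < \<alpha>' \<Longrightarrow> \<alpha>' < \<alpha> \<Longrightarrow> k \<in> E \<alpha> \<Longrightarrow> P N t s k \<in> E \<alpha>'"
  by (rule ops_E[OF psum_ops])

text \<open>The bound \<open>\<rho>\<close> on \<open>rate \<alpha>' \<alpha> * (t - s)\<close> is kept separate from that number, so that the estimates are uniform
  on sets of times.\<close>
lemma series_convergence:
  assumes st: "0 \<le> s" "s \<le> t" and \<alpha>: "low S < \<alpha>'" "\<alpha>' < \<alpha>" and k: "k \<in> E \<alpha>"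
    and \<rho>: "rate \<alpha>' \<alpha> * (t - s) \<le> \<rho>" "\<rho> < 1"
  shows series_E: "W t s k \<in> E \<alpha>'"
    and psum_tendsto: "(\<lambda>N. em \<alpha>' (P N t s k)) \<longlonglongrightarrow> em \<alpha>' (W t s k)"
    and psum_tail: "nm \<alpha>' (P N t s k - W t s k) \<le> K * nm \<alpha> k / (1 - \<rho>) * \<rho> ^ N"
    and psum_bound: "nm \<alpha>' (P N t s k) \<le> K / (1 - \<rho>) * nm \<alpha> k"
proof -
  define f where "f j = em \<alpha>' (w v b j t s k)" for j
  define c where "c = K * nm \<alpha> k"
  have \<rho>0: "0 \<le> \<rho>" using rate_nonneg[OF \<alpha>] st \<rho> by (meson diff_ge_0_iff_ge mult_nonneg_nonneg order_trans)
  have c: "0 \<le> c" using K_ge_1 \<alpha> k by (auto simp: c_def intro!: mult_nonneg_nonneg nm_nonneg)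
  have f: "norm (f j) \<le> c * \<rho> ^ j" for j
  proof -
    have "norm (f j) = nm \<alpha>' (w v b j t s k)"
      using w_E[OF st \<alpha> k] \<alpha> by (simp add: f_def norm_em)
    also have "\<dots> \<le> c * (rate \<alpha>' \<alpha> * (t - s)) ^ j"
      unfolding c_def by (rule w_bound[OF \<alpha> k st])
    also have "\<dots> \<le> c * \<rho> ^ j"
      using rate_nonneg[OF \<alpha>] st \<rho> c by (intro mult_left_mono power_mono) auto
    finally show ?thesis .
  qed
  have geo: "summable (\<lambda>j. c * \<rho> ^ (j + N))" "(\<Sum>j. c * \<rho> ^ (j + N)) = c / (1 - \<rho>) * \<rho> ^ N" for N
  proof -
    have "(\<lambda>j. (c * \<rho> ^ N) * \<rho> ^ j) sums ((c * \<rho> ^ N) * (1 / (1 - \<rho>)))"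
      by (intro sums_mult geometric_sums) (use \<rho>0 \<rho> in simp)
    then have "(\<lambda>j. c * \<rho> ^ (j + N)) sums (c / (1 - \<rho>) * \<rho> ^ N)"
      by (simp add: power_add mult_ac)
    then show "summable (\<lambda>j. c * \<rho> ^ (j + N))" "(\<Sum>j. c * \<rho> ^ (j + N)) = c / (1 - \<rho>) * \<rho> ^ N"
      by (auto simp: sums_iff)
  qed
  have sf: "summable f"
    by (rule summable_comparison_test'[where N=0 and g="\<lambda>j. c * \<rho> ^ j"]) (use f geo(1)[of 0] in auto)
  have Pf: "em \<alpha>' (P N t s k) = (\<Sum>j<N. f j)" for N
    by (simp add: psum_def f_def em_sum \<alpha>)
  have conv: "(\<lambda>N. em \<alpha>' (P N t s k)) \<longlonglongrightarrow> suminf f"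
    unfolding Pf by (rule summable_LIMSEQ[OF sf])
  note PE = psum_E[OF st \<alpha> k]
  note sl = slim_Cauchy[OF \<alpha>(1) PE LIMSEQ_imp_Cauchy[OF conv], folded series_def]
  show WE: "W t s k \<in> E \<alpha>'" by (rule sl(1))
  show lim: "(\<lambda>N. em \<alpha>' (P N t s k)) \<longlonglongrightarrow> em \<alpha>' (W t s k)" by (rule sl(2))
  have Wf: "em \<alpha>' (W t s k) = suminf f" by (rule LIMSEQ_unique[OF lim conv])
  show "nm \<alpha>' (P N t s k - W t s k) \<le> K * nm \<alpha> k / (1 - \<rho>) * \<rho> ^ N"
  proof -
    have "nm \<alpha>' (P N t s k - W t s k) = norm (suminf f - (\<Sum>j<N. f j))"
      using norm_em_diff[OF \<alpha>(1) PE WE, of N] by (simp add: Pf Wf norm_minus_commute)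
    also have "suminf f - (\<Sum>j<N. f j) = (\<Sum>j. f (j + N))"
      using suminf_split_initial_segment[OF sf, of N] by simp
    also have "norm \<dots> \<le> (\<Sum>j. c * \<rho> ^ (j + N))"
      by (rule norm_suminf_le[OF _ geo(1)]) (rule f)
    also have "\<dots> = c / (1 - \<rho>) * \<rho> ^ N" by (rule geo(2))
    finally show ?thesis unfolding c_def .
  qed
  show "nm \<alpha>' (P N t s k) \<le> K / (1 - \<rho>) * nm \<alpha> k"
  proof -
    have "nm \<alpha>' (P N t s k) = norm (\<Sum>j<N. f j)" using PE \<alpha> by (simp add: Pf[symmetric] norm_em)
    also have "\<dots> \<le> (\<Sum>j<N. c * \<rho> ^ j)" by (rule sum_norm_le) (rule f)
    also have "\<dots> \<le> (\<Sum>j. c * \<rho> ^ j)"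
      by (rule sum_le_suminf) (use geo(1)[of 0] c \<rho>0 in auto)
    finally show ?thesis using geo(2)[of 0] by (simp add: c_def)
  qed
qed

lemma rate_mono:
  assumes "low S < \<alpha>'" "\<alpha>' \<le> \<beta>" "\<beta> < \<alpha>" "s \<le> t"
  shows "rate \<alpha>' \<alpha> * (t - s) \<le> rate \<beta> \<alpha> * (t - s)"
  using assms K_ge_1 pertD(2)[OF pb, of \<alpha>] unfolding rate_def
  by (intro mult_right_mono divide_left_mono) auto

lemma rate_time_mono:
  assumes "low S < \<alpha>'" "\<alpha>' < \<alpha>" "s \<le> s'" "t' \<le> t"
  shows "rate \<alpha>' \<alpha> * (t' - s') \<le> rate \<alpha>' \<alpha> * (t - s)"
  using assms rate_nonneg[of \<alpha>' \<alpha>] by (intro mult_left_mono) auto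

text \<open>For \<open>s = t\<close> the bound \<open>\<rho> = 0\<close> is admissible, so the first partial sum already is the sum.\<close>
lemma series_refl:
  assumes "low S < \<alpha>" "k \<in> E \<alpha>" "0 \<le> t"
  shows "W t t k = k"
proof -
  obtain \<alpha>' where \<alpha>: "low S < \<alpha>'" "\<alpha>' < \<alpha>" using dense[OF assms(1)] by blast
  note * = series_convergence[OF assms(3) order_refl \<alpha> assms(2), of 0]
  have "nm \<alpha>' (P 1 t t k - W t t k) \<le> 0" using *(3)[of 1] by simp
  moreover have PE: "P 1 t t k \<in> E \<alpha>'" by (rule psum_E[OF assms(3) order_refl \<alpha> assms(2)])
  moreover have "P 1 t t k = k" using evol_refl[OF ev assms] by (simp add: psum_def)
  moreover have WE: "W t t k \<in> E \<alpha>'" using *(1) by simp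
  ultimately show ?thesis
    using nm_eq_0[OF \<alpha>(1) E_diff[OF \<alpha>(1) PE WE]] nm_nonneg[OF \<alpha>(1) E_diff[OF \<alpha>(1) PE WE]] by simp
qed

lemma series_op:
  assumes st: "0 \<le> s" "s \<le> t" and \<alpha>: "low S < \<alpha>'" "\<alpha>' < \<alpha>" and \<rho>: "rate \<alpha>' \<alpha> * (t - s) < 1"
  shows "W t s \<in> bounded_op S \<alpha> \<alpha>'" "\<And>k. k \<in> E \<alpha> \<Longrightarrow> nm \<alpha>' (W t s k) \<le> K / (1 - rate \<alpha>' \<alpha> * (t - s)) * nm \<alpha> k"
  by (rule bounded_op_limit[OF \<alpha>(1) less_trans[OF \<alpha>] opsD[OF psum_ops[OF st] \<alpha>]
        series_convergence(1,2,4)[OF st \<alpha> _ order_refl \<rho>]]; assumption)+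

lemma series_continuous:
  assumes \<alpha>: "low S < \<alpha>'" "\<alpha>' < \<alpha>" and k: "k \<in> E \<alpha>"
  shows "continuous_on {(t, s). 0 \<le> s \<and> s \<le> t \<and> rate \<alpha>' \<alpha> * (t - s) < 1} (\<lambda>(t, s). em \<alpha>' (W t s k))"
    (is "continuous_on ?X ?f")
proof (rule continuous_on_exhaust)
  fix p assume p: "p \<in> ?X"
  obtain t s where ts: "p = (t, s)" by (cases p)
  with p have "rate \<alpha>' \<alpha> * (t - s) < 1" by simp
  then obtain \<rho> where \<rho>: "rate \<alpha>' \<alpha> * (t - s) < \<rho>" "\<rho> < 1" using dense by blast
  have \<rho>0: "0 \<le> \<rho>"
    using \<rho> p ts mult_nonneg_nonneg[OF rate_nonneg[OF \<alpha>], of "t - s"] by simp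
  define U where "U = {q. rate \<alpha>' \<alpha> * (fst q - snd q) < \<rho> \<and> fst q < t + 1}"
  have U: "open U" "p \<in> U"
    unfolding U_def using \<rho> ts by (auto intro!: open_Collect_conj open_Collect_less continuous_intros)
  have sub: "?X \<inter> U \<subseteq> tri2 (t + 1)" by (auto simp: tri2_def U_def)
  have "uniform_limit (?X \<inter> U) (\<lambda>N q. em \<alpha>' ((case q of (t, s) \<Rightarrow> P N t s) k)) ?f sequentially"
  proof (rule uniform_limit_geometric[OF \<rho>0 \<rho>(2)])
    fix N q assume "q \<in> ?X \<inter> U"
    then obtain t' s' where q: "q = (t', s')" "0 \<le> s'" "s' \<le> t'" "rate \<alpha>' \<alpha> * (t' - s') \<le> \<rho>"
      by (auto simp: U_def)
    note * = series_convergence[OF q(2,3) \<alpha> k q(4) \<rho>(2)]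
    show "dist (em \<alpha>' ((case q of (t, s) \<Rightarrow> P N t s) k)) (?f q) \<le> K * nm \<alpha> k / (1 - \<rho>) * \<rho> ^ N"
      using *(3)[of N] dist_em[OF \<alpha>(1) psum_E[OF q(2,3) \<alpha> k] *(1)] by (simp add: q(1))
  qed
  then have "continuous_on (?X \<inter> U) ?f"
    by (rule uniform_limit_theorem[rotated])
      (use continuous_on_subset[OF scontD[OF opfamD(2)[OF opfam_psum] \<alpha> k] sub] in auto)
  with U show "\<exists>U. open U \<and> p \<in> U \<and> continuous_on (?X \<inter> U) ?f" by blast
qed

text \<open>By the recursion, the integral equation holds if \<open>W\<close> is replaced by the \<open>N\<close>-th partial sum under the
  integral and by the next partial sum on the other side.
  The partial sums converge in \<open>E \<alpha>''\<close> uniformly in the time \<open>r\<close>, so the limit can be taken under the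
  integral.\<close>
lemma series_left:
  assumes st: "0 \<le> s" "s \<le> t" and \<alpha>: "low S < \<alpha>'" "\<alpha>' < \<alpha>''" "\<alpha>'' < \<alpha>" and k: "k \<in> E \<alpha>"
    and \<rho>: "rate \<alpha>'' \<alpha> * (t - s) < 1"
  shows "((\<lambda>r. em \<alpha>' (v t r (b r (W r s k)))) has_integral em \<alpha>' (W t s k - v t s k)) {s..t}"
proof -
  define q where "q = rate \<alpha>'' \<alpha> * (t - s)"
  have l: "low S < \<alpha>''" "\<alpha>' < \<alpha>" using \<alpha> by auto
  have q: "0 \<le> q" "q < 1" using rate_nonneg[OF l(1) \<alpha>(3)] st \<rho> by (auto simp: q_def)
  have qr: "rate \<alpha>'' \<alpha> * (r - s) \<le> q" if "r \<in> {s..t}" for r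
    unfolding q_def using that by (intro rate_time_mono l \<alpha>) auto
  define c where "c = K * M \<alpha>'' / (\<alpha>'' - \<alpha>')"
  have c: "0 \<le> c" using K_ge_1 \<alpha> pertD(2)[OF pb l(1)] by (simp add: c_def)
  have vb: "(\<lambda>x. v t r (b r x)) \<in> bounded_op S \<alpha>'' \<alpha>'" if "r \<in> {s..t}" for r
    using that st by (intro opsD[OF vb_ops] \<alpha>) auto
  have lim: "uniform_limit {s..t} (\<lambda>N r. em \<alpha>' (v t r (b r (P N r s k)))) (\<lambda>r. em \<alpha>' (v t r (b r (W r s k)))) sequentially"
  proof (rule uniform_limit_geometric[OF q])
    fix N r assume r: "r \<in> {s..t}"
    then have r': "0 \<le> r" "s \<le> r" "r \<le> t" using st by auto
    note * = series_convergence[OF st(1) r'(2) l(1) \<alpha>(3) k qr[OF r] q(2)]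
    note PE = psum_E[OF st(1) r'(2) l(1) \<alpha>(3) k, of N]
    have "dist (em \<alpha>' (v t r (b r (P N r s k)))) (em \<alpha>' (v t r (b r (W r s k)))) = nm \<alpha>' (v t r (b r (P N r s k - W r s k)))"
      using op_E[OF vb[OF r]] PE *(1) \<alpha> op_diff[OF vb[OF r] l(1) PE *(1)] by (simp add: dist_em)
    also have "\<dots> \<le> c * nm \<alpha>'' (P N r s k - W r s k)"
      unfolding c_def by (rule vb_bound[OF \<alpha>(1,2) E_diff[OF l(1) PE *(1)] r'(1,3)])
    also have "\<dots> \<le> c * (K * nm \<alpha> k / (1 - q) * q ^ N)"
      using *(3) c by (rule mult_left_mono)
    finally show "dist (em \<alpha>' (v t r (b r (P N r s k)))) (em \<alpha>' (v t r (b r (W r s k)))) \<le> (c * (K * nm \<alpha> k / (1 - q))) * q ^ N"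
      by (simp add: mult.assoc)
  qed
  show ?thesis
  proof (rule has_integral_uniform_limit[OF lim])
    fix N
    have Pg: "opfam {s..t} (\<lambda>r. P N r s)"
      by (rule opfam_reindex[OF opfam_psum[of t N], of "{s..t}" "\<lambda>r. (r, s)", unfolded prod.case])
        (use st in \<open>auto simp: tri2_def intro!: continuous_intros\<close>)
    have bg: "opfam {s..t} b" by (rule opfam_subset[OF pertD(3)[OF pb, of t]]) (use st in auto)
    show "continuous_on {s..t} (\<lambda>r. em \<alpha>' (v t r (b r (P N r s k))))"
      by (rule scontD[OF opfamD(2)[OF opfam_compose[OF evol_opfam_snd[OF ev st(1)] opfam_compose[OF bg Pg]]] \<alpha>(1) l(2) k])
    have A: "((\<lambda>r. \<Sum>j<N. em \<alpha>' (v t r (b r (w v b j r s k)))) has_integral (\<Sum>j<N. em \<alpha>' (w v b (Suc j) t s k))) {s..t}"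
      by (rule has_integral_sum) (use w_Suc_left[OF st \<alpha>(1) l(2) k] in auto)
    have B: "(\<Sum>j<N. em \<alpha>' (w v b (Suc j) t s k)) = em \<alpha>' (P (Suc N) t s k - v t s k)"
      unfolding psum_def sum.lessThan_Suc_shift using \<alpha> by (simp add: em_sum)
    have eq: "(\<Sum>j<N. em \<alpha>' (v t r (b r (w v b j r s k)))) = em \<alpha>' (v t r (b r (P N r s k)))" if "r \<in> {s..t}" for r
      using op_sum[OF vb[OF that] l(1), of "{..<N}" "\<lambda>j. w v b j r s k"] w_E[OF st(1) _ l(1) \<alpha>(3) k] that \<alpha>
      by (simp add: psum_def em_sum)
    show "((\<lambda>r. em \<alpha>' (v t r (b r (P N r s k)))) has_integral em \<alpha>' (P (Suc N) t s k - v t s k)) {s..t}"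
      using has_integral_eq[OF eq A] unfolding B .
    have "rate \<alpha>' \<alpha> * (t - s) \<le> q" unfolding q_def using rate_mono[of \<alpha>' \<alpha>'' \<alpha> s t] \<alpha> st by simp
    note series_convergence(2)[OF st \<alpha>(1) l(2) k this q(2)]
    then have "(\<lambda>N. em \<alpha>' (P (Suc N) t s k) - em \<alpha>' (v t s k)) \<longlonglongrightarrow> em \<alpha>' (W t s k) - em \<alpha>' (v t s k)"
      by (intro tendsto_diff tendsto_const LIMSEQ_Suc)
    then show "(\<lambda>N. em \<alpha>' (P (Suc N) t s k - v t s k)) \<longlonglongrightarrow> em \<alpha>' (W t s k - v t s k)"
      by (simp add: em_diff \<alpha>)
  qed
qed

lemma series_right:
  assumes st: "0 \<le> s" "s \<le> t" and \<alpha>: "low S < \<alpha>'" "\<alpha>' < \<alpha>''" "\<alpha>'' < \<alpha>" and k: "k \<in> E \<alpha>"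
    and \<rho>: "rate \<alpha>' \<alpha> * (t - s) < 1" "rate \<alpha>' \<alpha>'' * (t - s) < 1"
  shows "((\<lambda>r. em \<alpha>' (W t r (b r (v r s k)))) has_integral em \<alpha>' (W t s k - v t s k)) {s..t}"
proof -
  define q where "q = rate \<alpha>' \<alpha>'' * (t - s)"
  have l: "low S < \<alpha>''" "\<alpha>' < \<alpha>" using \<alpha> by auto
  have q: "0 \<le> q" "q < 1" using rate_nonneg[OF \<alpha>(1,2)] st \<rho> by (auto simp: q_def)
  have qr: "rate \<alpha>' \<alpha>'' * (t - r) \<le> q" if "r \<in> {s..t}" for r
    unfolding q_def using that by (intro rate_time_mono l \<alpha>) auto
  have bg: "opfam {s..t} b" by (rule opfam_subset[OF pertD(3)[OF pb, of t]]) (use st in auto)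
  have yg: "opfam {s..t} (\<lambda>r x. b r (v r s x))"
    by (rule opfam_compose[OF bg evol_opfam_fst[OF ev st(1)]])
  have yE: "b r (v r s k) \<in> E \<alpha>''" if "r \<in> {s..t}" for r
    by (rule ops_E[OF opfamD(1)[OF yg that] l(1) \<alpha>(3) k])
  obtain D where D: "0 \<le> D" "\<forall>r\<in>{s..t}. \<forall>x\<in>E \<alpha>. nm \<alpha>'' (b r (v r s x)) \<le> D * nm \<alpha> x"
    using equi_bound[OF opfamD(3)[OF yg] l(1) \<alpha>(3)] by blast
  have lim: "uniform_limit {s..t} (\<lambda>N r. em \<alpha>' (P N t r (b r (v r s k)))) (\<lambda>r. em \<alpha>' (W t r (b r (v r s k)))) sequentially"
  proof (rule uniform_limit_geometric[OF q])
    fix N r assume r: "r \<in> {s..t}"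
    then have r': "0 \<le> r" "s \<le> r" "r \<le> t" using st by auto
    note * = series_convergence[OF r'(1,3) \<alpha>(1,2) yE[OF r] qr[OF r] q(2)]
    note PE = psum_E[OF r'(1,3) \<alpha>(1,2) yE[OF r], of N]
    have "dist (em \<alpha>' (P N t r (b r (v r s k)))) (em \<alpha>' (W t r (b r (v r s k)))) \<le> K * nm \<alpha>'' (b r (v r s k)) / (1 - q) * q ^ N"
      using *(3)[of N] dist_em[OF \<alpha>(1) PE *(1)] by simp
    also have "\<dots> \<le> K * (D * nm \<alpha> k) / (1 - q) * q ^ N"
      using K_ge_1 q D(2) r k by (intro mult_right_mono divide_right_mono mult_left_mono) auto
    finally show "dist (em \<alpha>' (P N t r (b r (v r s k)))) (em \<alpha>' (W t r (b r (v r s k)))) \<le> K * (D * nm \<alpha> k) / (1 - q) * q ^ N" .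
  qed
  show ?thesis
  proof (rule has_integral_uniform_limit[OF lim])
    fix N
    have Pg: "opfam {s..t} (\<lambda>r. P N t r)"
      by (rule opfam_reindex[OF opfam_psum[of t N], of "{s..t}" "\<lambda>r. (t, r)", unfolded prod.case])
        (use st in \<open>auto simp: tri2_def intro!: continuous_intros\<close>)
    show "continuous_on {s..t} (\<lambda>r. em \<alpha>' (P N t r (b r (v r s k))))"
      by (rule scontD[OF opfamD(2)[OF opfam_compose[OF Pg yg]] \<alpha>(1) l(2) k])
    have A: "((\<lambda>r. \<Sum>j<N. em \<alpha>' (w v b j t r (b r (v r s k)))) has_integral (\<Sum>j<N. em \<alpha>' (w v b (Suc j) t s k))) {s..t}"
      by (rule has_integral_sum) (use w_Suc_right[OF st \<alpha>(1) l(2) k] in auto)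
    have B: "(\<Sum>j<N. em \<alpha>' (w v b (Suc j) t s k)) = em \<alpha>' (P (Suc N) t s k - v t s k)"
      unfolding psum_def sum.lessThan_Suc_shift using \<alpha> by (simp add: em_sum)
    have eq: "(\<Sum>j<N. em \<alpha>' (w v b j t r (b r (v r s k)))) = em \<alpha>' (P N t r (b r (v r s k)))" for r
      using \<alpha> by (simp add: psum_def em_sum)
    show "((\<lambda>r. em \<alpha>' (P N t r (b r (v r s k)))) has_integral em \<alpha>' (P (Suc N) t s k - v t s k)) {s..t}"
      using A unfolding B eq .
    note series_convergence(2)[OF st \<alpha>(1) l(2) k order_refl \<rho>(1)]
    then have "(\<lambda>N. em \<alpha>' (P (Suc N) t s k) - em \<alpha>' (v t s k)) \<longlonglongrightarrow> em \<alpha>' (W t s k) - em \<alpha>' (v t s k)"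
      by (intro tendsto_diff tendsto_const LIMSEQ_Suc)
    then show "(\<lambda>N. em \<alpha>' (P (Suc N) t s k - v t s k)) \<longlonglongrightarrow> em \<alpha>' (W t s k - v t s k)"
      by (simp add: em_diff \<alpha>)
  qed
qed

text \<open>If \<open>z\<close> vanishes up to the time \<open>r0\<close>, then the integral may start at \<open>r0\<close>, and Ovsyannikov's
  estimate for the constant sequence \<open>z, z, \<dots>\<close> bounds \<open>nm \<alpha>' (z r)\<close> by \<open>C (rate \<alpha>' \<alpha> * (r - r0))\<^sup>j\<close> for
  every \<open>j\<close>. Hence \<open>z\<close> vanishes for another \<open>d\<close> units of time, first in \<open>E \<alpha>'\<close>; but as an element
  of \<open>'a\<close> it then is \<open>0\<close> in all the spaces, and the step can be iterated without a loss of regularity.\<close>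
lemma homogeneous_solution_zero:
  assumes st: "0 \<le> s" and \<alpha>: "low S < \<alpha>'" "\<alpha>' < \<alpha>" and C: "0 \<le> C"
    and zE: "\<And>r \<beta>. r \<in> {s..t} \<Longrightarrow> \<alpha>' \<le> \<beta> \<Longrightarrow> \<beta> < \<alpha> \<Longrightarrow> z r \<in> E \<beta>"
    and zC: "\<And>r \<beta>. r \<in> {s..t} \<Longrightarrow> \<alpha>' \<le> \<beta> \<Longrightarrow> \<beta> < \<alpha> \<Longrightarrow> nm \<beta> (z r) \<le> C"
    and int: "\<And>r \<beta>. r \<in> {s..t} \<Longrightarrow> \<alpha>' \<le> \<beta> \<Longrightarrow> \<beta> < \<alpha> \<Longrightarrow>
      ((\<lambda>u. em \<beta> (v r u (b u (z u)))) has_integral em \<beta> (z r)) {s..r}"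
    and r: "r \<in> {s..t}"
  shows "z r = 0"
proof -
  define q where "q = rate \<alpha>' \<alpha>"
  (* with steps of this length the estimate is C / 2 ^ j *)
  define d where "d = 1 / (2 * (q + 1))"
  have q: "0 \<le> q" unfolding q_def by (rule rate_nonneg[OF \<alpha>])
  have d: "0 < d" "q * d \<le> 1 / 2" using q by (auto simp: d_def field_simps)
  have vb0: "v r u (b u 0) = 0" if "0 \<le> u" "u \<le> r" for r u
    using op_zero[OF opsD[OF vb_ops[OF that] \<alpha>]] \<alpha> by simp
  have "\<forall>r\<in>{s..t}. r \<le> s + real m * d \<longrightarrow> z r = 0" for m
  proof (induction m)
    case 0
    have "z s = 0" if "s \<in> {s..t}"
    proof -
      have "em \<alpha>' (z s) = 0" using integral_unique[OF int[OF that order_refl \<alpha>(2)]] by simp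
      then show ?thesis using em_eq_iff[OF \<alpha>(1) zE[OF that order_refl \<alpha>(2)] E_zero[OF \<alpha>(1)]] em_zero[OF \<alpha>(1)] by simp
    qed
    then show ?case by auto
  next
    case (Suc m)
    define r0 where "r0 = s + real m * d"
    have sr0: "s \<le> r0" using d by (simp add: r0_def)
    show ?case
    proof (intro ballI impI)
      fix r assume r: "r \<in> {s..t}" and "r \<le> s + real (Suc m) * d"
      then have rd: "r - r0 \<le> d" by (simp add: r0_def algebra_simps)
      show "z r = 0"
      proof (cases "r \<le> r0")
        case True
        then show ?thesis using Suc.IH r by (simp add: r0_def)
      next
        case False
        have sub: "r' \<in> {s..t}" if "r' \<in> {r0..r}" for r' using that r sr0 by auto
        have "nm \<alpha>' (z r) \<le> C * ((K * M \<alpha> * (r - r0)) ^ j / fact j * (real (j + 1) / (\<alpha> - \<alpha>')) ^ j)" for j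
        proof (rule ovsyannikov[where y="\<lambda>_. z" and c=r, OF \<alpha>(1) _ C])
          show "0 \<le> r0" using st sr0 by simp
          show "z r' \<in> E \<beta>" if "r' \<in> {r0..r}" "\<alpha>' \<le> \<beta>" "\<beta> < \<alpha>" for r' \<beta> using zE[OF sub] that by blast
          show "nm \<beta> (z r') \<le> C" if "r' \<in> {r0..r}" "\<alpha>' \<le> \<beta>" "\<beta> < \<alpha>" for r' \<beta> using zC[OF sub] that by blast
          fix r' \<beta> assume r': "r' \<in> {r0..r}" and \<beta>: "\<alpha>' \<le> \<beta>" "\<beta> < \<alpha>"
          note I = int[OF sub[OF r'] \<beta>]
          have low: "low S < \<beta>" using \<alpha> \<beta> by simp
          let ?h = "\<lambda>u. em \<beta> (v r' u (b u (z u)))"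
          have "integral {s..r0} ?h = integral {s..r0} (\<lambda>u. 0)"
          proof (rule integral_cong)
            fix u assume u: "u \<in> {s..r0}"
            then have "z u = 0" using Suc.IH r False by (auto simp: r0_def)
            then show "?h u = 0" using vb0[of u r'] u st r' em_zero[OF low] by simp
          qed
          moreover have "integral {s..r'} ?h = integral {s..r0} ?h + integral {r0..r'} ?h"
            using sr0 r' has_integral_integrable[OF I]
            by (intro Henstock_Kurzweil_Integration.integral_combine[symmetric]) auto
          moreover have "?h integrable_on {r0..r'}"
            by (rule integrable_on_subinterval[OF has_integral_integrable[OF I]]) (use sr0 in auto)
          ultimately show "(?h has_integral em \<beta> (z r')) {r0..r'}"
            using integral_unique[OF I] integrable_integral[of ?h "{r0..r'}"] by simp
        qed (use False \<alpha> in auto)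
        also have "C * ((K * M \<alpha> * (r - r0)) ^ j / fact j * (real (j + 1) / (\<alpha> - \<alpha>')) ^ j) \<le> C * (q * (r - r0)) ^ j" for j
          unfolding q_def using False by (intro ovsyannikov_rate[OF \<alpha> C]) auto
        also have "C * (q * (r - r0)) ^ j \<le> C * (1 / 2) ^ j" for j
          using C q False mult_left_mono[OF rd q] d(2) by (intro mult_left_mono power_mono) auto
        finally have le: "nm \<alpha>' (z r) \<le> C * (1 / 2) ^ j" for j .
        have "(\<lambda>j. C * (1 / 2) ^ j) \<longlonglongrightarrow> C * 0"
          by (intro tendsto_mult tendsto_const LIMSEQ_power_zero) simp
        then have "nm \<alpha>' (z r) \<le> 0" using le by (intro LIMSEQ_le_const[of _ 0]) auto
        then show ?thesis
          using nm_nonneg[OF \<alpha>(1)] nm_eq_0[OF \<alpha>(1)] zE[OF r order_refl \<alpha>(2)] by (meson antisym)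
      qed
    qed
  qed
  moreover obtain m where "(t - s) / d \<le> real m" using real_arch_simple by blast
  then have "t \<le> s + real m * d" using d by (simp add: field_simps)
  ultimately show ?thesis using r by (meson atLeastAtMost_iff order_trans)
qed

end

section \<open>Collections and single maps\<close>

lemma continuous_on_tri2_exhaust:
  assumes "\<And>T. continuous_on (tri2 T) f"
  shows "continuous_on {(t, s). 0 \<le> s \<and> s \<le> t} f"
proof (rule continuous_on_exhaust)
  fix p :: "real \<times> real"
  have "open {q :: real \<times> real. fst q < fst p + 1}" by (intro open_Collect_less continuous_intros)
  moreover have "continuous_on ({(t, s). 0 \<le> s \<and> s \<le> t} \<inter> {q. fst q < fst p + 1}) f"
    by (rule continuous_on_subset[OF assms[of "fst p + 1"]]) (auto simp: tri2_def)
  ultimately show "\<exists>U. open U \<and> p \<in> U \<and> continuous_on ({(t, s). 0 \<le> s \<and> s \<le> t} \<inter> U) f"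
    by (intro exI[of _ "{q. fst q < fst p + 1}"]) simp
qed

lemma continuous_on_atLeast_exhaust:
  fixes f :: "real \<Rightarrow> 'b::topological_space"
  assumes "\<And>T. continuous_on {0..T} f"
  shows "continuous_on {0..} f"
proof (rule continuous_on_exhaust)
  fix p :: real
  have "continuous_on ({0..} \<inter> {..<p + 1}) f"
    by (rule continuous_on_subset[OF assms[of "p + 1"]]) auto
  then show "\<exists>U. open U \<and> p \<in> U \<and> continuous_on ({0..} \<inter> U) f"
    by (intro exI[of _ "{..<p + 1}"]) simp
qed

lemma tendsto_zero_ennrealI:
  fixes f :: "nat \<Rightarrow> ennreal"
  assumes "\<And>e :: real. e > 0 \<Longrightarrow> \<exists>N. \<forall>n\<ge>N. f n \<le> ennreal e"
  shows "f \<longlonglongrightarrow> 0"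
proof (rule order_tendstoI)
  fix a :: ennreal assume "0 < a"
  then obtain c where c: "0 < c" "c < a" using dense by blast
  then obtain e where e: "c = ennreal e" "0 \<le> e" by (cases c) auto
  with c have "e > 0" by (simp add: ennreal_less_zero_iff)
  then obtain N where "\<And>n. n \<ge> N \<Longrightarrow> f n \<le> ennreal e" using assms by blast
  then show "\<forall>\<^sub>F n in sequentially. f n < a"
    using c e by (auto simp: eventually_sequentially intro!: exI[of _ N] intro: le_less_trans)
qed simp

context bscale
begin

lemma flat_const: "a \<in> ops \<Longrightarrow> low S < \<alpha> \<Longrightarrow> x \<in> E \<alpha> \<Longrightarrow> flat (\<lambda>_ _. a) x = a x"
  using dense[of "low S" \<alpha>] flat_eq[OF ops_coll[of a]] by blast

lemma scale_comp_flat: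
  assumes "A \<in> scale_ops S" "B \<in> scale_ops S" "low S < \<alpha>'" "\<alpha>' < \<alpha>" "x \<in> E \<alpha>"
  shows "scale_comp A B \<alpha> \<alpha>' x = flat A (flat B x)"
proof -
  have m: "\<alpha>' < (\<alpha>' + \<alpha>) / 2" "(\<alpha>' + \<alpha>) / 2 < \<alpha>" "low S < (\<alpha>' + \<alpha>) / 2" using assms by auto
  have "B \<alpha> ((\<alpha>' + \<alpha>) / 2) x = flat B x" using flat_eq[OF assms(2) m(3,2) assms(5)] by simp
  moreover have "flat B x \<in> E ((\<alpha>' + \<alpha>) / 2)" by (rule ops_E[OF flat_ops[OF assms(2)] m(3,2) assms(5)])
  ultimately show ?thesis using flat_eq[OF assms(1,3) m(1)] by (simp add: scale_comp_def)
qed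

lemma opnorm_flat_diff:
  assumes "A \<in> scale_ops S" "B \<in> scale_ops S" "low S < \<alpha>'" "\<alpha>' < \<alpha>"
  shows "opnorm S \<alpha> \<alpha>' (\<lambda>x. A \<alpha> \<alpha>' x - B \<alpha> \<alpha>' x) = opnorm S \<alpha> \<alpha>' (\<lambda>x. flat A x - flat B x)"
  by (rule opnorm_cong) (simp add: flat_eq[OF assms(1,3,4)] flat_eq[OF assms(2,3,4)])

lemma opnorm_flat:
  assumes "A \<in> scale_ops S" "low S < \<alpha>'" "\<alpha>' < \<alpha>"
  shows "opnorm S \<alpha> \<alpha>' (A \<alpha> \<alpha>') = opnorm S \<alpha> \<alpha>' (flat A)"
  by (rule opnorm_cong) (simp add: flat_eq[OF assms])

lemma uconv_cong:
  assumes "uconv X fn f" "\<And>n p \<alpha> x. p \<in> X \<Longrightarrow> low S < \<alpha> \<Longrightarrow> x \<in> E \<alpha> \<Longrightarrow> fn n p x = gn n p x"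
    "\<And>p \<alpha> x. p \<in> X \<Longrightarrow> low S < \<alpha> \<Longrightarrow> x \<in> E \<alpha> \<Longrightarrow> f p x = g p x"
  shows "uconv X gn g"
  unfolding uconv_def
proof (intro allI impI)
  fix \<alpha>' \<alpha> e :: real assume \<alpha>: "low S < \<alpha>'" "\<alpha>' < \<alpha>" and e: "e > 0"
  have l: "low S < \<alpha>" using \<alpha> by simp
  obtain N where N: "\<And>n p x. n \<ge> N \<Longrightarrow> p \<in> X \<Longrightarrow> x \<in> E \<alpha> \<Longrightarrow> nm \<alpha>' (fn n p x - f p x) \<le> e * nm \<alpha> x"
    using uconvD[OF assms(1) \<alpha> e] by blast
  then show "\<exists>N. \<forall>n\<ge>N. \<forall>p\<in>X. \<forall>x\<in>E \<alpha>. nm \<alpha>' (gn n p x - g p x) \<le> e * nm \<alpha> x"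
    by (intro exI[of _ N] allI impI ballI) (use assms(2,3)[OF _ l] in metis)
qed

lemma evol_flat:
  assumes A2: "cond_A2 S V" and A4: "cond_A4 S K V"
  shows "evol K (\<lambda>t s. flat (V t s))"
proof -
  have V: "V t s \<in> scale_ops S" if "0 \<le> s" "s \<le> t" for t s
    using A2 that unfolding cond_A2_def by blast
  have K: "1 \<le> K" using A4 unfolding cond_A4_def by blast
  have bound: "nm \<alpha>' (flat (V t s) k) \<le> K * nm \<alpha> k"
    if "low S < \<alpha>'" "\<alpha>' < \<alpha>" "0 \<le> s" "s \<le> t" "k \<in> E \<alpha>" for \<alpha>' \<alpha> t s k
  proof -
    have l: "low S < \<alpha>" using that by simp
    have "opnorm S \<alpha> \<alpha>' (flat (V t s)) \<le> K"
      using A4 that unfolding cond_A4_def opnorm_flat[OF V[OF that(3,4)] that(1,2), symmetric] by blast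
    then have "opnorm S \<alpha> \<alpha>' (flat (V t s)) * nm \<alpha> k \<le> K * nm \<alpha> k"
      using that l by (intro mult_right_mono nm_nonneg)
    then show ?thesis
      using opnorm_bound[OF l that(1) opsD[OF flat_ops[OF V[OF that(3,4)]] that(1,2)] that(5)] by simp
  qed
  have "opfam (tri2 T) (\<lambda>(t, s). flat (V t s))" for T
    unfolding opfam_def
  proof (intro conjI ballI)
    show "(case p of (t, s) \<Rightarrow> flat (V t s)) \<in> ops" if "p \<in> tri2 T" for p
      using that by (auto simp: tri2_def intro: flat_ops[OF V])
    show "scont (tri2 T) (\<lambda>(t, s). flat (V t s))"
      unfolding scont_def
    proof (intro allI impI ballI)
      fix \<alpha>' \<alpha> k assume \<alpha>: "low S < \<alpha>'" "\<alpha>' < \<alpha>" "k \<in> E \<alpha>"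
      have "continuous_map (top_of_set {(t, s). 0 \<le> s \<and> s \<le> t}) (ntop S \<alpha>') (\<lambda>(t, s). V t s \<alpha> \<alpha>' k)"
        using A2 \<alpha> unfolding cond_A2_def by blast
      then have "continuous_on {(t, s). 0 \<le> s \<and> s \<le> t} (\<lambda>p. em \<alpha>' ((\<lambda>(t, s). V t s \<alpha> \<alpha>' k) p))"
        unfolding continuous_map_ntop_iff[OF \<alpha>(1)] by (rule conjunct2)
      then have "continuous_on (tri2 T) (\<lambda>p. em \<alpha>' ((\<lambda>(t, s). V t s \<alpha> \<alpha>' k) p))"
        by (rule continuous_on_subset) (auto simp: tri2_def)
      then show "continuous_on (tri2 T) (\<lambda>p. em \<alpha>' ((case p of (t, s) \<Rightarrow> flat (V t s)) k))"
        by (rule continuous_on_eq) (auto simp: tri2_def flat_eq[OF V \<alpha>])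
    qed
    show "equi (tri2 T) (\<lambda>(t, s). flat (V t s))"
      unfolding equi_def by (auto simp: tri2_def intro!: exI[of _ K] bound)
  qed
  moreover have "flat (V t t) k = k" if \<alpha>: "low S < \<alpha>" "k \<in> E \<alpha>" "0 \<le> t" for \<alpha> k t
  proof -
    obtain \<alpha>' where "low S < \<alpha>'" "\<alpha>' < \<alpha>" using dense[OF \<alpha>(1)] by blast
    then show ?thesis
      using A2 \<alpha> flat_eq[OF V[OF \<alpha>(3) order_refl], of \<alpha>' \<alpha> k] unfolding cond_A2_def by simp
  qed
  ultimately show ?thesis using K bound unfolding evol_def by blast
qed

lemma evol_conds:
  assumes v: "evol K v"
  shows "cond_A2 S (\<lambda>t s _ _. v t s)" "cond_A4 S K (\<lambda>t s _ _. v t s)"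
proof -
  show "cond_A2 S (\<lambda>t s _ _. v t s)"
    unfolding cond_A2_def
  proof (intro conjI allI impI ballI)
    show "(\<lambda>_ _. v t s) \<in> scale_ops S" if "0 \<le> s" "s \<le> t" for t s
      by (rule ops_coll[OF evol_ops[OF v that]])
    fix \<alpha>' \<alpha> k assume \<alpha>: "low S < \<alpha>'" "\<alpha>' < \<alpha>" and k: "k \<in> E \<alpha>"
    show "v t t k = k" if "0 \<le> t" for t using evol_refl[OF v _ k that] \<alpha> by simp
    have "continuous_on {(t, s). 0 \<le> s \<and> s \<le> t} (\<lambda>p. em \<alpha>' ((case p of (t, s) \<Rightarrow> v t s) k))"
      by (rule continuous_on_tri2_exhaust[OF scontD[OF opfamD(2)[OF evol_opfam[OF v]] \<alpha> k]])
    then show "continuous_map (top_of_set {(t, s). 0 \<le> s \<and> s \<le> t}) (ntop S \<alpha>') (\<lambda>(t, s). v t s k)"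
      unfolding continuous_map_ntop_iff[OF \<alpha>(1)] using evol_E[OF v _ _ \<alpha> k] by (auto simp: case_prod_unfold)
  qed
  show "cond_A4 S K (\<lambda>t s _ _. v t s)"
    unfolding cond_A4_def using evol_K[OF v] evol_bound[OF v] by (auto intro!: opnorm_le)
qed

lemma generates_flat:
  assumes A3: "cond_A3 S A V" and A: "\<And>t. 0 \<le> t \<Longrightarrow> A t \<in> scale_ops S"
    and V: "\<And>t s. 0 \<le> s \<Longrightarrow> s \<le> t \<Longrightarrow> V t s \<in> scale_ops S"
  shows "generates (\<lambda>t. flat (A t)) (\<lambda>t s. flat (V t s))"
  unfolding generates_def
proof (intro allI impI)
  fix \<alpha>' \<alpha> t s :: real and k assume \<alpha>: "low S < \<alpha>'" "\<alpha>' < \<alpha>" and st: "0 \<le> s" "s \<le> t" and k: "k \<in> E \<alpha>"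
  obtain \<beta> where \<beta>: "\<alpha>' < \<beta>" "\<beta> < \<alpha>" "low S < \<beta>" using dense[OF \<alpha>(2)] \<alpha> by force
  have 1: "flat (V r s) k = V r s \<alpha> \<beta> k" "flat (V r s) k \<in> E \<beta>" if "r \<in> {s..t}" for r
    using that st V[of s r] flat_eq[OF _ \<beta>(3,2) k] ops_E[OF flat_ops \<beta>(3,2) k] by auto
  have 2: "flat (A r) k = A r \<alpha> \<beta> k" "flat (A r) k \<in> E \<beta>" if "r \<in> {s..t}" for r
    using that st A[of r] flat_eq[OF _ \<beta>(3,2) k] ops_E[OF flat_ops \<beta>(3,2) k] by auto
  have 3: "A r \<beta> \<alpha>' (V r s \<alpha> \<beta> k) = flat (A r) (flat (V r s) k)" "flat (A r) (flat (V r s) k) \<in> E \<alpha>'" if "r \<in> {s..t}" for r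
    using that st A[of r] flat_eq[OF _ \<alpha>(1) \<beta>(1) 1(2)[OF that]] ops_E[OF flat_ops \<alpha>(1) \<beta>(1) 1(2)[OF that]]
    by (auto simp: 1[OF that])
  have 4: "V t r \<beta> \<alpha>' (A r \<alpha> \<beta> k) = flat (V t r) (flat (A r) k)" "flat (V t r) (flat (A r) k) \<in> E \<alpha>'" if "r \<in> {s..t}" for r
    using that st V[of r t] flat_eq[OF _ \<alpha>(1) \<beta>(1) 2(2)[OF that]] ops_E[OF flat_ops \<alpha>(1) \<beta>(1) 2(2)[OF that]]
    by (auto simp: 2[OF that])
  have V0: "V t s \<alpha> \<alpha>' k = flat (V t s) k" using flat_eq[OF V[OF st] \<alpha> k] by simp
  have "has_integral_in S \<alpha>' s t (\<lambda>r. A r \<beta> \<alpha>' (V r s \<alpha> \<beta> k)) (V t s \<alpha> \<alpha>' k - k)"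
    "has_integral_in S \<alpha>' s t (\<lambda>r. V t r \<beta> \<alpha>' (A r \<alpha> \<beta> k)) (V t s \<alpha> \<alpha>' k - k)"
    using A3 \<alpha> \<beta> k st unfolding cond_A3_def by blast+
  then have I: "((\<lambda>r. em \<alpha>' (A r \<beta> \<alpha>' (V r s \<alpha> \<beta> k))) has_integral em \<alpha>' (flat (V t s) k - k)) {s..t}"
    "((\<lambda>r. em \<alpha>' (V t r \<beta> \<alpha>' (A r \<alpha> \<beta> k))) has_integral em \<alpha>' (flat (V t s) k - k)) {s..t}"
    using has_integral_in_iff[OF \<alpha>(1), of s t "\<lambda>r. A r \<beta> \<alpha>' (V r s \<alpha> \<beta> k)"]
      has_integral_in_iff[OF \<alpha>(1), of s t "\<lambda>r. V t r \<beta> \<alpha>' (A r \<alpha> \<beta> k)"]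
    by (simp_all only: 3 4 V0)
  show "((\<lambda>r. em \<alpha>' (flat (A r) (flat (V r s) k))) has_integral em \<alpha>' (flat (V t s) k - k)) {s..t} \<and>
    ((\<lambda>r. em \<alpha>' (flat (V t r) (flat (A r) k))) has_integral em \<alpha>' (flat (V t s) k - k)) {s..t}"
    using has_integral_eq[OF _ I(1)] has_integral_eq[OF _ I(2)] 3(1) 4(1) by simp
qed

lemma cond_A3_generates:
  assumes g: "generates (\<lambda>t. flat (A t)) v" and A: "\<And>t. 0 \<le> t \<Longrightarrow> A t \<in> scale_ops S" and v: "evol K v"
  shows "cond_A3 S A (\<lambda>t s _ _. v t s)"
  unfolding cond_A3_def
proof (intro allI impI ballI)
  fix \<alpha>' \<beta> \<alpha> t s :: real and k
  assume \<alpha>: "low S < \<alpha>'" "\<alpha>' < \<beta>" "\<beta> < \<alpha>" and k: "k \<in> E \<alpha>" and st: "0 \<le> s" "s \<le> t"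
  have l: "low S < \<beta>" "\<alpha>' < \<alpha>" using \<alpha> by auto
  have 1: "v r s k \<in> E \<beta>" if "r \<in> {s..t}" for r
    using that by (intro evol_E[OF v st(1) _ l(1) \<alpha>(3) k]) auto
  have 2: "A r \<alpha> \<beta> k = flat (A r) k" "flat (A r) k \<in> E \<beta>" if "r \<in> {s..t}" for r
    using that st A[of r] flat_eq[OF _ l(1) \<alpha>(3) k] ops_E[OF flat_ops l(1) \<alpha>(3) k] by auto
  have 3: "A r \<beta> \<alpha>' (v r s k) = flat (A r) (v r s k)" "flat (A r) (v r s k) \<in> E \<alpha>'" if "r \<in> {s..t}" for r
    using that st A[of r] flat_eq[OF _ \<alpha>(1,2) 1[OF that]] ops_E[OF flat_ops \<alpha>(1,2) 1[OF that]] by auto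
  have 4: "v t r (flat (A r) k) \<in> E \<alpha>'" if "r \<in> {s..t}" for r
    using that st by (intro evol_E[OF v _ _ \<alpha>(1,2) 2(2)[OF that]]) auto
  have vE: "v t s k - k \<in> E \<alpha>'"
    using evol_E[OF v st \<alpha>(1) l(2) k] E_mono[OF \<alpha>(1) _ k] l by (intro E_diff \<alpha>) auto
  have I: "((\<lambda>r. em \<alpha>' (flat (A r) (v r s k))) has_integral em \<alpha>' (v t s k - k)) {s..t}"
    "((\<lambda>r. em \<alpha>' (v t r (flat (A r) k))) has_integral em \<alpha>' (v t s k - k)) {s..t}"
    using g \<alpha>(1) l(2) k st unfolding generates_def by blast+
  have "has_integral_in S \<alpha>' s t (\<lambda>r. A r \<beta> \<alpha>' (v r s k)) (v t s k - k)"
    using has_integral_eq[OF _ I(1)] 3 vE by (subst has_integral_in_iff[OF \<alpha>(1)]) auto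
  moreover have "has_integral_in S \<alpha>' s t (\<lambda>r. v t r (A r \<alpha> \<beta> k)) (v t s k - k)"
    using has_integral_eq[OF _ I(2)] 2 4 vE by (subst has_integral_in_iff[OF \<alpha>(1)]) auto
  ultimately show "has_integral_in S \<alpha>' s t (\<lambda>r. A r \<beta> \<alpha>' (v r s k)) (v t s k - k) \<and>
    has_integral_in S \<alpha>' s t (\<lambda>r. v t r (A r \<alpha> \<beta> k)) (v t s k - k)" ..
qed

text \<open>Continuity in operator norm makes the norm itself continuous in time, hence bounded
  on compact intervals.\<close>
lemma opfam_A1:
  assumes A: "\<And>t. 0 \<le> t \<Longrightarrow> A t \<in> scale_ops S" and A1: "cond_A1 S A"
  shows "opfam {0..T} (\<lambda>t. flat (A t))"
proof -
  define a where "a t = flat (A t)" for t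
  have aops: "a t \<in> ops" if "0 \<le> t" for t unfolding a_def by (rule flat_ops[OF A[OF that]])
  have diff: "nm \<alpha>' (a t x - a t0 x) \<le> opnorm S \<alpha> \<alpha>' (\<lambda>x. A t \<alpha> \<alpha>' x - A t0 \<alpha> \<alpha>' x) * nm \<alpha> x"
    if "0 \<le> t" "0 \<le> t0" "low S < \<alpha>'" "\<alpha>' < \<alpha>" "x \<in> E \<alpha>" for t t0 \<alpha>' \<alpha> x
  proof -
    have l: "low S < \<alpha>" using that by simp
    show ?thesis
      unfolding opnorm_flat_diff[OF A[OF that(1)] A[OF that(2)] that(3,4)] a_def[symmetric]
      by (rule opnorm_bound[OF l that(3) bounded_op_diff[OF l that(3)] that(5)])
        (use opsD[OF aops that(3,4)] that in auto)
  qed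
  have lim: "((\<lambda>t. opnorm S \<alpha> \<alpha>' (\<lambda>x. A t \<alpha> \<alpha>' x - A t0 \<alpha> \<alpha>' x)) \<longlongrightarrow> 0) (at t0 within {0..})"
    if "low S < \<alpha>'" "\<alpha>' < \<alpha>" "0 \<le> t0" for t0 \<alpha>' \<alpha>
    using A1 that unfolding cond_A1_def by blast
  have "scont {0..T} a"
    unfolding scont_def
  proof (intro allI impI ballI)
    fix \<alpha>' \<alpha> k assume \<alpha>: "low S < \<alpha>'" "\<alpha>' < \<alpha>" and k: "k \<in> E \<alpha>"
    have "continuous_on {0..} (\<lambda>t. em \<alpha>' (a t k))"
      unfolding continuous_on_def
    proof
      fix t0 :: real assume t0: "t0 \<in> {0..}"
      show "((\<lambda>t. em \<alpha>' (a t k)) \<longlongrightarrow> em \<alpha>' (a t0 k)) (at t0 within {0..})"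
      proof (rule LIM_zero_cancel, rule Lim_null_comparison)
        show "\<forall>\<^sub>F t in at t0 within {0..}. norm (em \<alpha>' (a t k) - em \<alpha>' (a t0 k))
            \<le> opnorm S \<alpha> \<alpha>' (\<lambda>x. A t \<alpha> \<alpha>' x - A t0 \<alpha> \<alpha>' x) * nm \<alpha> k"
          unfolding eventually_at_filter
          using diff[OF _ _ \<alpha> k, of _ t0] t0 ops_E[OF aops \<alpha> k] \<alpha>
          by (intro always_eventually) (simp add: norm_em_diff)
        show "((\<lambda>t. opnorm S \<alpha> \<alpha>' (\<lambda>x. A t \<alpha> \<alpha>' x - A t0 \<alpha> \<alpha>' x) * nm \<alpha> k) \<longlongrightarrow> 0) (at t0 within {0..})"
          using lim[OF \<alpha>] t0 by (intro tendsto_mult_left_zero) auto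
      qed
    qed
    then show "continuous_on {0..T} (\<lambda>t. em \<alpha>' (a t k))" by (rule continuous_on_subset) auto
  qed
  moreover have "equi {0..T} a"
    unfolding equi_def
  proof (intro allI impI)
    fix \<alpha>' \<alpha> assume \<alpha>: "low S < \<alpha>'" "\<alpha>' < \<alpha>"
    have l: "low S < \<alpha>" using \<alpha> by simp
    define g where "g t = opnorm S \<alpha> \<alpha>' (a t)" for t
    have gb: "nm \<alpha>' (a t x) \<le> g t * nm \<alpha> x" if "0 \<le> t" "x \<in> E \<alpha>" for t x
      unfolding g_def by (rule opnorm_bound[OF l \<alpha>(1) opsD[OF aops[OF that(1)] \<alpha>] that(2)])
    have g0: "0 \<le> g t" if "0 \<le> t" for t
      unfolding g_def by (rule opnorm_nonneg[OF l \<alpha>(1) opsD[OF aops[OF that] \<alpha>]])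
    have d0: "0 \<le> opnorm S \<alpha> \<alpha>' (\<lambda>x. A t \<alpha> \<alpha>' x - A t0 \<alpha> \<alpha>' x)" if "0 \<le> t" "0 \<le> t0" for t t0
      unfolding opnorm_flat_diff[OF A[OF that(1)] A[OF that(2)] \<alpha>]
      by (rule opnorm_nonneg[OF l \<alpha>(1) bounded_op_diff[OF l \<alpha>(1)]]) (use opsD[OF flat_ops[OF A] \<alpha>] that in auto)
    have tri: "g t \<le> g t0 + opnorm S \<alpha> \<alpha>' (\<lambda>x. A r \<alpha> \<alpha>' x - A q \<alpha> \<alpha>' x)"
      if "0 \<le> t" "0 \<le> t0" "(r = t \<and> q = t0) \<or> (r = t0 \<and> q = t)" for t t0 r q
      unfolding g_def[of t]
    proof (rule opnorm_le[OF l])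
      have rq: "0 \<le> r" "0 \<le> q" using that by auto
      show "0 \<le> g t0 + opnorm S \<alpha> \<alpha>' (\<lambda>x. A r \<alpha> \<alpha>' x - A q \<alpha> \<alpha>' x)" using g0[OF that(2)] d0[OF rq] by simp
      fix x assume x: "x \<in> E \<alpha>"
      note aE = ops_E[OF aops \<alpha> x]
      have "norm (em \<alpha>' (a t x)) \<le> norm (em \<alpha>' (a t0 x)) + norm (em \<alpha>' (a t x) - em \<alpha>' (a t0 x))"
        by (rule norm_triangle_sub)
      also have "norm (em \<alpha>' (a t x) - em \<alpha>' (a t0 x)) = norm (em \<alpha>' (a r x) - em \<alpha>' (a q x))"
        using that(3) norm_minus_commute by blast
      finally have "nm \<alpha>' (a t x) \<le> nm \<alpha>' (a t0 x) + nm \<alpha>' (a r x - a q x)"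
        using aE that rq \<alpha> by (simp add: norm_em norm_em_diff)
      then show "nm \<alpha>' (a t x) \<le> (g t0 + opnorm S \<alpha> \<alpha>' (\<lambda>x. A r \<alpha> \<alpha>' x - A q \<alpha> \<alpha>' x)) * nm \<alpha> x"
        using gb[OF that(2) x] diff[OF rq \<alpha> x] by (simp add: distrib_right)
    qed
    have "continuous_on {0..T} g"
      unfolding continuous_on_def
    proof
      fix t0 assume t0: "t0 \<in> {0..T}"
      have "((\<lambda>t. g t - g t0) \<longlongrightarrow> 0) (at t0 within {0..T})"
      proof (rule Lim_null_comparison)
        show "\<forall>\<^sub>F t in at t0 within {0..T}. norm (g t - g t0) \<le> opnorm S \<alpha> \<alpha>' (\<lambda>x. A t \<alpha> \<alpha>' x - A t0 \<alpha> \<alpha>' x)"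
          unfolding eventually_at_filter
        proof (intro always_eventually allI impI)
          fix t assume "t \<in> {0..T}"
          then show "norm (g t - g t0) \<le> opnorm S \<alpha> \<alpha>' (\<lambda>x. A t \<alpha> \<alpha>' x - A t0 \<alpha> \<alpha>' x)"
            using tri[of t t0 t t0] tri[of t0 t t t0] t0 by auto
        qed
        have "((\<lambda>t. opnorm S \<alpha> \<alpha>' (\<lambda>x. A t \<alpha> \<alpha>' x - A t0 \<alpha> \<alpha>' x)) \<longlongrightarrow> 0) (at t0 within {0..})"
          using lim[OF \<alpha>] t0 by simp
        then show "((\<lambda>t. opnorm S \<alpha> \<alpha>' (\<lambda>x. A t \<alpha> \<alpha>' x - A t0 \<alpha> \<alpha>' x)) \<longlongrightarrow> 0) (at t0 within {0..T})"
          by (rule tendsto_within_subset) auto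
      qed
      then show "(g \<longlongrightarrow> g t0) (at t0 within {0..T})" by (rule LIM_zero_cancel)
    qed
    then have "compact (g ` {0..T})" by (intro compact_continuous_image) auto
    then have "bdd_above (g ` {0..T})" by (intro bounded_imp_bdd_above compact_imp_bounded)
    then have "\<exists>C. \<forall>t\<in>{0..T}. g t \<le> C" by (simp add: bdd_above_def)
    then obtain C where C: "\<And>t. t \<in> {0..T} \<Longrightarrow> g t \<le> C" by blast
    have "nm \<alpha>' (a t x) \<le> C * nm \<alpha> x" if "t \<in> {0..T}" "x \<in> E \<alpha>" for t x
      using gb[of t x] that mult_right_mono[OF C[OF that(1)] nm_nonneg[OF l that(2)]] by simp
    then show "\<exists>C. \<forall>t\<in>{0..T}. \<forall>x\<in>E \<alpha>. nm \<alpha>' (a t x) \<le> C * nm \<alpha> x" by blast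
  qed
  ultimately have "opfam {0..T} a" using aops by (simp add: opfam_def)
  then show ?thesis unfolding a_def .
qed

lemma pert_flat:
  assumes B: "\<And>t. 0 \<le> t \<Longrightarrow> B t \<in> scale_ops S" and B1: "cond_B1 S B" and B2: "cond_B2 S M B"
  shows "pert M (\<lambda>t. flat (B t))"
proof -
  have M: "mono_on {low S<..} M" "\<And>\<alpha>. low S < \<alpha> \<Longrightarrow> 0 \<le> M \<alpha>"
    using B2 unfolding cond_B2_def by blast+
  have bound: "nm \<alpha>' (flat (B t) k) \<le> M \<alpha> / (\<alpha> - \<alpha>') * nm \<alpha> k"
    if "low S < \<alpha>'" "\<alpha>' < \<alpha>" "0 \<le> t" "k \<in> E \<alpha>" for \<alpha>' \<alpha> t k
  proof -
    have l: "low S < \<alpha>" using that by simp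
    have "opnorm S \<alpha> \<alpha>' (flat (B t)) \<le> M \<alpha> / (\<alpha> - \<alpha>')"
      using B2 that unfolding cond_B2_def opnorm_flat[OF B[OF that(3)] that(1,2), symmetric] by blast
    then have "opnorm S \<alpha> \<alpha>' (flat (B t)) * nm \<alpha> k \<le> M \<alpha> / (\<alpha> - \<alpha>') * nm \<alpha> k"
      using that l by (intro mult_right_mono nm_nonneg)
    then show ?thesis
      using opnorm_bound[OF l that(1) opsD[OF flat_ops[OF B[OF that(3)]] that(1,2)] that(4)] by simp
  qed
  have "opfam {0..T} (\<lambda>t. flat (B t))" for T
    unfolding opfam_def
  proof (intro conjI ballI)
    show "flat (B t) \<in> ops" if "t \<in> {0..T}" for t using that by (intro flat_ops B) auto
    show "scont {0..T} (\<lambda>t. flat (B t))"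
      unfolding scont_def
    proof (intro allI impI ballI)
      fix \<alpha>' \<alpha> k assume \<alpha>: "low S < \<alpha>'" "\<alpha>' < \<alpha>" "k \<in> E \<alpha>"
      have "continuous_map (top_of_set {0..}) (ntop S \<alpha>') (\<lambda>t. B t \<alpha> \<alpha>' k)"
        using B1 \<alpha> unfolding cond_B1_def by blast
      then have "continuous_on {0..} (\<lambda>t. em \<alpha>' (B t \<alpha> \<alpha>' k))"
        unfolding continuous_map_ntop_iff[OF \<alpha>(1)] by (rule conjunct2)
      then have "continuous_on {0..T} (\<lambda>t. em \<alpha>' (B t \<alpha> \<alpha>' k))"
        by (rule continuous_on_subset) auto
      then show "continuous_on {0..T} (\<lambda>t. em \<alpha>' (flat (B t) k))"
        by (rule continuous_on_eq) (auto simp: flat_eq[OF B \<alpha>])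
    qed
    show "equi {0..T} (\<lambda>t. flat (B t))"
      unfolding equi_def
    proof (intro allI impI)
      fix \<alpha>' \<alpha> assume "low S < \<alpha>'" "\<alpha>' < \<alpha>"
      then show "\<exists>C. \<forall>t\<in>{0..T}. \<forall>x\<in>E \<alpha>. nm \<alpha>' (flat (B t) x) \<le> C * nm \<alpha> x"
        using bound by (intro exI[of _ "M \<alpha> / (\<alpha> - \<alpha>')"]) simp
    qed
  qed
  with M bound show ?thesis unfolding pert_def by blast
qed

lemma pert_conds:
  assumes b: "pert M (\<lambda>t. flat (B t))" and B: "\<And>t. 0 \<le> t \<Longrightarrow> B t \<in> scale_ops S" and M: "continuous_on {low S<..} M"
  shows "cond_B1 S B" "cond_B2 S M B"
proof -
  show "cond_B1 S B"
    unfolding cond_B1_def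
  proof (intro allI impI ballI)
    fix \<alpha>' \<alpha> k assume \<alpha>: "low S < \<alpha>'" "\<alpha>' < \<alpha>" and k: "k \<in> E \<alpha>"
    have "continuous_on {0..} (\<lambda>t. em \<alpha>' (flat (B t) k))"
      by (rule continuous_on_atLeast_exhaust[OF scontD[OF opfamD(2)[OF pertD(3)[OF b]] \<alpha> k]])
    then have "continuous_on {0..} (\<lambda>t. em \<alpha>' (B t \<alpha> \<alpha>' k))"
      by (rule continuous_on_eq) (simp add: flat_eq[OF B \<alpha> k])
    moreover have "B t \<alpha> \<alpha>' k \<in> E \<alpha>'" if "0 \<le> t" for t
      using ops_E[OF flat_ops[OF B[OF that]] \<alpha> k] flat_eq[OF B[OF that] \<alpha> k] by simp
    ultimately show "continuous_map (top_of_set {0..}) (ntop S \<alpha>') (\<lambda>t. B t \<alpha> \<alpha>' k)"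
      unfolding continuous_map_ntop_iff[OF \<alpha>(1)] by simp
  qed
  have "opnorm S \<alpha> \<alpha>' (B t \<alpha> \<alpha>') \<le> M \<alpha> / (\<alpha> - \<alpha>')" if \<alpha>: "low S < \<alpha>'" "\<alpha>' < \<alpha>" and t: "0 \<le> t" for \<alpha>' \<alpha> t
    unfolding opnorm_flat[OF B[OF t] \<alpha>]
    using \<alpha> pertD(2)[OF b, of \<alpha>] pertD(4)[OF b \<alpha> t] by (intro opnorm_le) auto
  with b M show "cond_B2 S M B" unfolding cond_B2_def pert_def by blast
qed

lemma uconv_flat:
  fixes An :: "nat \<Rightarrow> real \<Rightarrow> 'a coll" and A :: "real \<Rightarrow> 'a coll"
  assumes A: "\<And>n t. 0 \<le> t \<Longrightarrow> An n t \<in> scale_ops S" "\<And>t. 0 \<le> t \<Longrightarrow> A t \<in> scale_ops S"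
    and lim: "\<And>T \<alpha>' \<alpha>. 0 < T \<Longrightarrow> low S < \<alpha>' \<Longrightarrow> \<alpha>' < \<alpha> \<Longrightarrow>
      (\<lambda>n. SUP t\<in>{0..T}. ennreal (opnorm S \<alpha> \<alpha>' (\<lambda>x. An n t \<alpha> \<alpha>' x - A t \<alpha> \<alpha>' x))) \<longlonglongrightarrow> 0"
  shows "uconv {0..T} (\<lambda>n t. flat (An n t)) (\<lambda>t. flat (A t))"
  unfolding uconv_def
proof (intro allI impI)
  fix \<alpha>' \<alpha> e :: real assume \<alpha>: "low S < \<alpha>'" "\<alpha>' < \<alpha>" and e: "e > 0"
  have l: "low S < \<alpha>" using \<alpha> by simp
  have "\<forall>\<^sub>F n in sequentially. (SUP t\<in>{0..max T 1}. ennreal (opnorm S \<alpha> \<alpha>' (\<lambda>x. An n t \<alpha> \<alpha>' x - A t \<alpha> \<alpha>' x))) < ennreal e"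
    using e by (intro order_tendstoD(2)[OF lim[OF _ \<alpha>]]) auto
  then obtain N where N: "\<And>n. n \<ge> N \<Longrightarrow>
      (SUP t\<in>{0..max T 1}. ennreal (opnorm S \<alpha> \<alpha>' (\<lambda>x. An n t \<alpha> \<alpha>' x - A t \<alpha> \<alpha>' x))) < ennreal e"
    unfolding eventually_sequentially by blast
  have "nm \<alpha>' (flat (An n t) x - flat (A t) x) \<le> e * nm \<alpha> x" if n: "n \<ge> N" and t: "t \<in> {0..T}" and x: "x \<in> E \<alpha>" for n t x
  proof -
    have t': "t \<in> {0..max T 1}" "0 \<le> t" using t by auto
    have "ennreal (opnorm S \<alpha> \<alpha>' (\<lambda>x. An n t \<alpha> \<alpha>' x - A t \<alpha> \<alpha>' x)) \<le> ennreal e"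
      using less_imp_le[OF N[OF n]] t'(1) by (meson SUP_upper order_trans)
    then have "opnorm S \<alpha> \<alpha>' (\<lambda>x. flat (An n t) x - flat (A t) x) \<le> e"
      using e unfolding opnorm_flat_diff[OF A(1)[OF t'(2)] A(2)[OF t'(2)] \<alpha>] by (simp add: ennreal_le_iff)
    then have "opnorm S \<alpha> \<alpha>' (\<lambda>x. flat (An n t) x - flat (A t) x) * nm \<alpha> x \<le> e * nm \<alpha> x"
      using nm_nonneg[OF l x] by (rule mult_right_mono)
    moreover have "nm \<alpha>' (flat (An n t) x - flat (A t) x) \<le> opnorm S \<alpha> \<alpha>' (\<lambda>x. flat (An n t) x - flat (A t) x) * nm \<alpha> x"
      by (rule opnorm_bound[OF l \<alpha>(1) bounded_op_diff[OF l \<alpha>(1)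
            opsD[OF flat_ops[OF A(1)[OF t'(2)]] \<alpha>] opsD[OF flat_ops[OF A(2)[OF t'(2)]] \<alpha>]] x])
    ultimately show ?thesis by simp
  qed
  then show "\<exists>N. \<forall>n\<ge>N. \<forall>t\<in>{0..T}. \<forall>x\<in>E \<alpha>. nm \<alpha>' (flat (An n t) x - flat (A t) x) \<le> e * nm \<alpha> x" by blast
qed

lemma pert_uconv:
  assumes bn: "\<And>n. pert M (bn n)" and u: "\<And>T. uconv {0..T} bn b" and b: "\<And>t. 0 \<le> t \<Longrightarrow> b t \<in> ops"
  shows "pert M b"
proof -
  have "opfam {0..T} b" for T
    by (rule opfam_uconv[OF u pertD(3)[OF bn]]) (simp add: b)
  moreover have "nm \<alpha>' (b t k) \<le> M \<alpha> / (\<alpha> - \<alpha>') * nm \<alpha> k"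
    if \<alpha>: "low S < \<alpha>'" "\<alpha>' < \<alpha>" and t: "0 \<le> t" and k: "k \<in> E \<alpha>" for \<alpha>' \<alpha> t k
  proof -
    have bE: "b t k \<in> E \<alpha>'" "bn n t k \<in> E \<alpha>'" for n
      using ops_E[OF b[OF t] \<alpha> k] ops_E[OF opfamD(1)[OF pertD(3)[OF bn, of t n], of t] \<alpha> k] t by auto
    have g: "opfam {0..t} (bn n)" for n by (rule pertD(3)[OF bn])
    have "uniform_limit {0..t} (\<lambda>n t. em \<alpha>' (bn n t k)) (\<lambda>t. em \<alpha>' (b t k)) sequentially"
      by (rule uconv_tendsto[OF u opfamD(1)[OF g] _ \<alpha> k]) (auto intro: b)
    then have "(\<lambda>n. em \<alpha>' (bn n t k)) \<longlonglongrightarrow> em \<alpha>' (b t k)"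
      by (rule tendsto_uniform_limitI) (use t in simp)
    then have "norm (em \<alpha>' (b t k)) \<le> M \<alpha> / (\<alpha> - \<alpha>') * nm \<alpha> k"
      by (rule Lim_norm_ubound[OF sequentially_bot]) (use pertD(4)[OF bn \<alpha> t k] bE \<alpha> in \<open>simp add: norm_em\<close>)
    then show ?thesis using bE \<alpha> by (simp add: norm_em)
  qed
  ultimately show ?thesis using bn[of 0] unfolding pert_def by blast
qed

lemma cond_A1_uconv:
  assumes An: "\<And>n t. 0 \<le> t \<Longrightarrow> An n t \<in> scale_ops S" "\<And>n. cond_A1 S (An n)"
    and A: "\<And>t. 0 \<le> t \<Longrightarrow> A t \<in> scale_ops S"
    and u: "\<And>T. uconv {0..T} (\<lambda>n t. flat (An n t)) (\<lambda>t. flat (A t))"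
  shows "cond_A1 S A"
  unfolding cond_A1_def
proof (intro allI impI)
  fix \<alpha>' \<alpha> t0 :: real assume \<alpha>: "low S < \<alpha>'" "\<alpha>' < \<alpha>" and t0: "0 \<le> t0"
  have l: "low S < \<alpha>" using \<alpha> by simp
  show "((\<lambda>t. opnorm S \<alpha> \<alpha>' (\<lambda>x. A t \<alpha> \<alpha>' x - A t0 \<alpha> \<alpha>' x)) \<longlongrightarrow> 0) (at t0 within {0..})"
  proof (rule tendstoI)
    fix e :: real assume e: "e > 0"
    obtain N where N: "\<And>t x. t \<in> {0..t0 + 1} \<Longrightarrow> x \<in> E \<alpha> \<Longrightarrow> nm \<alpha>' (flat (An N t) x - flat (A t) x) \<le> e / 4 * nm \<alpha> x"
      using uconvD[OF u \<alpha>, of "e / 4" "t0 + 1"] e by (meson divide_pos_pos order_refl zero_less_numeral)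
    have "((\<lambda>t. opnorm S \<alpha> \<alpha>' (\<lambda>x. An N t \<alpha> \<alpha>' x - An N t0 \<alpha> \<alpha>' x)) \<longlongrightarrow> 0) (at t0 within {0..})"
      using An(2)[of N] \<alpha> t0 unfolding cond_A1_def by blast
    then have "\<forall>\<^sub>F t in at t0 within {0..}. opnorm S \<alpha> \<alpha>' (\<lambda>x. An N t \<alpha> \<alpha>' x - An N t0 \<alpha> \<alpha>' x) < e / 4"
      using e by (intro order_tendstoD(2)) auto
    moreover have "\<forall>\<^sub>F t in at t0 within {0..}. t \<in> {0..t0 + 1}"
      unfolding eventually_at by (intro exI[of _ 1]) (auto simp: dist_real_def)
    ultimately show "\<forall>\<^sub>F t in at t0 within {0..}. dist (opnorm S \<alpha> \<alpha>' (\<lambda>x. A t \<alpha> \<alpha>' x - A t0 \<alpha> \<alpha>' x)) 0 < e"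
    proof eventually_elim
      case (elim t)
      then have t: "0 \<le> t" and t0': "t0 \<in> {0..t0 + 1}" using t0 by auto
      note An' = opsD[OF flat_ops[OF An(1)] \<alpha>] and A' = opsD[OF flat_ops[OF A] \<alpha>]
      have "opnorm S \<alpha> \<alpha>' (\<lambda>x. flat (A t) x - flat (A t0) x) \<le> 3 * e / 4"
      proof (rule opnorm_le[OF l])
        fix x assume x: "x \<in> E \<alpha>"
        have nx: "0 \<le> nm \<alpha> x" by (rule nm_nonneg[OF l x])
        have 1: "nm \<alpha>' (flat (An N t) x - flat (An N t0) x) \<le> e / 4 * nm \<alpha> x"
        proof -
          have "nm \<alpha>' (flat (An N t) x - flat (An N t0) x)
              \<le> opnorm S \<alpha> \<alpha>' (\<lambda>x. flat (An N t) x - flat (An N t0) x) * nm \<alpha> x"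
            by (rule opnorm_bound[OF l \<alpha>(1) bounded_op_diff[OF l \<alpha>(1) An'[OF t] An'[OF t0]] x])
          also have "\<dots> \<le> e / 4 * nm \<alpha> x"
            using elim(1) unfolding opnorm_flat_diff[OF An(1)[OF t] An(1)[OF t0] \<alpha>]
            by (intro mult_right_mono nx) simp
          finally show ?thesis .
        qed
        have E: "flat (An N t) x \<in> E \<alpha>'" "flat (An N t0) x \<in> E \<alpha>'" "flat (A t) x \<in> E \<alpha>'" "flat (A t0) x \<in> E \<alpha>'"
          using op_E[OF An'[OF t] x] op_E[OF An'[OF t0] x] op_E[OF A'[OF t] x] op_E[OF A'[OF t0] x] by auto
        have "norm (em \<alpha>' (flat (A t) x) - em \<alpha>' (flat (A t0) x))
          \<le> norm (em \<alpha>' (flat (An N t) x) - em \<alpha>' (flat (A t) x)) + norm (em \<alpha>' (flat (An N t) x) - em \<alpha>' (flat (An N t0) x))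
            + norm (em \<alpha>' (flat (An N t0) x) - em \<alpha>' (flat (A t0) x))"
          unfolding dist_norm[symmetric] by metric
        then show "nm \<alpha>' (flat (A t) x - flat (A t0) x) \<le> 3 * e / 4 * nm \<alpha> x"
          using N[OF elim(2) x] N[OF t0' x] 1 E \<alpha> by (simp add: norm_em_diff)
      qed (use e in simp)
      moreover have "0 \<le> opnorm S \<alpha> \<alpha>' (\<lambda>x. flat (A t) x - flat (A t0) x)"
        by (rule opnorm_nonneg[OF l \<alpha>(1) bounded_op_diff[OF l \<alpha>(1) A'[OF t] A'[OF t0]]])
      ultimately show ?case
        using e unfolding opnorm_flat_diff[OF A[OF t] A[OF t0] \<alpha>] by simp
    qed
  qed
qed

end

section \<open>Perturbed forward families\<close>

lemma fwd_dom_min: "p \<in> fwd_dom (min T T') \<longleftrightarrow> p \<in> fwd_dom T \<and> p \<in> fwd_dom T'"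
  by (auto simp: fwd_dom_def)

context perturbation
begin

lemma fwd_dom_iff:
  assumes \<alpha>: "low S < \<alpha>'" "\<alpha>' < \<alpha>"
  shows "(t, s) \<in> fwd_dom (Tmax K M \<alpha>' \<alpha>) \<longleftrightarrow> 0 \<le> s \<and> s \<le> t \<and> rate \<alpha>' \<alpha> * (t - s) < 1"
proof (cases "M \<alpha> = 0")
  case True
  then show ?thesis using \<alpha> by (simp add: fwd_dom_def Tmax_zero rate_def)
next
  case False
  then have M: "M \<alpha> > 0" using pertD(2)[OF pb, of \<alpha>] \<alpha> by simp
  have "0 < 2 * K * exp 1 * M \<alpha>" using K_ge_1 M by simp
  then show ?thesis
    using \<alpha> by (simp add: fwd_dom_def Tmax_pos[where M=M and \<alpha>=\<alpha>, OF M K_ge_1] rate_def pos_less_divide_eq divide_less_eq mult_ac)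
qed

lemma growth_Tmax:
  assumes \<alpha>: "low S < \<alpha>'" "\<alpha>' < \<alpha>" and \<rho>: "rate \<alpha>' \<alpha> * \<tau> < 1"
  shows "growth (Tmax K M \<alpha>' \<alpha>) \<tau> * ereal K = ereal (K / (1 - rate \<alpha>' \<alpha> * \<tau>))"
proof (cases "M \<alpha> = 0")
  case True
  then show ?thesis using \<alpha> by (simp add: growth_def Tmax_zero rate_def)
next
  case False
  then have M: "M \<alpha> > 0" using pertD(2)[OF pb, of \<alpha>] \<alpha> by simp
  define T where "T = (\<alpha> - \<alpha>') / (2 * K * exp 1 * M \<alpha>)"
  have pos: "0 < 2 * K * exp 1 * M \<alpha>" using K_ge_1 M by simp
  have T: "T > 0" using pos \<alpha> by (simp add: T_def)
  have rT: "rate \<alpha>' \<alpha> = 1 / T" by (simp add: rate_def T_def)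
  have "\<tau> < T" using \<rho> T by (simp add: rT field_simps)
  then have "T / (T - \<tau>) * K = K / (1 - rate \<alpha>' \<alpha> * \<tau>)"
    using T by (simp add: rT field_simps)
  then show ?thesis
    using \<open>\<tau> < T\<close> by (simp add: growth_def Tmax_pos[where M=M and \<alpha>=\<alpha>, OF M K_ge_1] flip: T_def)
qed

lemma perturbed_forward_series:
  assumes V: "\<And>t s. 0 \<le> s \<Longrightarrow> s \<le> t \<Longrightarrow> V t s \<in> scale_ops S" and B: "\<And>t. 0 \<le> t \<Longrightarrow> B t \<in> scale_ops S"
    and vb: "v = (\<lambda>t s. flat (V t s))" "b = (\<lambda>t. flat (B t))"
  shows "perturbed_forward S K M V B (\<lambda>t s _ _. W t s)"
  unfolding perturbed_forward_def
proof (rule conjI; intro allI impI)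
  fix \<alpha>' \<alpha> :: real assume \<alpha>: "low S < \<alpha>'" "\<alpha>' < \<alpha>"
  have l: "low S < \<alpha>" using \<alpha> by simp
  have dom: "fwd_dom (Tmax K M \<alpha>' \<alpha>) = {(t, s). 0 \<le> s \<and> s \<le> t \<and> rate \<alpha>' \<alpha> * (t - s) < 1}"
    using fwd_dom_iff[OF \<alpha>] by auto
  show "(\<forall>(t, s)\<in>fwd_dom (Tmax K M \<alpha>' \<alpha>). W t s \<in> bounded_op S \<alpha> \<alpha>' \<and>
        ereal (opnorm S \<alpha> \<alpha>' (W t s)) \<le> growth (Tmax K M \<alpha>' \<alpha>) (t - s) * ereal K) \<and>
      (\<forall>k\<in>E \<alpha>. (\<forall>t\<ge>0. W t t k = k) \<and>
        continuous_map (top_of_set (fwd_dom (Tmax K M \<alpha>' \<alpha>))) (ntop S \<alpha>') (\<lambda>(t, s). W t s k))"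
  proof (intro conjI ballI allI impI)
    fix p assume "p \<in> fwd_dom (Tmax K M \<alpha>' \<alpha>)"
    then obtain t s where p: "p = (t, s)" "0 \<le> s" "s \<le> t" "rate \<alpha>' \<alpha> * (t - s) < 1"
      unfolding dom by auto
    note * = series_op[OF p(2,3) \<alpha> p(4)]
    have "opnorm S \<alpha> \<alpha>' (W t s) \<le> K / (1 - rate \<alpha>' \<alpha> * (t - s))"
      using K_ge_1 p(4) *(2) by (intro opnorm_le[OF l]) auto
    then show "case p of (t, s) \<Rightarrow> W t s \<in> bounded_op S \<alpha> \<alpha>' \<and>
        ereal (opnorm S \<alpha> \<alpha>' (W t s)) \<le> growth (Tmax K M \<alpha>' \<alpha>) (t - s) * ereal K"
      using *(1) by (simp add: p(1) growth_Tmax[OF \<alpha> p(4)])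
  next
    fix k assume k: "k \<in> E \<alpha>"
    show "W t t k = k" if "0 \<le> t" for t by (rule series_refl[OF l k that])
    have "W t s k \<in> E \<alpha>'" if "0 \<le> s" "s \<le> t" "rate \<alpha>' \<alpha> * (t - s) < 1" for t s
      by (rule series_E[OF that(1,2) \<alpha> k order_refl that(3)])
    then show "continuous_map (top_of_set (fwd_dom (Tmax K M \<alpha>' \<alpha>))) (ntop S \<alpha>') (\<lambda>(t, s). W t s k)"
      unfolding continuous_map_ntop_iff[OF \<alpha>(1)] dom
      using series_continuous[OF \<alpha> k] by (auto simp: case_prod_unfold)
  qed
next
  fix \<alpha>' \<alpha>'' \<alpha> :: real assume \<alpha>: "low S < \<alpha>'" "\<alpha>' < \<alpha>''" "\<alpha>'' < \<alpha>"
  have l: "low S < \<alpha>''" "\<alpha>' < \<alpha>" using \<alpha> by auto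
  have left: "has_integral_in S \<alpha>' s t (\<lambda>r. scale_comp (V t r) (B r) \<alpha>'' \<alpha>' (W r s k)) (W t s k - V t s \<alpha> \<alpha>' k)"
    if k: "k \<in> E \<alpha>" and p: "0 \<le> s" "s \<le> t" "rate \<alpha>' \<alpha> * (t - s) < 1" "rate \<alpha>'' \<alpha> * (t - s) < 1" for k t s
  proof -
    have WE: "W r s k \<in> E \<alpha>''" if r: "r \<in> {s..t}" for r
    proof (rule series_E[OF p(1) _ l(1) \<alpha>(3) k _ p(4)])
      show "rate \<alpha>'' \<alpha> * (r - s) \<le> rate \<alpha>'' \<alpha> * (t - s)"
        using r by (intro rate_time_mono[OF l(1) \<alpha>(3)]) auto
    qed (use r in auto)
    have eq: "scale_comp (V t r) (B r) \<alpha>'' \<alpha>' (W r s k) = v t r (b r (W r s k))" if r: "r \<in> {s..t}" for r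
      unfolding vb(1,2) using r p(1) by (intro scale_comp_flat V B \<alpha> WE[OF r, unfolded vb]) auto
    have in_E: "v t r (b r (W r s k)) \<in> E \<alpha>'" if r: "r \<in> {s..t}" for r
      using r p(1) by (intro ops_E[OF vb_ops \<alpha>(1,2) WE[OF r]]) auto
    have Veq: "V t s \<alpha> \<alpha>' k = v t s k" unfolding vb using flat_eq[OF V[OF p(1,2)] \<alpha>(1) l(2) k] by simp
    have "W t s k - v t s k \<in> E \<alpha>'"
      by (rule E_diff[OF \<alpha>(1) series_E[OF p(1,2) \<alpha>(1) l(2) k order_refl p(3)] evol_E[OF ev p(1,2) \<alpha>(1) l(2) k]])
    then show ?thesis
      using has_integral_eq[OF _ series_left[OF p(1,2) \<alpha> k p(4)], of "\<lambda>r. em \<alpha>' (scale_comp (V t r) (B r) \<alpha>'' \<alpha>' (W r s k))"]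
        eq in_E by (subst has_integral_in_iff[OF \<alpha>(1)]) (auto simp: Veq)
  qed
  have right: "has_integral_in S \<alpha>' s t (\<lambda>r. W t r (scale_comp (B r) (V r s) \<alpha> \<alpha>'' k)) (W t s k - V t s \<alpha> \<alpha>' k)"
    if k: "k \<in> E \<alpha>" and p: "0 \<le> s" "s \<le> t" "rate \<alpha>' \<alpha> * (t - s) < 1" "rate \<alpha>' \<alpha>'' * (t - s) < 1" for k t s
  proof -
    have eq: "scale_comp (B r) (V r s) \<alpha> \<alpha>'' k = b r (v r s k)" if r: "r \<in> {s..t}" for r
      unfolding vb using r p(1) by (intro scale_comp_flat V B l(1) \<alpha>(3) k) auto
    have yE: "b r (v r s k) \<in> E \<alpha>''" if r: "r \<in> {s..t}" for r
      using r p(1) by (intro ops_E[OF ops_compose[OF b_ops evol_ops[OF ev]] l(1) \<alpha>(3) k]) auto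
    have in_E: "W t r (b r (v r s k)) \<in> E \<alpha>'" if r: "r \<in> {s..t}" for r
    proof (rule series_E[OF _ _ \<alpha>(1,2) yE[OF r] _ p(4)])
      show "rate \<alpha>' \<alpha>'' * (t - r) \<le> rate \<alpha>' \<alpha>'' * (t - s)"
        using r by (intro rate_time_mono[OF \<alpha>(1,2)]) auto
    qed (use r p(1) in auto)
    have Veq: "V t s \<alpha> \<alpha>' k = v t s k" unfolding vb using flat_eq[OF V[OF p(1,2)] \<alpha>(1) l(2) k] by simp
    have "W t s k - v t s k \<in> E \<alpha>'"
      by (rule E_diff[OF \<alpha>(1) series_E[OF p(1,2) \<alpha>(1) l(2) k order_refl p(3)] evol_E[OF ev p(1,2) \<alpha>(1) l(2) k]])
    then show ?thesis
      using has_integral_eq[OF _ series_right[OF p(1,2) \<alpha> k p(3,4)], of "\<lambda>r. em \<alpha>' (W t r (scale_comp (B r) (V r s) \<alpha> \<alpha>'' k))"]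
        eq in_E by (subst has_integral_in_iff[OF \<alpha>(1)]) (auto simp: Veq)
  qed
  show "\<forall>k\<in>E \<alpha>. (\<forall>(t, s)\<in>fwd_dom (min (Tmax K M \<alpha>' \<alpha>) (Tmax K M \<alpha>'' \<alpha>)). W t s k = W t s k) \<and>
      (\<forall>(t, s)\<in>fwd_dom (min (Tmax K M \<alpha>' \<alpha>) (Tmax K M \<alpha>' \<alpha>'')). W t s k = W t s k) \<and>
      (\<forall>(t, s)\<in>fwd_dom (min (Tmax K M \<alpha>' \<alpha>) (Tmax K M \<alpha>'' \<alpha>)).
         has_integral_in S \<alpha>' s t (\<lambda>r. scale_comp (V t r) (B r) \<alpha>'' \<alpha>' (W r s k)) (W t s k - V t s \<alpha> \<alpha>' k)) \<and>
      (\<forall>(t, s)\<in>fwd_dom (min (Tmax K M \<alpha>' \<alpha>) (Tmax K M \<alpha>' \<alpha>'')).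
         has_integral_in S \<alpha>' s t (\<lambda>r. W t r (scale_comp (B r) (V r s) \<alpha> \<alpha>'' k)) (W t s k - V t s \<alpha> \<alpha>' k))"
    using left right fwd_dom_iff[OF \<alpha>(1) l(2)] fwd_dom_iff[OF l(1) \<alpha>(3)] fwd_dom_iff[OF \<alpha>(1,2)]
    by (auto simp: fwd_dom_min)
qed

text \<open>The family \<open>Wc\<close> need not consist of restrictions of single maps, but on the relevant times the
  restriction property makes \<open>Wc r s \<alpha> \<beta> k\<close> independent of \<open>\<beta>\<close>. So its difference from the series is one
  function with values in all the spaces between \<open>\<alpha>''\<close> and \<open>\<alpha>'\<close>, to which the lemma on homogeneous
  solutions applies.\<close>
lemma perturbed_forward_unique:
  assumes pf: "perturbed_forward S K M V B Wc"
    and V: "\<And>t s. 0 \<le> s \<Longrightarrow> s \<le> t \<Longrightarrow> V t s \<in> scale_ops S" and B: "\<And>t. 0 \<le> t \<Longrightarrow> B t \<in> scale_ops S"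
    and vb: "v = (\<lambda>t s. flat (V t s))" "b = (\<lambda>t. flat (B t))"
    and \<alpha>: "low S < \<alpha>'" "\<alpha>' < \<alpha>" and p: "(t, s) \<in> fwd_dom (Tmax K M \<alpha>' \<alpha>)" and k: "k \<in> E \<alpha>"
  shows "Wc t s \<alpha> \<alpha>' k = W t s k"
proof -
  have st: "0 \<le> s" "s \<le> t" "rate \<alpha>' \<alpha> * (t - s) < 1" using p fwd_dom_iff[OF \<alpha>] by auto
  (* the domain condition is open, so (t, s) is admissible also for some \<alpha>'' slightly above \<alpha>' *)
  have "((\<lambda>\<beta>. rate \<beta> \<alpha> * (t - s)) \<longlongrightarrow> rate \<alpha>' \<alpha> * (t - s)) (at_right \<alpha>')"
    unfolding rate_def using \<alpha> by (intro tendsto_intros) auto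
  then have "\<forall>\<^sub>F \<beta> in at_right \<alpha>'. rate \<beta> \<alpha> * (t - s) < 1" by (rule order_tendstoD(2)[OF _ st(3)])
  moreover have "\<forall>\<^sub>F \<beta> in at_right \<alpha>'. \<alpha>' < \<beta> \<and> \<beta> < \<alpha>"
    unfolding eventually_at_right[OF \<alpha>(2)] using \<alpha>(2) by blast
  ultimately have "\<exists>\<beta>. rate \<beta> \<alpha> * (t - s) < 1 \<and> \<alpha>' < \<beta> \<and> \<beta> < \<alpha>"
    using eventually_happens'[OF trivial_limit_at_right_real] eventually_conj by blast
  then obtain \<alpha>'' where \<alpha>'': "rate \<alpha>'' \<alpha> * (t - s) < 1" "\<alpha>' < \<alpha>''" "\<alpha>'' < \<alpha>" by blast
  have l: "low S < \<alpha>''" "low S < \<alpha>" using \<alpha> \<alpha>'' by auto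
  define \<rho> where "\<rho> = rate \<alpha>'' \<alpha> * (t - s)"
  have \<rho>: "\<rho> < 1" using \<alpha>'' by (simp add: \<rho>_def)
  have nk: "0 \<le> nm \<alpha> k" by (rule nm_nonneg[OF l(2) k])
  have rho: "rate \<beta> \<alpha> * (r - s) \<le> \<rho>" if "r \<in> {s..t}" "\<alpha>' \<le> \<beta>" "\<beta> \<le> \<alpha>''" for r \<beta>
  proof -
    have "rate \<beta> \<alpha> * (r - s) \<le> rate \<alpha>'' \<alpha> * (r - s)" using that \<alpha> \<alpha>'' by (intro rate_mono) auto
    also have "\<dots> \<le> \<rho>" unfolding \<rho>_def using that by (intro rate_time_mono l \<alpha>'') auto
    finally show ?thesis .
  qed
  have dom: "(r, s) \<in> fwd_dom (Tmax K M \<beta> \<alpha>)" if "r \<in> {s..t}" "\<alpha>' \<le> \<beta>" "\<beta> \<le> \<alpha>''" for r \<beta>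
    using rho[OF that] \<rho> st that \<alpha> \<alpha>'' by (subst fwd_dom_iff) auto
  note pf1 = conjunct1[OF pf[unfolded perturbed_forward_def], rule_format]
  note pf2 = conjunct2[OF pf[unfolded perturbed_forward_def], rule_format]
  have op: "Wc r s \<alpha> \<beta> \<in> bounded_op S \<alpha> \<beta>"
    "ereal (opnorm S \<alpha> \<beta> (Wc r s \<alpha> \<beta>)) \<le> growth (Tmax K M \<beta> \<alpha>) (r - s) * ereal K"
    if "r \<in> {s..t}" "\<alpha>' \<le> \<beta>" "\<beta> \<le> \<alpha>''" for r \<beta>
    using bspec[OF conjunct1[OF pf1[of \<beta> \<alpha>]] dom[OF that]] that \<alpha> \<alpha>'' by auto
  have restr: "Wc r s \<alpha> \<beta> k = Wc r s \<alpha> \<alpha>' k" if "r \<in> {s..t}" "\<alpha>' \<le> \<beta>" "\<beta> \<le> \<alpha>''" for r \<beta>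
  proof (cases "\<beta> = \<alpha>'")
    case False
    then have \<beta>: "\<alpha>' < \<beta>" "\<beta> < \<alpha>" using that \<alpha>'' by auto
    have "(r, s) \<in> fwd_dom (min (Tmax K M \<alpha>' \<alpha>) (Tmax K M \<beta> \<alpha>))"
      using dom[OF that] dom[OF that(1) order_refl] \<alpha>'' by (simp add: fwd_dom_min)
    from bspec[OF conjunct1[OF pf2[OF \<alpha>(1) \<beta> k]] this] show ?thesis by simp
  qed simp
  define C where "C = K / (1 - \<rho>) * nm \<alpha> k + K / (1 - \<rho>) * nm \<alpha> k"
  have C: "0 \<le> C" using K_ge_1 \<rho> nk by (simp add: C_def)
  have WE: "W r s k \<in> E \<beta>" if "r \<in> {s..t}" "\<alpha>' \<le> \<beta>" "\<beta> \<le> \<alpha>''" for r \<beta>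
    by (rule series_E[OF st(1) _ _ _ k rho[OF that] \<rho>]) (use that \<alpha> \<alpha>'' in auto)
  have WcE: "Wc r s \<alpha> \<alpha>' k \<in> E \<beta>" if "r \<in> {s..t}" "\<alpha>' \<le> \<beta>" "\<beta> \<le> \<alpha>''" for r \<beta>
    using op_E[OF op(1)[OF that] k] restr[OF that] by simp
  have bound: "nm \<beta> (Wc r s \<alpha> \<alpha>' k) \<le> K / (1 - \<rho>) * nm \<alpha> k" "nm \<beta> (W r s k) \<le> K / (1 - \<rho>) * nm \<alpha> k"
    if b: "r \<in> {s..t}" "\<alpha>' \<le> \<beta>" "\<beta> \<le> \<alpha>''" for r \<beta>
  proof -
    have \<beta>: "low S < \<beta>" "\<beta> < \<alpha>" using b \<alpha> \<alpha>'' by auto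
    have r1: "rate \<beta> \<alpha> * (r - s) < 1" using rho[OF b] \<rho> by simp
    have frac: "K / (1 - rate \<beta> \<alpha> * (r - s)) * nm \<alpha> k \<le> K / (1 - \<rho>) * nm \<alpha> k"
      using K_ge_1 \<rho> rho[OF b] by (intro mult_right_mono divide_left_mono nk) auto
    have "opnorm S \<alpha> \<beta> (Wc r s \<alpha> \<beta>) \<le> K / (1 - rate \<beta> \<alpha> * (r - s))"
      using op(2)[OF b] unfolding growth_Tmax[OF \<beta> r1] by simp
    then have "opnorm S \<alpha> \<beta> (Wc r s \<alpha> \<beta>) * nm \<alpha> k \<le> K / (1 - rate \<beta> \<alpha> * (r - s)) * nm \<alpha> k"
      by (rule mult_right_mono[OF _ nk])
    then show "nm \<beta> (Wc r s \<alpha> \<alpha>' k) \<le> K / (1 - \<rho>) * nm \<alpha> k"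
      using opnorm_bound[OF l(2) \<beta>(1) op(1)[OF b] k] frac restr[OF b] by simp
    show "nm \<beta> (W r s k) \<le> K / (1 - \<rho>) * nm \<alpha> k"
      using series_op(2)[OF st(1) _ \<beta> r1 k] b frac by simp
  qed
  have "Wc t s \<alpha> \<alpha>' k - W t s k = 0"
  proof (rule homogeneous_solution_zero[where z="\<lambda>r. Wc r s \<alpha> \<alpha>' k - W r s k" and t=t, OF st(1) \<alpha>(1) \<alpha>''(2) C])
    fix r \<beta> assume r: "r \<in> {s..t}" and \<beta>: "\<alpha>' \<le> \<beta>" "\<beta> < \<alpha>''"
    have lb: "low S < \<beta>" "\<beta> < \<alpha>" using \<alpha> \<alpha>'' \<beta> by auto
    note E1 = WcE[OF r \<beta>(1) less_imp_le[OF \<beta>(2)]] and E2 = WE[OF r \<beta>(1) less_imp_le[OF \<beta>(2)]]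
    show "Wc r s \<alpha> \<alpha>' k - W r s k \<in> E \<beta>" by (rule E_diff[OF lb(1) E1 E2])
    have "norm (em \<beta> (Wc r s \<alpha> \<alpha>' k) - em \<beta> (W r s k)) \<le> norm (em \<beta> (Wc r s \<alpha> \<alpha>' k)) + norm (em \<beta> (W r s k))"
      by (rule norm_triangle_ineq4)
    then show "nm \<beta> (Wc r s \<alpha> \<alpha>' k - W r s k) \<le> C"
      using bound[OF r \<beta>(1) less_imp_le[OF \<beta>(2)]] E1 E2 lb by (simp add: norm_em norm_em_diff C_def)
    have r': "s \<le> r" "r \<le> t" using r by auto
    have sub: "u \<in> {s..t}" if "u \<in> {s..r}" for u using that r' by auto
    have vbop: "(\<lambda>x. v r u (b u x)) \<in> bounded_op S \<alpha>'' \<beta>" if "u \<in> {s..r}" for u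
      using that st by (intro opsD[OF vb_ops] lb \<beta>) auto
    have Eu: "Wc u s \<alpha> \<alpha>' k \<in> E \<alpha>''" "W u s k \<in> E \<alpha>''" if "u \<in> {s..r}" for u
      using WcE[OF sub[OF that] _ order_refl] WE[OF sub[OF that] _ order_refl] \<alpha>''(2) by auto
    have eq: "scale_comp (V r u) (B u) \<alpha>'' \<beta> (Wc u s \<alpha> \<alpha>'' k) = v r u (b u (Wc u s \<alpha> \<alpha>' k))" if u: "u \<in> {s..r}" for u
      using restr[OF sub[OF u] _ order_refl] \<alpha>''(2) scale_comp_flat[OF V B lb(1) \<beta>(2) Eu(1)[OF u]] u st
      by (simp add: vb)
    have "(r, s) \<in> fwd_dom (min (Tmax K M \<beta> \<alpha>) (Tmax K M \<alpha>'' \<alpha>))"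
      using dom[OF r \<beta>(1) less_imp_le[OF \<beta>(2)]] dom[OF r _ order_refl] \<alpha>''(2) by (simp add: fwd_dom_min)
    from bspec[OF conjunct1[OF conjunct2[OF conjunct2[OF pf2[OF lb(1) \<beta>(2) \<alpha>''(3) k]]]] this]
    have "has_integral_in S \<beta> s r (\<lambda>u. scale_comp (V r u) (B u) \<alpha>'' \<beta> (Wc u s \<alpha> \<alpha>'' k)) (Wc r s \<alpha> \<beta> k - V r s \<alpha> \<beta> k)"
      by simp
    then have "((\<lambda>u. em \<beta> (scale_comp (V r u) (B u) \<alpha>'' \<beta> (Wc u s \<alpha> \<alpha>'' k))) has_integral em \<beta> (Wc r s \<alpha> \<beta> k - V r s \<alpha> \<beta> k)) {s..r}"
      by (subst (asm) has_integral_in_iff[OF lb(1)]) (use eq op_E[OF vbop Eu(1)] in auto)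
    then have "((\<lambda>u. em \<beta> (v r u (b u (Wc u s \<alpha> \<alpha>' k)))) has_integral em \<beta> (Wc r s \<alpha> \<beta> k - V r s \<alpha> \<beta> k)) {s..r}"
      by (rule has_integral_eq[rotated]) (simp only: eq)
    moreover have "Wc r s \<alpha> \<beta> k - V r s \<alpha> \<beta> k = Wc r s \<alpha> \<alpha>' k - v r s k"
      using restr[OF r \<beta>(1) less_imp_le[OF \<beta>(2)]] flat_eq[OF V[OF st(1) r'(1)] lb k] by (simp add: vb)
    ultimately have I1: "((\<lambda>u. em \<beta> (v r u (b u (Wc u s \<alpha> \<alpha>' k)))) has_integral em \<beta> (Wc r s \<alpha> \<alpha>' k - v r s k)) {s..r}" by simp
    have "rate \<alpha>'' \<alpha> * (r - s) < 1" using rho[OF r less_imp_le[OF \<alpha>''(2)] order_refl] \<rho> by simp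
    note I2 = series_left[OF st(1) r'(1) lb(1) \<beta>(2) \<alpha>''(3) k this]
    have "((\<lambda>u. em \<beta> (v r u (b u (Wc u s \<alpha> \<alpha>' k))) - em \<beta> (v r u (b u (W u s k)))) has_integral
        em \<beta> (Wc r s \<alpha> \<alpha>' k - v r s k) - em \<beta> (W r s k - v r s k)) {s..r}"
      by (rule has_integral_diff[OF I1 I2])
    then have "((\<lambda>u. em \<beta> (v r u (b u (Wc u s \<alpha> \<alpha>' k))) - em \<beta> (v r u (b u (W u s k)))) has_integral
        em \<beta> (Wc r s \<alpha> \<alpha>' k - W r s k)) {s..r}"
      by (simp add: em_diff lb)
    then show "((\<lambda>u. em \<beta> (v r u (b u (Wc u s \<alpha> \<alpha>' k - W u s k)))) has_integral em \<beta> (Wc r s \<alpha> \<alpha>' k - W r s k)) {s..r}"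
      by (rule has_integral_eq[rotated]) (simp add: op_diff[OF vbop l(1) Eu] em_diff lb)
  qed (use st in auto)
  then show ?thesis by simp
qed

end

context bscale
begin

section \<open>Convergence of the perturbed families\<close>

lemma uconv_tri3:
  assumes "uconv (tri2 T) (\<lambda>n (t, s). fn n t s) (\<lambda>(t, s). f t s)"
  shows "uconv (tri3 T) (\<lambda>n (t, r, s). fn n t r) (\<lambda>(t, r, s). f t r)"
    "uconv (tri3 T) (\<lambda>n (t, r, s). fn n r s) (\<lambda>(t, r, s). f r s)"
  using uconv_reindex[OF assms, of "\<lambda>p. (fst p, fst (snd p))" "tri3 T"] uconv_reindex[OF assms, of snd "tri3 T"]
  by (auto simp: tri2_def tri3_def case_prod_unfold image_subset_iff)

lemma uconv_tri3_middle:
  assumes "uconv {0..T} fn f"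
  shows "uconv (tri3 T) (\<lambda>n (t, r, s). fn n r) (\<lambda>(t, r, s). f r)"
  using uconv_reindex[OF assms, of "\<lambda>p. fst (snd p)" "tri3 T"]
  by (auto simp: tri3_def case_prod_unfold image_subset_iff)

lemma uconv_w:
  assumes pn: "\<And>n. perturbation S K M (vn n) (bn n)" and p: "perturbation S K M v b"
    and uv: "uconv (tri2 T) (\<lambda>n (t, s). vn n t s) (\<lambda>(t, s). v t s)" and ub: "uconv {0..T} bn b"
  shows "uconv (tri2 T) (\<lambda>n (t, s). w (vn n) (bn n) j t s) (\<lambda>(t, s). w v b j t s)"
proof (induction j)
  case 0
  show ?case using uv by simp
next
  case (Suc j)
  interpret P: perturbation S K M v b by (rule p)
  interpret Pn: perturbation S K M "vn n" "bn n" for n by (rule pn)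
  note gv = opfam_tri3_outer[OF evol_opfam[OF P.ev], of T] and gvn = opfam_tri3_outer[OF evol_opfam[OF Pn.ev], of T]
  note gb = opfam_tri3_middle[OF pertD(3)[OF P.pb], of T] and gbn = opfam_tri3_middle[OF pertD(3)[OF Pn.pb], of T]
  note gw = opfam_tri3_inner[OF P.opfam_w, of T j] and gwn = opfam_tri3_inner[OF Pn.opfam_w, of T _ j]
  note u1 = uconv_tri3(1)[OF uv] and u2 = uconv_tri3_middle[OF ub] and u3 = uconv_tri3(2)[OF Suc]
  have "uconv (tri3 T) (\<lambda>n p x. (case p of (t, r, s) \<Rightarrow> bn n r) ((case p of (t, r, s) \<Rightarrow> w (vn n) (bn n) j r s) x))
      (\<lambda>p x. (case p of (t, r, s) \<Rightarrow> b r) ((case p of (t, r, s) \<Rightarrow> w v b j r s) x))" (is "uconv _ ?fn ?f")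
    by (rule uconv_compose[OF u2 u3 equi_uconv(1)[OF u2 opfamD(1)[OF gbn] opfamD(1)[OF gb] opfamD(3)[OF gbn]]
          opfamD(3)[OF gw] opfamD(1)[OF gbn] opfamD(1)[OF gb] opfamD(1)[OF gwn] opfamD(1)[OF gw]])
  from uconv_compose[OF u1 this equi_uconv(1)[OF u1 opfamD(1)[OF gvn] opfamD(1)[OF gv] opfamD(3)[OF gvn]]
      opfamD(3)[OF opfam_compose[OF gb gw]] opfamD(1)[OF gvn] opfamD(1)[OF gv] opfamD(1)[OF opfam_compose[OF gbn gwn]]
      opfamD(1)[OF opfam_compose[OF gb gw]]]
  have "uconv (tri3 T) (\<lambda>n (t, r, s) k. vn n t r (bn n r (w (vn n) (bn n) j r s k))) (\<lambda>(t, r, s) k. v t r (b r (w v b j r s k)))"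
    by (simp add: case_prod_unfold)
  from uconv_integral[OF Pn.opfam_w_integrand[OF Pn.opfam_w] P.opfam_w_integrand[OF P.opfam_w] this]
  have "uconv (tri2 T) (\<lambda>n (t, s) k. w (vn n) (bn n) (Suc j) t s k) (\<lambda>(t, s) k. w v b (Suc j) t s k)"
    by (simp add: case_prod_unfold)
  then show ?case by (simp add: case_prod_unfold)
qed

lemma uconv_zero: "uconv X (\<lambda>n p x. 0) (\<lambda>p x. 0)"
  unfolding uconv_def
proof (intro allI impI)
  fix \<alpha>' \<alpha> e :: real assume \<alpha>: "low S < \<alpha>'" "\<alpha>' < \<alpha>" "e > 0"
  then have "low S < \<alpha>" by simp
  then show "\<exists>N. \<forall>n\<ge>N. \<forall>p\<in>X. \<forall>x\<in>E \<alpha>. nm \<alpha>' (0 - 0) \<le> e * nm \<alpha> x"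
    using \<alpha> nm_nonneg by (simp add: nm_zero)
qed

lemma uconv_add:
  assumes u: "uconv X fn f" "uconv X gn g"
    and ops: "\<And>n p. p \<in> X \<Longrightarrow> fn n p \<in> ops" "\<And>p. p \<in> X \<Longrightarrow> f p \<in> ops"
      "\<And>n p. p \<in> X \<Longrightarrow> gn n p \<in> ops" "\<And>p. p \<in> X \<Longrightarrow> g p \<in> ops"
  shows "uconv X (\<lambda>n p x. fn n p x + gn n p x) (\<lambda>p x. f p x + g p x)"
  unfolding uconv_def
proof (intro allI impI)
  fix \<alpha>' \<alpha> e :: real assume \<alpha>: "low S < \<alpha>'" "\<alpha>' < \<alpha>" and e: "e > 0"
  then have e2: "e / 2 > 0" by simp
  obtain N1 where N1: "\<forall>n\<ge>N1. \<forall>p\<in>X. \<forall>x\<in>E \<alpha>. nm \<alpha>' (fn n p x - f p x) \<le> e / 2 * nm \<alpha> x"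
    using uconvD[OF u(1) \<alpha> e2] by blast
  obtain N2 where N2: "\<forall>n\<ge>N2. \<forall>p\<in>X. \<forall>x\<in>E \<alpha>. nm \<alpha>' (gn n p x - g p x) \<le> e / 2 * nm \<alpha> x"
    using uconvD[OF u(2) \<alpha> e2] by blast
  have "nm \<alpha>' (fn n p x + gn n p x - (f p x + g p x)) \<le> e * nm \<alpha> x" if n: "n \<ge> max N1 N2" and p: "p \<in> X" and x: "x \<in> E \<alpha>" for n p x
  proof -
    have "fn n p x + gn n p x - (f p x + g p x) = (fn n p x - f p x) + (gn n p x - g p x)" by simp
    also have "nm \<alpha>' \<dots> \<le> nm \<alpha>' (fn n p x - f p x) + nm \<alpha>' (gn n p x - g p x)"
      by (intro nm_add E_diff \<alpha> ops_E[OF ops(1)[OF p] \<alpha> x] ops_E[OF ops(2)[OF p] \<alpha> x]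
          ops_E[OF ops(3)[OF p] \<alpha> x] ops_E[OF ops(4)[OF p] \<alpha> x])
    also have "\<dots> \<le> e / 2 * nm \<alpha> x + e / 2 * nm \<alpha> x" using N1 N2 n p x by (intro add_mono) auto
    finally show ?thesis by simp
  qed
  then show "\<exists>N. \<forall>n\<ge>N. \<forall>p\<in>X. \<forall>x\<in>E \<alpha>. nm \<alpha>' (fn n p x + gn n p x - (f p x + g p x)) \<le> e * nm \<alpha> x" by blast
qed

lemma uconv_psum:
  assumes pn: "\<And>n. perturbation S K M (vn n) (bn n)" and p: "perturbation S K M v b"
    and uv: "uconv (tri2 T) (\<lambda>n (t, s). vn n t s) (\<lambda>(t, s). v t s)" and ub: "uconv {0..T} bn b"
  shows "uconv (tri2 T) (\<lambda>n (t, s). psum (vn n) (bn n) N t s) (\<lambda>(t, s). psum v b N t s)"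
proof (induction N)
  case 0
  show ?case using uconv_zero[of "tri2 T"] by (simp add: psum_def[abs_def] case_prod_unfold)
next
  case (Suc N)
  note g1 = perturbation.opfam_psum[OF pn] and g2 = perturbation.opfam_psum[OF p]
  note g3 = perturbation.opfam_w[OF pn] and g4 = perturbation.opfam_w[OF p]
  from uconv_add[OF Suc uconv_w[OF pn p uv ub] opfamD(1)[OF g1] opfamD(1)[OF g2] opfamD(1)[OF g3] opfamD(1)[OF g4]]
  show ?case by (simp add: psum_def[abs_def] case_prod_unfold)
qed

text \<open>Three parts: the tails of both series, which have one geometric majorant, and a partial sum of fixed
  length, which converges in operator norm.\<close>
theorem series_convergent:
  assumes pn: "\<And>n. perturbation S K M (vn n) (bn n)" and p: "perturbation S K M v b"
    and uv: "uconv (tri2 T) (\<lambda>n (t, s). vn n t s) (\<lambda>(t, s). v t s)" and ub: "uconv {0..T} bn b"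
    and \<alpha>: "low S < \<alpha>'" "\<alpha>' < \<alpha>" and k: "k \<in> E \<alpha>" and \<rho>: "0 \<le> \<rho>" "\<rho> < 1" and e: "0 < e"
    and \<Delta>: "\<And>t s. (t, s) \<in> \<Delta> \<Longrightarrow> (t, s) \<in> tri2 T \<and> perturbation.rate K M \<alpha>' \<alpha> * (t - s) \<le> \<rho>"
  shows "\<exists>N. \<forall>n\<ge>N. \<forall>(t, s)\<in>\<Delta>. nm \<alpha>' (series (vn n) (bn n) t s k - series v b t s k) \<le> e"
proof -
  interpret P: perturbation S K M v b by (rule p)
  interpret Pn: perturbation S K M "vn n" "bn n" for n by (rule pn)
  have l: "low S < \<alpha>" using \<alpha> by simp
  define c where "c = K * nm \<alpha> k / (1 - \<rho>)"
  have nk: "0 \<le> nm \<alpha> k" by (rule nm_nonneg[OF l k])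
  have "(\<lambda>J. c * \<rho> ^ J) \<longlonglongrightarrow> c * 0"
    by (intro tendsto_mult tendsto_const LIMSEQ_power_zero) (use \<rho> in simp)
  then have "\<forall>\<^sub>F J in sequentially. c * \<rho> ^ J < e / 3" using e by (intro order_tendstoD(2)) auto
  then obtain J where J: "c * \<rho> ^ J < e / 3" unfolding eventually_sequentially by blast
  define d where "d = e / (3 * (nm \<alpha> k + 1))"
  have d: "d > 0" "d * nm \<alpha> k \<le> e / 3" using e nk by (auto simp: d_def field_simps)
  obtain N where N: "\<And>n p x. n \<ge> N \<Longrightarrow> p \<in> tri2 T \<Longrightarrow> x \<in> E \<alpha> \<Longrightarrow>
      nm \<alpha>' ((case p of (t, s) \<Rightarrow> psum (vn n) (bn n) J t s) x - (case p of (t, s) \<Rightarrow> psum v b J t s) x) \<le> d * nm \<alpha> x"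
    using uconvD[OF uconv_psum[OF pn p uv ub, of J] \<alpha> d(1)] by blast
  have "nm \<alpha>' (series (vn n) (bn n) t s k - series v b t s k) \<le> e" if n: "n \<ge> N" and ts: "(t, s) \<in> \<Delta>" for n t s
  proof -
    have t: "(t, s) \<in> tri2 T" "P.rate \<alpha>' \<alpha> * (t - s) \<le> \<rho>" using \<Delta>[OF ts] by auto
    then have st: "0 \<le> s" "s \<le> t" by (auto simp: tri2_def)
    note 1 = P.series_convergence[OF st \<alpha> k t(2) \<rho>(2)] and 2 = Pn.series_convergence[OF st \<alpha> k t(2) \<rho>(2), of n]
    note E1 = 1(1) and E2 = 2(1) and E3 = P.psum_E[OF st \<alpha> k, of J] and E4 = Pn.psum_E[OF st \<alpha> k, of n J]
    have "norm (em \<alpha>' (series (vn n) (bn n) t s k) - em \<alpha>' (series v b t s k))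
        \<le> norm (em \<alpha>' (psum (vn n) (bn n) J t s k) - em \<alpha>' (series (vn n) (bn n) t s k))
        + norm (em \<alpha>' (psum (vn n) (bn n) J t s k) - em \<alpha>' (psum v b J t s k))
        + norm (em \<alpha>' (psum v b J t s k) - em \<alpha>' (series v b t s k))"
      unfolding dist_norm[symmetric] by metric
    moreover have "nm \<alpha>' (psum (vn n) (bn n) J t s k - psum v b J t s k) \<le> d * nm \<alpha> k"
      using N[OF n t(1) k] by simp
    ultimately show ?thesis
      using 1(3)[of J] 2(3)[of J] J d(2) E1 E2 E3 E4 \<alpha> by (simp add: norm_em_diff c_def)
  qed
  then show ?thesis by (intro exI[of _ N]) auto
qed

end

theorem theorem3p8:
  fixes S :: "('k::real_normed_field, 'a::real_vector) scale"
    and K :: real and M :: "real \<Rightarrow> real"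
    and An Bn :: "nat \<Rightarrow> real \<Rightarrow> 'a coll" and Vn :: "nat \<Rightarrow> real \<Rightarrow> real \<Rightarrow> 'a coll"
    and A B :: "real \<Rightarrow> 'a coll"
  assumes scale: "banach_scale S"
    and S1: "\<And>n. (\<forall>t\<ge>0. An n t \<in> scale_ops S) \<and> cond_A1 S (An n)"
    and S2: "\<And>n. cond_A2 S (Vn n) \<and> cond_A3 S (An n) (Vn n) \<and> cond_A4 S K (Vn n)"
    and S3: "\<And>n. (\<forall>t\<ge>0. Bn n t \<in> scale_ops S) \<and> cond_B1 S (Bn n) \<and> cond_B2 S M (Bn n)"
    and A_ops: "\<forall>t\<ge>0. A t \<in> scale_ops S"
    and B_ops: "\<forall>t\<ge>0. B t \<in> scale_ops S"
    and B_lim: "\<And>T \<alpha>' \<alpha>. 0 < T \<Longrightarrow> low S < \<alpha>' \<Longrightarrow> \<alpha>' < \<alpha> \<Longrightarrow>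
      (\<lambda>n. SUP t\<in>{0..T}. ennreal (opnorm S \<alpha> \<alpha>' (\<lambda>x. Bn n t \<alpha> \<alpha>' x - B t \<alpha> \<alpha>' x)))
        \<longlonglongrightarrow> 0"
    and A_lim: "\<And>T \<alpha>' \<alpha>. 0 < T \<Longrightarrow> low S < \<alpha>' \<Longrightarrow> \<alpha>' < \<alpha> \<Longrightarrow>
      (\<lambda>n. SUP t\<in>{0..T}. ennreal (opnorm S \<alpha> \<alpha>' (\<lambda>x. An n t \<alpha> \<alpha>' x - A t \<alpha> \<alpha>' x)))
        \<longlonglongrightarrow> 0"
  shows "cond_A1 S A \<and> cond_B1 S B \<and> cond_B2 S M B \<and>
    (\<exists>V. cond_A2 S V \<and> cond_A3 S A V \<and> cond_A4 S K V \<and>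
      (\<forall>n. \<exists>Wn. perturbed_forward S K M (Vn n) (Bn n) Wn) \<and>
      (\<exists>W. perturbed_forward S K M V B W) \<and>
      (\<forall>Wn W. (\<forall>n. perturbed_forward S K M (Vn n) (Bn n) (Wn n)) \<longrightarrow>
        perturbed_forward S K M V B W \<longrightarrow>
        (\<forall>\<alpha>' \<alpha> \<Delta> k. low S < \<alpha>' \<longrightarrow> \<alpha>' < \<alpha> \<longrightarrow>
          compact \<Delta> \<longrightarrow> \<Delta> \<subseteq> fwd_dom (Tmax K M \<alpha>' \<alpha>) \<longrightarrow> k \<in> sp S \<alpha> \<longrightarrow>
          (\<lambda>n. SUP (t, s)\<in>\<Delta>. ennreal (nrm S \<alpha>' (Wn n t s \<alpha> \<alpha>' k - W t s \<alpha> \<alpha>' k)))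
            \<longlonglongrightarrow> 0)))"
proof -
  interpret bscale S by unfold_locales (rule scale)
  have An: "An n t \<in> scale_ops S" and Bn: "Bn n t \<in> scale_ops S" if "0 \<le> t" for n t
    using S1[of n] S3[of n] that by blast+
  have Vn: "Vn n t s \<in> scale_ops S" if "0 \<le> s" "s \<le> t" for n t s
    using S2[of n] that unfolding cond_A2_def by blast
  have A: "A t \<in> scale_ops S" and B: "B t \<in> scale_ops S" if "0 \<le> t" for t
    using A_ops B_ops that by blast+
  define vn where "vn n = (\<lambda>t s. flat (Vn n t s))" for n
  define bn where "bn n = (\<lambda>t. flat (Bn n t))" for n
  define b where "b = (\<lambda>t. flat (B t))"
  have evn: "evol K (vn n)" for n unfolding vn_def using S2[of n] by (intro evol_flat) blast+
  have gen: "generates (\<lambda>t. flat (An n t)) (vn n)" for n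
    unfolding vn_def by (rule generates_flat[OF _ An Vn]) (use S2[of n] in blast)
  have gan: "opfam {0..T} (\<lambda>t. flat (An n t))" for n T
    by (rule opfam_A1[OF An]) (use S1[of n] in blast)+
  have pbn: "pert M (bn n)" for n
    unfolding bn_def by (rule pert_flat[OF Bn]) (use S3[of n] in blast)+
  have ua: "uconv {0..T} (\<lambda>n t. flat (An n t)) (\<lambda>t. flat (A t))" for T
    by (rule uconv_flat[OF An A A_lim])
  have ub: "uconv {0..T} bn b" for T
    unfolding bn_def b_def by (rule uconv_flat[OF Bn B B_lim])
  have pb: "pert M b"
    by (rule pert_uconv[OF pbn ub]) (simp add: b_def flat_ops B)
  have A1: "cond_A1 S A"
    by (rule cond_A1_uconv[OF An conjunct2[OF S1] A ua])
  have Mcont: "continuous_on {low S<..} M" using S3[of 0] unfolding cond_B2_def by blast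
  have B12: "cond_B1 S B" "cond_B2 S M B"
    using pert_conds[OF pb[unfolded b_def] B Mcont] by blast+
  obtain v0 where v0: "evol K v0" "generates (\<lambda>t. flat (A t)) v0"
      and uv0: "\<And>T. uconv (tri2 T) (\<lambda>n (t, s). vn n t s) (\<lambda>(t, s). v0 t s)"
    using evol_limit[OF evn gen gan ua flat_ops[OF A]] by blast
  (* the limit is a family of single maps; as a collection it is independent of both indices *)
  define V where "V = (\<lambda>t s (_::real) (_::real). v0 t s)"
  have A24: "cond_A2 S V" "cond_A4 S K V" unfolding V_def by (rule evol_conds[OF v0(1)])+
  have A3: "cond_A3 S A V" unfolding V_def by (rule cond_A3_generates[OF v0(2) A v0(1)])
  have V: "V t s \<in> scale_ops S" if "0 \<le> s" "s \<le> t" for t s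
    using A24(1) that unfolding cond_A2_def by blast
  define v where "v = (\<lambda>t s. flat (V t s))"
  have ev: "evol K v" unfolding v_def by (rule evol_flat[OF A24])
  have uv: "uconv (tri2 T) (\<lambda>n (t, s). vn n t s) (\<lambda>(t, s). v t s)" for T
    by (rule uconv_cong[OF uv0]) (auto simp: v_def V_def tri2_def flat_const[OF evol_ops[OF v0(1)]])
  have p: "perturbation S K M v b" by unfold_locales (rule ev pb)+
  have pn: "perturbation S K M (vn n) (bn n)" for n by unfold_locales (rule evn pbn)+
  have ex_n: "\<exists>Wn. perturbed_forward S K M (Vn n) (Bn n) Wn" for n
    using perturbation.perturbed_forward_series[OF pn Vn Bn vn_def bn_def] by blast
  have ex: "\<exists>W. perturbed_forward S K M V B W"
    using perturbation.perturbed_forward_series[OF p V B v_def b_def] by blast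
  have conv: "(\<lambda>n. SUP (t, s)\<in>\<Delta>. ennreal (nrm S \<alpha>' (Wn n t s \<alpha> \<alpha>' k - W t s \<alpha> \<alpha>' k))) \<longlonglongrightarrow> 0"
    if Wn: "\<forall>n. perturbed_forward S K M (Vn n) (Bn n) (Wn n)" and W: "perturbed_forward S K M V B W"
      and \<alpha>: "low S < \<alpha>'" "\<alpha>' < \<alpha>" and \<Delta>: "compact \<Delta>" "\<Delta> \<subseteq> fwd_dom (Tmax K M \<alpha>' \<alpha>)" and k: "k \<in> sp S \<alpha>"
    for Wn W \<alpha>' \<alpha> \<Delta> k
  proof (cases "\<Delta> = {}")
    case True
    then show ?thesis by (simp add: bot_ennreal)
  next
    case False
    interpret P: perturbation S K M v b by (rule p)
    let ?r = "\<lambda>q. P.rate \<alpha>' \<alpha> * (fst q - snd q)"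
    have rc: "continuous_on \<Delta> ?r" "continuous_on \<Delta> fst" by (intro continuous_intros)+
    (* compactness bounds t and keeps rate \<alpha>' \<alpha> * (t - s) away from 1 *)
    obtain q0 where q0: "q0 \<in> \<Delta>" "\<And>q. q \<in> \<Delta> \<Longrightarrow> ?r q \<le> ?r q0"
      using continuous_attains_sup[OF \<Delta>(1) False rc(1)] by blast
    obtain q1 where q1: "q1 \<in> \<Delta>" "\<And>q. q \<in> \<Delta> \<Longrightarrow> fst q \<le> fst q1"
      using continuous_attains_sup[OF \<Delta>(1) False rc(2)] by blast
    have dom: "0 \<le> s" "s \<le> t" "P.rate \<alpha>' \<alpha> * (t - s) < 1" if "(t, s) \<in> \<Delta>" for t s
      using subsetD[OF \<Delta>(2) that] P.fwd_dom_iff[OF \<alpha>] by auto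
    have \<rho>: "0 \<le> ?r q0" "?r q0 < 1"
      using dom[of "fst q0" "snd q0"] q0(1) P.rate_nonneg[OF \<alpha>] by auto
    have \<Delta>': "(t, s) \<in> tri2 (fst q1) \<and> P.rate \<alpha>' \<alpha> * (t - s) \<le> ?r q0" if "(t, s) \<in> \<Delta>" for t s
      using dom[OF that] q0(2)[OF that] q1(2)[OF that] by (simp add: tri2_def)
    show ?thesis
    proof (rule tendsto_zero_ennrealI)
      fix e :: real assume e: "e > 0"
      obtain N where N: "\<forall>n\<ge>N. \<forall>(t, s)\<in>\<Delta>. nm \<alpha>' (series (vn n) (bn n) t s k - series v b t s k) \<le> e"
        using series_convergent[OF pn p uv ub \<alpha> k \<rho> e \<Delta>'] by blast
      have "ennreal (nm \<alpha>' (Wn n t s \<alpha> \<alpha>' k - W t s \<alpha> \<alpha>' k)) \<le> ennreal e" if n: "n \<ge> N" and ts: "(t, s) \<in> \<Delta>" for n t s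
      proof -
        have "Wn n t s \<alpha> \<alpha>' k = series (vn n) (bn n) t s k"
          by (rule perturbation.perturbed_forward_unique[OF pn Wn[rule_format] Vn Bn vn_def bn_def \<alpha> subsetD[OF \<Delta>(2) ts] k])
        moreover have "W t s \<alpha> \<alpha>' k = series v b t s k"
          by (rule P.perturbed_forward_unique[OF W V B v_def b_def \<alpha> subsetD[OF \<Delta>(2) ts] k])
        moreover have "nm \<alpha>' (series (vn n) (bn n) t s k - series v b t s k) \<le> e"
          using N n ts by blast
        ultimately show ?thesis by (simp only: ennreal_leI)
      qed
      then show "\<exists>N. \<forall>n\<ge>N. (SUP (t, s)\<in>\<Delta>. ennreal (nm \<alpha>' (Wn n t s \<alpha> \<alpha>' k - W t s \<alpha> \<alpha>' k))) \<le> ennreal e"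
        by (intro exI[of _ N]) (auto intro!: SUP_least)
    qed
  qed
  show ?thesis
    using A1 B12 A24 A3 ex_n ex conv by blast
qed

end
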